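(* Let $(M,g)$ be a closed $n$-dimensional Einstein manifold, $n\ge3$, with positive scalar curvature, normalized so that $Ric(g)=(n-1)g$. Assume $g$ is a strict local minimizer for $\tilde{\mathcal F}_0$. Then there exists a $C^{2,\alpha}$-neighborhood $U$ of $g$ such that if $\tilde g\in U$ satisfies $Ric(\tilde g)\le(n-1)\tilde g$, then $\mathrm{Vol}(\tilde g)\ge\mathrm{Vol}(g)$, with equality if and only if $\tilde g=\phi^*g$ for some diffeomorphism $\phi:M\to M$.
   Context: $\tilde{\mathcal F}_0[g]=\mathrm{Vol}(g)^{\frac4n-1}\int_M|Ric_g|^2dV_g$. The metric $g$ is a strict local minimizer for $\tilde{\mathcal F}_0$ if there is a $C^{2,\alpha}$-neighborhood of $g$ in which $\tilde{\mathcal F}_0[\tilde g]\ge\tilde{\mathcal F}_0[g]$ for all metrics $\tilde g$, with equality if and only if $\tilde g=e^c\phi^*g$ for some $C^{3,\alpha}$-diffeomorphism $\phi:M\to M$ and constant $c\in\mathbb R$. The inequality $Ric(\tilde g)\le(n-1)\tilde g$ is in the sense of symmetric bilinear forms. *)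

theory Defs
  imports "HOL-Analysis.Analysis"
begin

definition partial_deriv ::
    "'n \<Rightarrow> (real^'n \<Rightarrow> 'b::real_normed_vector) \<Rightarrow> real^'n \<Rightarrow> 'b" where
  "partial_deriv i f x = frechet_derivative f (at x) (axis i 1)"

text \<open>\<open>Ck_on\<close>, \<open>smooth_on\<close> and \<open>holder_on\<close> are only meant for open sets \<open>S\<close>.\<close>

primrec Ck_on ::
    "nat \<Rightarrow> (real^'n) set \<Rightarrow> (real^'n \<Rightarrow> 'b::real_normed_vector) \<Rightarrow> bool" where
  "Ck_on 0 S f = continuous_on S f"
| "Ck_on (Suc k) S f =
     (f differentiable_on S \<and> (\<forall>i. Ck_on k S (partial_deriv i f)))"

definition smooth_on :: "(real^'n) set \<Rightarrow> (real^'n \<Rightarrow> 'b::real_normed_vector) \<Rightarrow> bool" where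
  "smooth_on S f = (\<forall>k. Ck_on k S f)"

text \<open>The class \<open>C\<^sup>k\<^sup>,\<^sup>\<alpha>\<close> is understood locally: the top order derivatives are
  \<open>\<alpha>\<close>-Hoelder continuous on every compact subset of \<open>S\<close>.\<close>

primrec holder_on ::
    "nat \<Rightarrow> real \<Rightarrow> (real^'n) set \<Rightarrow> (real^'n \<Rightarrow> 'b::real_normed_vector) \<Rightarrow> bool" where
  "holder_on 0 \<alpha> S f =
     (continuous_on S f \<and>
      (\<forall>K. compact K \<longrightarrow> K \<subseteq> S \<longrightarrow>
        (\<exists>C. \<forall>x\<in>K. \<forall>y\<in>K. norm (f x - f y) \<le> C * dist x y powr \<alpha>)))"
| "holder_on (Suc k) \<alpha> S f =
     (f differentiable_on S \<and> (\<forall>i. holder_on k \<alpha> S (partial_deriv i f)))"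

text \<open>The \<open>C\<^sup>k\<^sup>,\<^sup>\<alpha>(K)\<close> norm: the sum of the suprema over \<open>K\<close> of all partial derivatives of
  order at most \<open>k\<close> (one for each order of differentiation) and of the \<open>\<alpha>\<close>-Hoelder seminorms of those of order \<open>k\<close>.\<close>

primrec holder_norm ::
    "nat \<Rightarrow> real \<Rightarrow> (real^'n) set \<Rightarrow> (real^'n \<Rightarrow> 'b::real_normed_vector) \<Rightarrow> ennreal" where
  "holder_norm 0 \<alpha> K f =
     (SUP x\<in>K. ennreal (norm (f x))) +
     (SUP (x, y)\<in>{(x, y). x \<in> K \<and> y \<in> K \<and> x \<noteq> y}.
        ennreal (norm (f x - f y) / dist x y powr \<alpha>))"
| "holder_norm (Suc k) \<alpha> K f =
     (SUP x\<in>K. ennreal (norm (f x))) + (\<Sum>i\<in>UNIV. holder_norm k \<alpha> K (partial_deriv i f))"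

text \<open>A chart consists of its domain and a coordinate map, whose values outside the domain
  are irrelevant. The manifold is the whole type \<open>'a\<close>, its dimension is \<open>CARD('n)\<close>. As chart
  images are open in \<open>real^'n\<close>, there is no boundary.\<close>

type_synonym ('a, 'n) chart = "'a set \<times> ('a \<Rightarrow> real^'n)"

abbreviation chart_dom :: "('a, 'n) chart \<Rightarrow> 'a set" where
  "chart_dom c \<equiv> fst c"

abbreviation chart_map :: "('a, 'n) chart \<Rightarrow> 'a \<Rightarrow> real^'n" where
  "chart_map c \<equiv> snd c"

abbreviation chart_img :: "('a, 'n) chart \<Rightarrow> (real^'n) set" where
  "chart_img c \<equiv> chart_map c ` chart_dom c"

abbreviation chart_inv :: "('a, 'n) chart \<Rightarrow> real^'n \<Rightarrow> 'a" where
  "chart_inv c \<equiv> inv_into (chart_dom c) (chart_map c)"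

definition is_chart :: "('a::topological_space, 'n::finite) chart \<Rightarrow> bool" where
  "is_chart c \<longleftrightarrow>
     open (chart_dom c) \<and> open (chart_img c) \<and>
     homeomorphism (chart_dom c) (chart_img c) (chart_map c) (chart_inv c)"

definition smooth_atlas :: "('a::topological_space, 'n::finite) chart set \<Rightarrow> bool" where
  "smooth_atlas \<A> \<longleftrightarrow>
     (\<forall>c\<in>\<A>. is_chart c) \<and> (\<Union>c\<in>\<A>. chart_dom c) = UNIV \<and>
     (\<forall>c\<in>\<A>. \<forall>d\<in>\<A>.
        smooth_on (chart_map c ` (chart_dom c \<inter> chart_dom d)) (chart_map d \<circ> chart_inv c))"

definition closed_manifold :: "('a::t2_space, 'n::finite) chart set \<Rightarrow> bool" where
  "closed_manifold \<A> \<longleftrightarrow> compact (UNIV :: 'a set) \<and> smooth_atlas \<A>"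

definition holder_map ::
    "nat \<Rightarrow> real \<Rightarrow> ('a::topological_space, 'n::finite) chart set \<Rightarrow> ('a \<Rightarrow> 'a) \<Rightarrow> bool" where
  "holder_map k \<alpha> \<A> \<phi> \<longleftrightarrow>
     continuous_on UNIV \<phi> \<and>
     (\<forall>c\<in>\<A>. \<forall>d\<in>\<A>.
        holder_on k \<alpha> (chart_map c ` (chart_dom c \<inter> \<phi> -` chart_dom d))
          (chart_map d \<circ> \<phi> \<circ> chart_inv c))"

definition holder_diffeo ::
    "nat \<Rightarrow> real \<Rightarrow> ('a::topological_space, 'n::finite) chart set \<Rightarrow> ('a \<Rightarrow> 'a) \<Rightarrow> bool" where
  "holder_diffeo k \<alpha> \<A> \<phi> \<longleftrightarrow>
     bij \<phi> \<and> holder_map k \<alpha> \<A> \<phi> \<and> holder_map k \<alpha> \<A> (inv \<phi>)"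

definition jacobian ::
    "('a \<Rightarrow> 'a) \<Rightarrow> ('a, 'n::finite) chart \<Rightarrow> ('a, 'n) chart \<Rightarrow> 'a \<Rightarrow> real^'n^'n" where
  "jacobian \<phi> c d p =
     matrix (frechet_derivative (chart_map d \<circ> \<phi> \<circ> chart_inv c) (at (chart_map c p)))"

text \<open>A \<open>(0,2)\<close>-tensor field is given by its component matrix in each chart, as a function of
  the coordinates; only the values on the image of the chart are meaningful, so equality of
  tensor fields is \<open>tensor_eq\<close>.\<close>

type_synonym ('a, 'n) tensor2 = "('a, 'n) chart \<Rightarrow> real^'n \<Rightarrow> real^'n^'n"

definition tensor_eq ::
    "('a, 'n::finite) chart set \<Rightarrow> ('a, 'n) tensor2 \<Rightarrow> ('a, 'n) tensor2 \<Rightarrow> bool" where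
  "tensor_eq \<A> h k \<longleftrightarrow> (\<forall>c\<in>\<A>. \<forall>x\<in>chart_img c. h c x = k c x)"

definition tensor_le ::
    "('a, 'n::finite) chart set \<Rightarrow> ('a, 'n) tensor2 \<Rightarrow> ('a, 'n) tensor2 \<Rightarrow> bool" where
  "tensor_le \<A> h k \<longleftrightarrow>
     (\<forall>c\<in>\<A>. \<forall>x\<in>chart_img c. \<forall>v. v \<bullet> (h c x *v v) \<le> v \<bullet> (k c x *v v))"

definition riemannian_metric ::
    "('a, 'n::finite) chart set \<Rightarrow> ('a, 'n) tensor2 \<Rightarrow> bool" where
  "riemannian_metric \<A> g \<longleftrightarrow>
     (\<forall>c\<in>\<A>. \<forall>d\<in>\<A>. \<forall>p\<in>chart_dom c \<inter> chart_dom d.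
        g c (chart_map c p) =
          transpose (jacobian id c d p) ** g d (chart_map d p) ** jacobian id c d p) \<and>
     (\<forall>c\<in>\<A>. \<forall>x\<in>chart_img c.
        transpose (g c x) = g c x \<and> (\<forall>v. v \<noteq> 0 \<longrightarrow> v \<bullet> (g c x *v v) > 0))"

definition smooth_metric ::
    "('a, 'n::finite) chart set \<Rightarrow> ('a, 'n) tensor2 \<Rightarrow> bool" where
  "smooth_metric \<A> g \<longleftrightarrow>
     riemannian_metric \<A> g \<and> (\<forall>c\<in>\<A>. smooth_on (chart_img c) (g c))"

definition holder_metric ::
    "nat \<Rightarrow> real \<Rightarrow> ('a, 'n::finite) chart set \<Rightarrow> ('a, 'n) tensor2 \<Rightarrow> bool" where
  "holder_metric k \<alpha> \<A> g \<longleftrightarrow>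
     riemannian_metric \<A> g \<and> (\<forall>c\<in>\<A>. holder_on k \<alpha> (chart_img c) (g c))"

text \<open>The pullback \<open>\<phi>\<^sup>*g\<close>. The result does not depend on which chart around the image point
  is selected, because the components of \<open>g\<close> transform as a tensor.\<close>

definition pullback ::
    "('a, 'n::finite) chart set \<Rightarrow> ('a \<Rightarrow> 'a) \<Rightarrow> ('a, 'n) tensor2 \<Rightarrow> ('a, 'n) tensor2" where
  "pullback \<A> \<phi> g = (\<lambda>c x.
     let p = chart_inv c x; d = (SOME d. d \<in> \<A> \<and> \<phi> p \<in> chart_dom d); J = jacobian \<phi> c d p
     in transpose J ** g d (chart_map d (\<phi> p)) ** J)"

text \<open>Neighbourhoods in the \<open>C\<^sup>k\<^sup>,\<^sup>\<alpha>\<close> topology on the set of \<open>C\<^sup>k\<^sup>,\<^sup>\<alpha>\<close> metrics, which is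
  defined by the \<open>C\<^sup>k\<^sup>,\<^sup>\<alpha>\<close> norms of the components on compact subsets of chart images. On a
  closed manifold it is the topology of the usual norm for any finite choice of charts and
  compact sets whose interiors cover the manifold.\<close>

definition holder_nhd ::
    "nat \<Rightarrow> real \<Rightarrow> ('a, 'n::finite) chart set \<Rightarrow> ('a, 'n) tensor2 \<Rightarrow> ('a, 'n) tensor2 set \<Rightarrow> bool"
  where
  "holder_nhd k \<alpha> \<A> g U \<longleftrightarrow>
     U \<subseteq> Collect (holder_metric k \<alpha> \<A>) \<and>
     (\<exists>F \<epsilon>. finite F \<and> \<epsilon> > 0 \<and>
        (\<forall>(c, K)\<in>F. c \<in> \<A> \<and> compact K \<and> K \<subseteq> chart_img c) \<and>
        (\<forall>h. holder_metric k \<alpha> \<A> h \<longrightarrow>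
           (\<forall>(c, K)\<in>F. holder_norm k \<alpha> K (\<lambda>x. h c x - g c x) < \<epsilon>) \<longrightarrow> h \<in> U))"

text \<open>For the component matrix \<open>G\<close> of a metric in a chart, \<open>christoffel G k i j\<close> is
  \<open>\<Gamma>\<close> with upper index \<open>k\<close> and lower indices \<open>i\<close>, \<open>j\<close>; \<open>riemann G l i j k\<close> is the coefficient
  of \<open>\<partial>\<^sub>l\<close> in \<open>R(\<partial>\<^sub>i, \<partial>\<^sub>j)\<partial>\<^sub>k\<close>, and the Ricci tensor is the trace
  of \<open>X \<mapsto> R(X, \<partial>\<^sub>i)\<partial>\<^sub>j\<close>, so that round spheres have positive Ricci curvature.\<close>

definition christoffel ::
    "(real^'n \<Rightarrow> real^'n^'n) \<Rightarrow> 'n::finite \<Rightarrow> 'n \<Rightarrow> 'n \<Rightarrow> real^'n \<Rightarrow> real" where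
  "christoffel G k i j x =
     (\<Sum>l\<in>UNIV. matrix_inv (G x) $ k $ l *
        (partial_deriv i (\<lambda>y. G y $ j $ l) x + partial_deriv j (\<lambda>y. G y $ i $ l) x
         - partial_deriv l (\<lambda>y. G y $ i $ j) x)) / 2"

definition riemann ::
    "(real^'n \<Rightarrow> real^'n^'n) \<Rightarrow> 'n::finite \<Rightarrow> 'n \<Rightarrow> 'n \<Rightarrow> 'n \<Rightarrow> real^'n \<Rightarrow> real" where
  "riemann G l i j k x =
     partial_deriv i (christoffel G l j k) x - partial_deriv j (christoffel G l i k) x
     + (\<Sum>m\<in>UNIV. christoffel G m j k x * christoffel G l i m x
                    - christoffel G m i k x * christoffel G l j m x)"

definition ricci :: "('a, 'n::finite) tensor2 \<Rightarrow> ('a, 'n) tensor2" where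
  "ricci g = (\<lambda>c x. \<chi> i j. \<Sum>l\<in>UNIV. riemann (g c) l l i j x)"

text \<open>The squared norm \<open>|h|\<^sup>2\<close> with respect to \<open>g\<close> at a point, which does not depend on the
  chart selected to compute it if \<open>g\<close> and \<open>h\<close> are tensors.\<close>

definition tensor_norm_sq ::
    "('a, 'n::finite) chart set \<Rightarrow> ('a, 'n) tensor2 \<Rightarrow> ('a, 'n) tensor2 \<Rightarrow> 'a \<Rightarrow> real" where
  "tensor_norm_sq \<A> g h p =
     (let c = (SOME c. c \<in> \<A> \<and> p \<in> chart_dom c); x = chart_map c p;
          I = matrix_inv (g c x); H = h c x
      in \<Sum>i\<in>UNIV. \<Sum>j\<in>UNIV. \<Sum>k\<in>UNIV. \<Sum>l\<in>UNIV. I $ i $ k * I $ j $ l * H $ i $ j * H $ k $ l)"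

text \<open>The Riemannian measure is the unique Borel measure which in every chart is given by
  the density \<open>sqrt (det g)\<close>.\<close>

definition riem_measure ::
    "('a::topological_space, 'n::finite) chart set \<Rightarrow> ('a, 'n) tensor2 \<Rightarrow> 'a measure" where
  "riem_measure \<A> g =
     (THE \<mu>. sets \<mu> = sets borel \<and>
        (\<forall>c\<in>\<A>. \<forall>B\<in>sets borel. B \<subseteq> chart_dom c \<longrightarrow>
           emeasure \<mu> B =
             (\<integral>\<^sup>+x\<in>chart_map c ` B. ennreal (sqrt (det (g c x))) \<partial>lborel)))"

definition vol ::
    "('a::topological_space, 'n::finite) chart set \<Rightarrow> ('a, 'n) tensor2 \<Rightarrow> real" where
  "vol \<A> g = measure (riem_measure \<A> g) UNIV"

definition ricci_functional ::
    "('a::topological_space, 'n::finite) chart set \<Rightarrow> ('a, 'n) tensor2 \<Rightarrow> real" where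
  "ricci_functional \<A> g =
     vol \<A> g powr (4 / real CARD('n) - 1) *
     (\<integral>p. tensor_norm_sq \<A> g (ricci g) p \<partial>riem_measure \<A> g)"

definition strict_local_minimizer ::
    "real \<Rightarrow> ('a::topological_space, 'n::finite) chart set \<Rightarrow> ('a, 'n) tensor2 \<Rightarrow> bool" where
  "strict_local_minimizer \<alpha> \<A> g \<longleftrightarrow>
     (\<exists>U. holder_nhd 2 \<alpha> \<A> g U \<and>
        (\<forall>h\<in>U. ricci_functional \<A> h \<ge> ricci_functional \<A> g \<and>
           (ricci_functional \<A> h = ricci_functional \<A> g \<longleftrightarrow>
              (\<exists>\<phi> s. holder_diffeo 3 \<alpha> \<A> \<phi> \<and>
                 tensor_eq \<A> h (\<lambda>c x. exp s *\<^sub>R pullback \<A> \<phi> g c x)))))"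

end

theory Submission
  imports Defs
begin

text \<open>Near \<open>g\<close> the eigenvalues of \<open>Ric(h)\<close> with respect to \<open>h\<close> stay above \<open>-(n - 1)\<close>, because they
  are close to those of \<open>Ric(g)\<close>, which equal \<open>n - 1\<close>. Together with \<open>Ric(h) \<le> (n - 1) h\<close> this gives
  \<open>|Ric(h)|\<^sup>2 \<le> n (n - 1)\<^sup>2\<close>, so the functional at \<open>h\<close> is at most \<open>n (n - 1)\<^sup>2 Vol(h) powr (4 / n)\<close>,
  with equality at \<open>g\<close>. Minimality of \<open>g\<close> forces \<open>Vol(g) \<le> Vol(h)\<close>. If the volumes agree, so do the
  functionals, hence \<open>h = exp s \<phi>\<^sup>*g\<close> by strictness, and \<open>Vol(h) = exp (n s / 2) Vol(g)\<close>
  yields \<open>s = 0\<close>.\<close>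

text \<open>Tensors are given by components in charts, and three objects are picked blindly: the
  chart in \<open>tensor_norm_sq\<close>, the chart in \<open>pullback\<close> and the measure in
  \<open>riem_measure\<close>. Showing that these choices are harmless takes most of the work.
  Closeness to \<open>g\<close> yields the lower Ricci bound only in the charts of a finite compact
  cover, while \<open>tensor_norm_sq\<close> may use another chart; the transformation law of
  \<open>ricci\<close> carries the bound over. The measure is glued from chart volumes, which agree
  on overlaps by change of variables, and its uniqueness then identifies the measure of a rescaled
  pullback. A competitor \<open>h\<close> has only two derivatives, so its curvature law and the
  symmetry of its Ricci tensor are derived from pointwise second derivatives. Eigenvalues never
  appear: in a frame orthonormal for \<open>h\<close> a two-sided bound on the Ricci form bounds
  each of the n columns of its matrix. The exponent 4/n - 1 turns a constant integrand into a
  constant times the increasing function Vol^(4/n), and this is what lets minimality compare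
  volumes.\<close>

section \<open>Change of variables over an arbitrary finite index type\<close>

text \<open>The change of variables theorem of HOL-Analysis requires a well-ordered index type;
  this copy of a finite type has an arbitrarily chosen well-order.\<close>

typedef 'a ordered_index = "UNIV :: 'a set" morphisms of_ordered to_ordered
  by simp

lemma bij_of_ordered: "bij of_ordered"
  by (metis bijI' of_ordered_inject to_ordered_inverse UNIV_I)

lemma bij_to_ordered: "bij to_ordered"
  by (metis bijI' to_ordered_inject of_ordered_inverse UNIV_I)

instance ordered_index :: (finite) finite
proof
  have "range (to_ordered :: 'a \<Rightarrow> 'a ordered_index) = UNIV"
    using bij_to_ordered by (rule bij_is_surj)
  then show "finite (UNIV :: 'a ordered_index set)"
    by (metis finite finite_imageI)
qed

instantiation ordered_index :: (finite) wellorder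
begin

definition less_eq_ordered_index :: "'a ordered_index \<Rightarrow> 'a ordered_index \<Rightarrow> bool" where
  "less_eq_ordered_index x y \<longleftrightarrow>
     to_nat_on UNIV (of_ordered x) \<le> to_nat_on UNIV (of_ordered y)"

definition less_ordered_index :: "'a ordered_index \<Rightarrow> 'a ordered_index \<Rightarrow> bool" where
  "less_ordered_index x y \<longleftrightarrow>
     to_nat_on UNIV (of_ordered x) < to_nat_on UNIV (of_ordered y)"

instance
proof
  fix x y :: "'a ordered_index"
  have inj: "inj (to_nat_on (UNIV :: 'a set))"
    by (intro inj_on_to_nat_on countable_finite finite)
  show "x = y" if "x \<le> y" "y \<le> x"
    using that inj by (simp add: less_eq_ordered_index_def inj_eq of_ordered_inject)
next
  fix P :: "'a ordered_index \<Rightarrow> bool" and a :: "'a ordered_index"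
  assume step: "\<And>x. (\<And>y. y < x \<Longrightarrow> P y) \<Longrightarrow> P x"
  show "P a"
    by (induction a rule: measure_induct_rule[where f = "\<lambda>a. to_nat_on UNIV (of_ordered a)"])
      (auto intro: step simp: less_ordered_index_def)
qed (auto simp: less_eq_ordered_index_def less_ordered_index_def)

end

text \<open>Absolute integrability transfers in both directions, so for nonnegative integrands
  either both sides are finite and equal to the same integral, or both are infinite. The real
  integrand is wrapped into \<open>real^1\<close> because the underlying theorem is about
  vector-valued functions.\<close>

lemma nn_integral_change_of_variables_wellorder:
  fixes \<psi> :: "real^'m::{finite,wellorder} \<Rightarrow> real^'m::_" and f :: "real^'m::_ \<Rightarrow> real"
  assumes S: "S \<in> sets borel" and T: "\<psi> ` S \<in> sets borel"
    and der: "\<And>x. x \<in> S \<Longrightarrow> (\<psi> has_derivative \<psi>' x) (at x)"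
    and inj: "inj_on \<psi> S"
    and f: "\<And>y. y \<in> \<psi> ` S \<Longrightarrow> 0 \<le> f y"
    and mf: "(\<lambda>y. indicator (\<psi> ` S) y *\<^sub>R f y) \<in> borel_measurable borel"
    and mh: "(\<lambda>x. indicator S x *\<^sub>R (\<bar>det (matrix (\<psi>' x))\<bar> * f (\<psi> x))) \<in> borel_measurable borel"
  shows "(\<integral>\<^sup>+x\<in>S. ennreal (\<bar>det (matrix (\<psi>' x))\<bar> * f (\<psi> x)) \<partial>lborel) =
         (\<integral>\<^sup>+y\<in>\<psi> ` S. ennreal (f y) \<partial>lborel)"
proof -
  define h where "h x = \<bar>det (matrix (\<psi>' x))\<bar> * f (\<psi> x)" for x
  have hnn: "0 \<le> h x" if "x \<in> S" for x
    using f that by (simp add: h_def)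
  have key: "(h absolutely_integrable_on S \<and> integral S h = b) \<longleftrightarrow>
      (f absolutely_integrable_on \<psi> ` S \<and> integral (\<psi> ` S) f = b)" for b
  proof -
    have *: "(\<lambda>x. \<bar>det (matrix (\<psi>' x))\<bar> *\<^sub>R (vec (f (\<psi> x)) :: real^1)) = (\<lambda>x. vec (h x))"
      by (simp add: h_def fun_eq_iff vec_eq_iff)
    have "S \<in> sets lebesgue"
      using S by simp
    from has_absolute_integral_change_of_variables [OF this has_derivative_at_withinI[OF der] inj,
        of "\<lambda>y. vec (f y) :: real^1" "vec b"]
    show ?thesis
      unfolding * by (simp add: absolutely_integrable_on_1_iff integral_on_1_eq)
  qed
  \<comment> \<open>Dictionary between absolute integrability and finiteness of the
    \<open>nn_integral\<close>, used once on \<open>S\<close> and once on its image.\<close>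
  have nn: "(k absolutely_integrable_on A \<longleftrightarrow> (\<integral>\<^sup>+x\<in>A. ennreal (k x) \<partial>lborel) < \<infinity>) \<and>
      (k absolutely_integrable_on A \<longrightarrow>
         (\<integral>\<^sup>+x\<in>A. ennreal (k x) \<partial>lborel) = ennreal (integral A k))"
    if A: "A \<in> sets borel" and k: "\<And>x. x \<in> A \<Longrightarrow> 0 \<le> k x"
      and m: "(\<lambda>x. indicator A x *\<^sub>R k x) \<in> borel_measurable borel"
    for A and k :: "real^'m::_ \<Rightarrow> real"
  proof -
    have eq: "(\<integral>\<^sup>+x\<in>A. ennreal (k x) \<partial>lborel) = (\<integral>\<^sup>+x. ennreal (indicator A x *\<^sub>R k x) \<partial>lborel)"
      by (intro nn_integral_cong) (auto split: split_indicator)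
    have pos: "0 \<le> indicator A x *\<^sub>R k x" for x
      using k by (auto split: split_indicator)
    have int: "k absolutely_integrable_on A \<longleftrightarrow> integrable lborel (\<lambda>x. indicator A x *\<^sub>R k x)"
      unfolding set_integrable_def using m by (subst integrable_completion) auto
    have 1: "integrable lborel (\<lambda>x. indicator A x *\<^sub>R k x) \<longleftrightarrow>
        (\<integral>\<^sup>+x. ennreal (indicator A x *\<^sub>R k x) \<partial>lborel) < \<infinity>"
      using m pos by (subst integrable_iff_bounded) (simp add: abs_of_nonneg)
    have 2: "(\<integral>\<^sup>+x. ennreal (indicator A x *\<^sub>R k x) \<partial>lborel) = ennreal (integral A k)"
      if "k absolutely_integrable_on A"
    proof -
      have "(\<integral>\<^sup>+x. ennreal (indicator A x *\<^sub>R k x) \<partial>lborel) =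
          ennreal (\<integral>x. indicator A x *\<^sub>R k x \<partial>lborel)"
        using that pos by (intro nn_integral_eq_integral) (auto simp: int)
      also have "(\<integral>x. indicator A x *\<^sub>R k x \<partial>lborel) = (LINT x:A|lebesgue. k x)"
        unfolding set_lebesgue_integral_def using m by (subst integral_completion) auto
      also have "\<dots> = integral A k"
        using that by (rule set_lebesgue_integral_eq_integral)
      finally show ?thesis .
    qed
    show ?thesis
      unfolding eq using int 1 2 by blast
  qed
  note nS = nn[OF S hnn mh[folded h_def]] and nT = nn[OF T f mf]
  have "(\<integral>\<^sup>+x\<in>S. ennreal (h x) \<partial>lborel) = (\<integral>\<^sup>+y\<in>\<psi> ` S. ennreal (f y) \<partial>lborel)"
  proof (cases "h absolutely_integrable_on S")
    case True
    then show ?thesis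
      using key[of "integral S h"] nS nT by simp
  next
    case False
    then have "\<not> f absolutely_integrable_on \<psi> ` S"
      using key by blast
    then show ?thesis
      using False nS nT by (simp add: not_less top_unique)
  qed
  then show ?thesis
    unfolding h_def .
qed

text \<open>Conjugation by \<open>f\<close> matches the permutations of the two index types and
  preserves signs, so the two Leibniz sums agree term by term.\<close>

lemma det_reindex:
  fixes A :: "real^'n^'n" and f :: "'m::finite \<Rightarrow> 'n::finite"
  assumes "bij f"
  shows "det (\<chi> i j. A $ f i $ f j) = det A"
proof -
  have bij: "bij_betw (map_permutation UNIV f) {p. p permutes UNIV} {p. p permutes UNIV}"
  proof (rule bij_betwI[where g = "map_permutation UNIV (inv f)"])
    have inv: "bij (inv f)"
      using assms by (simp add: bij_imp_bij_inv)
    show "map_permutation UNIV f \<in> {p. p permutes UNIV} \<rightarrow> {p. p permutes UNIV}"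
      using map_permutation_permutes[where f = f and A = UNIV and B = UNIV] assms by auto
    show "map_permutation UNIV (inv f) \<in> {p. p permutes UNIV} \<rightarrow> {p. p permutes UNIV}"
      using map_permutation_permutes[where f = "inv f" and A = UNIV and B = UNIV] inv by auto
    show "map_permutation UNIV (inv f) (map_permutation UNIV f p) = p"
      if "p \<in> {p. p permutes UNIV}" for p
      using that assms map_permutation_compose_inv[where f = f and A = UNIV and B = UNIV and p = p and g = "inv f"]
      by (auto simp: bij_is_inj)
    show "map_permutation UNIV f (map_permutation UNIV (inv f) p) = p"
      if "p \<in> {p. p permutes UNIV}" for p
      using that inv map_permutation_compose_inv[where f = "inv f" and A = UNIV and B = UNIV and p = p and g = f] assms
      by (auto simp: bij_is_surj surj_f_inv_f)
  qed
  have "det A = (\<Sum>p | p permutes (UNIV :: 'm set). of_int (sign (map_permutation UNIV f p)) *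
      (\<Prod>i\<in>UNIV. A $ i $ map_permutation UNIV f p i))"
    unfolding det_def by (rule sum.reindex_bij_betw[OF bij, symmetric])
  also have "\<dots> = (\<Sum>p | p permutes (UNIV :: 'm set). of_int (sign p) *
      (\<Prod>i\<in>UNIV. A $ f i $ f (p i)))"
  proof (rule sum.cong)
    fix p :: "'m \<Rightarrow> 'm"
    assume "p \<in> {p. p permutes UNIV}"
    then have p: "p permutes UNIV"
      by simp
    have "sign (map_permutation UNIV f p) = sign p"
      using p assms by (intro sign_map_permutation) (auto simp: bij_is_inj)
    moreover have "(\<Prod>i\<in>UNIV. A $ i $ map_permutation UNIV f p i) =
        (\<Prod>i\<in>UNIV. A $ f i $ map_permutation UNIV f p (f i))"
      using prod.reindex_bij_betw[OF assms, of "\<lambda>i. A $ i $ map_permutation UNIV f p i"] by simp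
    moreover have "map_permutation UNIV f p (f i) = f (p i)" for i
      using assms by (intro map_permutation_apply) (auto simp: bij_is_inj)
    ultimately show "of_int (sign (map_permutation UNIV f p)) *
        (\<Prod>i\<in>UNIV. A $ i $ map_permutation UNIV f p i) =
        of_int (sign p) * (\<Prod>i\<in>UNIV. A $ f i $ f (p i))"
      by simp
  qed simp
  finally show ?thesis
    by (simp add: det_def)
qed

section \<open>Relabelling the coordinates of Euclidean space\<close>

definition reindex :: "('m::finite \<Rightarrow> 'n::finite) \<Rightarrow> real^'n \<Rightarrow> real^'m" where
  "reindex f v = (\<chi> i. v $ f i)"

lemma linear_reindex: "linear (reindex f)"
  by (rule linearI) (simp_all add: reindex_def vec_eq_iff)

lemma reindex_inv:
  assumes "bij f"
  shows "reindex (inv f) (reindex f v) = v" "reindex f (reindex (inv f) w) = w"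
  using assms
  by (simp_all add: reindex_def vec_eq_iff bij_is_inj bij_is_surj surj_f_inv_f)

lemma measurable_reindex [measurable]: "reindex f \<in> borel_measurable borel"
  by (intro borel_measurable_continuous_onI linear_continuous_on linear_conv_bounded_linear[THEN iffD1]
      linear_reindex)

lemma prod_Basis_cart: "(\<Prod>b\<in>Basis. w \<bullet> b) = (\<Prod>i\<in>UNIV. w $ i)" for w :: "real^'k"
proof -
  have "inj (\<lambda>i::'k. axis i (1::real))"
    by (auto simp: inj_on_def axis_eq_axis)
  moreover have B: "(Basis :: (real^'k) set) = range (\<lambda>i. axis i 1)"
    by (auto simp: Basis_vec_def)
  ultimately show ?thesis
    unfolding B by (subst prod.reindex) (simp_all add: inner_axis)
qed

text \<open>\<open>lborel\<close> is determined by its values on boxes, and relabelling the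
  coordinates only permutes the side lengths of a box.\<close>

lemma lborel_reindex:
  fixes f :: "'m::finite \<Rightarrow> 'n::finite"
  assumes "bij f"
  shows "distr lborel borel (reindex f) = lborel"
proof (rule lborel_eqI[symmetric])
  fix l u :: "real^'m"
  assume lu: "\<And>b. b \<in> Basis \<Longrightarrow> l \<bullet> b \<le> u \<bullet> b"
  have le: "l $ i \<le> u $ i" for i
    using lu[of "axis i 1"] by (simp add: axis_in_Basis_iff inner_axis)
  have "reindex f -` box l u = box (reindex (inv f) l) (reindex (inv f) u)"
  proof (intro set_eqI)
    fix x
    have "(\<forall>i. l $ i < x $ f i \<and> x $ f i < u $ i) \<longleftrightarrow>
        (\<forall>j. l $ inv f j < x $ j \<and> x $ j < u $ inv f j)"
      using assms by (metis bij_inv_eq_iff)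
    then show "x \<in> reindex f -` box l u \<longleftrightarrow> x \<in> box (reindex (inv f) l) (reindex (inv f) u)"
      by (simp add: mem_box_cart reindex_def)
  qed
  moreover have "(\<Prod>j\<in>UNIV. u $ inv f j - l $ inv f j) = (\<Prod>i\<in>UNIV. u $ i - l $ i)"
    using prod.reindex_bij_betw[OF bij_imp_bij_inv[OF assms], of "\<lambda>i. u $ i - l $ i"] by simp
  moreover have "reindex (inv f) l \<bullet> b \<le> reindex (inv f) u \<bullet> b" if "b \<in> Basis" for b
    using that le by (auto simp: Basis_vec_def inner_axis reindex_def)
  ultimately show "emeasure (distr lborel borel (reindex f)) (box l u) = (\<Prod>b\<in>Basis. (u - l) \<bullet> b)"
    by (simp add: emeasure_distr emeasure_lborel_box prod_Basis_cart) (simp add: reindex_def)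
qed simp

lemma nn_integral_reindex:
  assumes "bij f" and "g \<in> borel_measurable borel"
  shows "(\<integral>\<^sup>+x. g (reindex f x) \<partial>lborel) = (\<integral>\<^sup>+y. g y \<partial>lborel)"
proof -
  have "(\<integral>\<^sup>+y. g y \<partial>lborel) = (\<integral>\<^sup>+y. g y \<partial>distr lborel borel (reindex f))"
    by (simp add: lborel_reindex[OF assms(1)])
  also have "\<dots> = (\<integral>\<^sup>+x. g (reindex f x) \<partial>lborel)"
    using assms(2) by (subst nn_integral_distr) auto
  finally show ?thesis
    by simp
qed


text \<open>Conjugating \<open>\<psi>\<close> with the relabellings \<open>P\<close> and
  \<open>Q\<close> moves the problem to the well-ordered copy of the index type. Both the Jacobian
  determinant and the integrals survive this, by \<open>det_reindex\<close> and
  \<open>nn_integral_reindex\<close>.\<close>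

theorem nn_integral_change_of_variables:
  fixes \<psi> :: "real^'n::finite \<Rightarrow> real^'n" and f :: "real^'n \<Rightarrow> real"
  assumes S: "S \<in> sets borel" and T: "\<psi> ` S \<in> sets borel"
    and der: "\<And>x. x \<in> S \<Longrightarrow> (\<psi> has_derivative \<psi>' x) (at x)"
    and inj: "inj_on \<psi> S"
    and f: "\<And>y. y \<in> \<psi> ` S \<Longrightarrow> 0 \<le> f y"
    and mf: "(\<lambda>y. indicator (\<psi> ` S) y *\<^sub>R f y) \<in> borel_measurable borel"
    and mh: "(\<lambda>x. indicator S x *\<^sub>R (\<bar>det (matrix (\<psi>' x))\<bar> * f (\<psi> x))) \<in> borel_measurable borel"
  shows "(\<integral>\<^sup>+x\<in>S. ennreal (\<bar>det (matrix (\<psi>' x))\<bar> * f (\<psi> x)) \<partial>lborel) =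
         (\<integral>\<^sup>+y\<in>\<psi> ` S. ennreal (f y) \<partial>lborel)"
proof -
  let ?o = "of_ordered :: 'n ordered_index \<Rightarrow> 'n"
  define P where "P = reindex ?o"
  define Q where "Q = reindex (inv ?o)"
  note bij = bij_of_ordered[where 'a = 'n]
  note bij' = bij_imp_bij_inv[OF bij]
  have QP [simp]: "Q (P x) = x" and PQ [simp]: "P (Q y) = y" for x y
    unfolding P_def Q_def by (simp_all add: reindex_inv bij)
  have linP: "linear P" and linQ: "linear Q"
    unfolding P_def Q_def by (rule linear_reindex)+
  have [measurable]: "P \<in> borel_measurable borel" "Q \<in> borel_measurable borel"
    unfolding P_def Q_def by measurable
  define S1 where "S1 = Q -` S"
  define \<phi> where "\<phi> = P \<circ> \<psi> \<circ> Q"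
  define \<phi>' where "\<phi>' x = P \<circ> \<psi>' (Q x) \<circ> Q" for x
  have img: "\<phi> ` S1 = Q -` (\<psi> ` S)"
  proof (intro set_eqI iffI)
    fix y
    assume "y \<in> Q -` (\<psi> ` S)"
    then obtain x where "x \<in> S" "Q y = \<psi> x"
      by auto
    then have "P x \<in> S1" "\<phi> (P x) = y"
      by (simp_all add: S1_def \<phi>_def) (metis PQ)
    then show "y \<in> \<phi> ` S1"
      by blast
  qed (auto simp: S1_def \<phi>_def)
  have "bounded_linear P" "bounded_linear Q"
    using linP linQ by (simp_all add: linear_conv_bounded_linear)
  note bl = this
  have der1: "(\<phi> has_derivative \<phi>' x) (at x)" if "x \<in> S1" for x
  proof -
    have "(\<psi> has_derivative \<psi>' (Q x)) (at (Q x))"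
      using that der by (simp add: S1_def)
    then have "(\<psi> \<circ> Q has_derivative \<psi>' (Q x) \<circ> Q) (at x)"
      using bl by (intro diff_chain_at bounded_linear_imp_has_derivative)
    then show ?thesis
      unfolding \<phi>_def \<phi>'_def comp_assoc
      using bl by (elim diff_chain_at) (rule bounded_linear_imp_has_derivative)
  qed
  have inj1: "inj_on \<phi> S1"
    using inj by (auto simp: inj_on_def \<phi>_def S1_def) (metis PQ QP)
  have axQ: "Q (axis j 1) = axis (?o j) 1" for j
    by (simp add: Q_def reindex_def vec_eq_iff axis_def bij_inv_eq_iff[OF bij] eq_commute)
  have "matrix (\<phi>' x) = (\<chi> i j. matrix (\<psi>' (Q x)) $ ?o i $ ?o j)" for x
    by (simp add: axQ vec_eq_iff matrix_def \<phi>'_def) (simp add: P_def reindex_def)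
  then have det1: "det (matrix (\<phi>' x)) = det (matrix (\<psi>' (Q x)))" for x
    by (simp add: det_reindex[OF bij])
  have [measurable]: "S1 \<in> sets borel" "Q -` (\<psi> ` S) \<in> sets borel"
    unfolding S1_def using S T
    by (auto intro: measurable_sets_borel[OF \<open>Q \<in> borel_measurable borel\<close>])
  have mf1: "(\<lambda>y. indicator (\<phi> ` S1) y *\<^sub>R f (Q y)) \<in> borel_measurable borel"
    using measurable_compose[OF _ mf, of Q borel] by (simp add: img indicator_vimage)
  have mh1: "(\<lambda>x. indicator S1 x *\<^sub>R (\<bar>det (matrix (\<phi>' x))\<bar> * f (Q (\<phi> x)))) \<in> borel_measurable borel"
    using measurable_compose[OF _ mh, of Q borel]
    by (simp add: S1_def indicator_vimage det1) (simp add: \<phi>_def)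
  have "(\<integral>\<^sup>+x\<in>S1. ennreal (\<bar>det (matrix (\<phi>' x))\<bar> * f (Q (\<phi> x))) \<partial>lborel) =
         (\<integral>\<^sup>+y\<in>\<phi> ` S1. ennreal (f (Q y)) \<partial>lborel)"
    by (rule nn_integral_change_of_variables_wellorder[OF _ _ der1 inj1 _ mf1 mh1])
      (auto simp: img f)
  moreover have "(\<integral>\<^sup>+y\<in>\<phi> ` S1. ennreal (f (Q y)) \<partial>lborel) = (\<integral>\<^sup>+y\<in>\<psi> ` S. ennreal (f y) \<partial>lborel)"
  proof -
    have "(\<lambda>y. ennreal (indicator (\<psi> ` S) y *\<^sub>R f y)) \<in> borel_measurable borel"
      using mf by measurable
    also have "(\<lambda>y. ennreal (indicator (\<psi> ` S) y *\<^sub>R f y)) =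
        (\<lambda>y. ennreal (f y) * indicator (\<psi> ` S) y)"
      by (auto split: split_indicator)
    finally show ?thesis
      using nn_integral_reindex[OF bij', of "\<lambda>y. ennreal (f y) * indicator (\<psi> ` S) y"]
      by (simp add: img Q_def[symmetric] indicator_vimage)
  qed
  moreover have "(\<integral>\<^sup>+x\<in>S1. ennreal (\<bar>det (matrix (\<phi>' x))\<bar> * f (Q (\<phi> x))) \<partial>lborel) =
      (\<integral>\<^sup>+x\<in>S. ennreal (\<bar>det (matrix (\<psi>' x))\<bar> * f (\<psi> x)) \<partial>lborel)"
  proof -
    let ?h = "\<lambda>x. \<bar>det (matrix (\<psi>' x))\<bar> * f (\<psi> x)"
    have "(\<lambda>x. ennreal (indicator S x *\<^sub>R ?h x)) \<in> borel_measurable borel"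
      using mh by measurable
    also have "(\<lambda>x. ennreal (indicator S x *\<^sub>R ?h x)) = (\<lambda>x. ennreal (?h x) * indicator S x)"
      by (auto split: split_indicator)
    finally show ?thesis
      using nn_integral_reindex[OF bij', of "\<lambda>x. ennreal (?h x) * indicator S x"]
      by (simp add: S1_def det1 \<phi>_def Q_def[symmetric] indicator_vimage)
  qed
  ultimately show ?thesis
    by simp
qed

section \<open>Positive definite matrices\<close>

definition pos_def :: "real^'n^'n \<Rightarrow> bool" where
  "pos_def G \<longleftrightarrow> transpose G = G \<and> (\<forall>v. v \<noteq> 0 \<longrightarrow> v \<bullet> (G *v v) > 0)"

lemma inner_matrix_vector_symmetric:
  fixes A :: "real^'n^'n"
  assumes "transpose A = A"
  shows "u \<bullet> (A *v v) = v \<bullet> (A *v u)"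
  by (metis assms dot_lmul_matrix inner_commute transpose_matrix_vector)

text \<open>Gram-Schmidt for the inner product of \<open>G\<close>. As long as fewer than
  \<open>CARD('n)\<close> vectors have been found, their span is proper, so there is a vector to
  start the next step from.\<close>

lemma pos_def_orthonormal_family:
  fixes G :: "real^'n^'n"
  assumes "pos_def G" and "finite I" and "card I \<le> CARD('n)"
  shows "\<exists>b. \<forall>i\<in>I. \<forall>j\<in>I. b i \<bullet> (G *v b j) = (if i = j then 1 else 0 :: real)"
  using assms(2,3)
proof (induction I rule: finite_induct)
  case empty
  then show ?case
    by simp
next
  case (insert k I)
  then obtain b where b: "\<And>i j. i \<in> I \<Longrightarrow> j \<in> I \<Longrightarrow> b i \<bullet> (G *v b j) = (if i = j then 1 else 0)"
    by force
  have sym: "transpose G = G" and pos: "\<And>v. v \<noteq> 0 \<Longrightarrow> v \<bullet> (G *v v) > 0"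
    using assms(1) by (auto simp: pos_def_def)
  have "span (b ` I) \<noteq> UNIV"
  proof
    assume "span (b ` I) = UNIV"
    then have "CARD('n) \<le> card (b ` I)"
      using dim_le_card[of UNIV "b ` I"] insert by simp
    also have "\<dots> \<le> card I"
      using insert by (simp add: card_image_le)
    finally show False
      using insert by simp
  qed
  then obtain v where v: "v \<notin> span (b ` I)"
    by blast
  define w where "w = v - (\<Sum>i\<in>I. (b i \<bullet> (G *v v)) *\<^sub>R b i)"
  have "w \<noteq> 0"
  proof
    assume "w = 0"
    then have "v = (\<Sum>i\<in>I. (b i \<bullet> (G *v v)) *\<^sub>R b i)"
      by (simp add: w_def)
    also have "\<dots> \<in> span (b ` I)"
      by (intro span_sum span_scale span_base imageI)
    finally show False
      using v by simp
  qed
  define N where "N = w \<bullet> (G *v w)"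
  have N: "N > 0"
    using pos \<open>w \<noteq> 0\<close> by (simp add: N_def)
  have orth: "b j \<bullet> (G *v w) = 0" if "j \<in> I" for j
  proof -
    have "b j \<bullet> (G *v w) = b j \<bullet> (G *v v) - (\<Sum>i\<in>I. (b i \<bullet> (G *v v)) * (b j \<bullet> (G *v b i)))"
      by (simp add: w_def matrix_vector_mult_diff_distrib inner_diff_right
          linear_sum[OF matrix_vector_mul_linear] matrix_vector_mult_scaleR inner_sum_right)
    also have "(\<Sum>i\<in>I. (b i \<bullet> (G *v v)) * (b j \<bullet> (G *v b i))) = (\<Sum>i\<in>I. if i = j then b j \<bullet> (G *v v) else 0)"
      using that b by (intro sum.cong) auto
    also have "\<dots> = b j \<bullet> (G *v v)"
      using that insert by simp
    finally show ?thesis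
      by simp
  qed
  define c where "c = b(k := w /\<^sub>R sqrt N)"
  have "c i \<bullet> (G *v c j) = (if i = j then 1 else 0)" if "i \<in> insert k I" "j \<in> insert k I" for i j
  proof -
    have "w \<bullet> (G *v b j) = 0" if "j \<in> I" for j
      using orth[OF that] inner_matrix_vector_symmetric[OF sym, of w "b j"] by simp
    moreover have "(w /\<^sub>R sqrt N) \<bullet> (G *v (w /\<^sub>R sqrt N)) = 1"
    proof -
      have "(w /\<^sub>R sqrt N) \<bullet> (G *v (w /\<^sub>R sqrt N)) = N / (sqrt N * sqrt N)"
        by (simp add: matrix_vector_mult_scaleR N_def field_simps)
      then show ?thesis
        using N by simp
    qed
    ultimately show ?thesis
      using that b orth \<open>k \<notin> I\<close> by (auto simp: c_def matrix_vector_mult_scaleR)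
  qed
  then show ?case
    by blast
qed

text \<open>The columns of \<open>S\<close> form a basis orthonormal for \<open>G\<close>. Passing
  to this frame takes the place of diagonalizing a second form simultaneously with
  \<open>G\<close>.\<close>

lemma pos_def_congruent_identity:
  fixes G :: "real^'n^'n"
  assumes "pos_def G"
  obtains S where "transpose S ** G ** S = mat 1" and "det G * (det S)\<^sup>2 = 1"
proof -
  obtain b :: "'n \<Rightarrow> real^'n" where b: "\<And>i j. b i \<bullet> (G *v b j) = (if i = j then 1 else 0)"
    using pos_def_orthonormal_family[OF assms, of "UNIV :: 'n set"] by auto
  define S where "S = (\<chi> i j. b j $ i)"
  have "(transpose S ** G ** S) $ i $ j = b i \<bullet> (G *v b j)" for i j
    by (simp add: S_def transpose_def inner_vec_def matrix_matrix_mult_def matrix_vector_mult_def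
        sum_distrib_left sum_distrib_right mult.assoc) (rule sum.swap)
  then have 1: "transpose S ** G ** S = mat 1"
    by (simp add: b vec_eq_iff mat_def)
  then have "det (transpose S ** G ** S) = 1"
    by simp
  then have "det G * (det S)\<^sup>2 = 1"
    by (simp add: det_mul power2_eq_square algebra_simps)
  then show ?thesis
    using that 1 by blast
qed

lemma pos_def_det_pos:
  assumes "pos_def G"
  shows "det G > 0"
proof -
  obtain S where "transpose S ** G ** S = mat 1" and "det G * (det S)\<^sup>2 = 1"
    by (rule pos_def_congruent_identity[OF assms])
  then show ?thesis
    by (smt (verit) mult_nonpos_nonneg zero_le_power2)
qed

lemma matrix_inv_mult:
  fixes A :: "real^'n^'n"
  assumes "det A \<noteq> 0"
  shows "matrix_inv A ** A = mat 1" and "A ** matrix_inv A = mat 1"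
proof -
  have "\<exists>B. A ** B = mat 1 \<and> B ** A = mat 1"
    using assms by (simp add: invertible_det_nz[symmetric] invertible_def)
  from someI_ex[OF this] show "matrix_inv A ** A = mat 1" and "A ** matrix_inv A = mat 1"
    by (simp_all add: matrix_inv_def)
qed

lemma matrix_inv_eqI:
  fixes A B :: "real^'n^'n"
  assumes "A ** B = mat 1"
  shows "matrix_inv A = B"
proof -
  have "det A * det B = 1"
    using assms by (metis det_I det_mul)
  then have "matrix_inv A ** A = mat 1"
    by (intro matrix_inv_mult) auto
  then have "matrix_inv A ** (A ** B) = B"
    by (simp add: matrix_mul_assoc)
  then show ?thesis
    by (simp add: assms)
qed

lemma pos_def_matrix_inv:
  fixes G S :: "real^'n^'n"
  assumes "pos_def G" "transpose S ** G ** S = mat 1"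
  shows "matrix_inv G = S ** transpose S"
proof -
  have "S ** (transpose S ** G) = mat 1"
    using assms(2) by (rule matrix_left_right_inverse1)
  then have "(S ** transpose S) ** G = mat 1"
    by (simp add: matrix_mul_assoc)
  then have "G ** (S ** transpose S) = mat 1"
    by (rule matrix_left_right_inverse1)
  then show ?thesis
    by (rule matrix_inv_eqI)
qed

text \<open>A substitute for the spectral theorem: polarization turns the bound on the quadratic
  form into a bound on \<open>x \<bullet> (N *v v)\<close>, which is then tested with
  \<open>x\<close> parallel to \<open>N *v v\<close>.\<close>

lemma symmetric_quadratic_bound:
  fixes N :: "real^'n^'n"
  assumes sym: "transpose N = N" and bd: "\<And>v. \<bar>v \<bullet> (N *v v)\<bar> \<le> c * (v \<bullet> v)" and "c \<ge> 0"
  shows "norm (N *v v) \<le> c * norm v"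
proof (cases "N *v v = 0")
  case False
  \<comment> \<open>Rescaled to the length of \<open>v\<close>, so that the two squared norms on the
    right of \<open>pol\<close> are equal.\<close>
  define u where "u = (norm v / norm (N *v v)) *\<^sub>R (N *v v)"
  have pol: "4 * (x \<bullet> (N *v v)) \<le> 2 * c * (x \<bullet> x + v \<bullet> v)" for x
  proof -
    have "4 * (x \<bullet> (N *v v)) = (x + v) \<bullet> (N *v (x + v)) - (x - v) \<bullet> (N *v (x - v))"
      using inner_matrix_vector_symmetric[OF sym, of v x]
      by (simp add: inner_simps matrix_vector_mult_diff_distrib matrix_vector_right_distrib)
    also have "\<dots> \<le> c * ((x + v) \<bullet> (x + v)) + c * ((x - v) \<bullet> (x - v))"
      using bd[of "x + v"] bd[of "x - v"] by linarith
    also have "\<dots> = 2 * c * (x \<bullet> x + v \<bullet> v)"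
      by (simp add: inner_simps algebra_simps)
    finally show ?thesis .
  qed
  have "u \<bullet> u = v \<bullet> v"
    using False by (simp add: u_def dot_square_norm power2_eq_square)
  moreover have "u \<bullet> (N *v v) = norm v * norm (N *v v)"
    using False by (simp add: u_def dot_square_norm power2_eq_square)
  ultimately have "norm v * norm (N *v v) \<le> norm v * (c * norm v)"
    using pol[of u] by (simp add: dot_square_norm power2_eq_square algebra_simps)
  moreover have "norm v > 0"
    using False by auto
  ultimately show ?thesis
    by simp
qed (use \<open>c \<ge> 0\<close> in simp)

section \<open>The squared norm of a bilinear form at one point\<close>

definition metric_norm_sq :: "real^'n^'n \<Rightarrow> real^'n^'n \<Rightarrow> real" where
  "metric_norm_sq G H = (\<Sum>i\<in>UNIV. \<Sum>j\<in>UNIV. \<Sum>k\<in>UNIV. \<Sum>l\<in>UNIV.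
     matrix_inv G $ i $ k * matrix_inv G $ j $ l * H $ i $ j * H $ k $ l)"

text \<open>Since the inverse of \<open>G\<close> is \<open>S ** transpose S\<close>, the fourfold
  contraction is the squared Frobenius norm of the components of \<open>H\<close> in the orthonormal
  frame \<open>S\<close>.\<close>

lemma metric_norm_sq_eq:
  fixes G H S :: "real^'n^'n"
  assumes "pos_def G" "transpose S ** G ** S = mat 1"
  shows "metric_norm_sq G H = (\<Sum>a\<in>UNIV. \<Sum>b\<in>UNIV. ((transpose S ** H ** S) $ a $ b)\<^sup>2)"
proof -
  have I: "matrix_inv G $ i $ k = (\<Sum>a\<in>UNIV. S $ i $ a * S $ k $ a)" for i k
    by (simp add: pos_def_matrix_inv[OF assms] matrix_matrix_mult_def transpose_def)
  have N: "(transpose S ** H ** S) $ a $ b = (\<Sum>j\<in>UNIV. \<Sum>i\<in>UNIV. S $ i $ a * H $ i $ j * S $ j $ b)" for a b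
    by (simp add: matrix_matrix_mult_def transpose_def sum_distrib_right)
  have "(\<Sum>a\<in>UNIV. \<Sum>b\<in>UNIV. ((transpose S ** H ** S) $ a $ b)\<^sup>2) =
      (\<Sum>a\<in>UNIV. \<Sum>b\<in>UNIV. \<Sum>l\<in>UNIV. \<Sum>k\<in>UNIV. \<Sum>j\<in>UNIV. \<Sum>i\<in>UNIV.
         (S $ i $ a * H $ i $ j * S $ j $ b) * (S $ k $ a * H $ k $ l * S $ l $ b))"
    unfolding N power2_eq_square by (simp add: sum_distrib_right sum_distrib_left)
  \<comment> \<open>With the frame indices \<open>a\<close> and \<open>b\<close> innermost, their
    sums assemble the two inverse matrices.\<close>
  also have "\<dots> = (\<Sum>i\<in>UNIV. \<Sum>j\<in>UNIV. \<Sum>k\<in>UNIV. \<Sum>l\<in>UNIV. \<Sum>a\<in>UNIV. \<Sum>b\<in>UNIV.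
         (S $ i $ a * H $ i $ j * S $ j $ b) * (S $ k $ a * H $ k $ l * S $ l $ b))"
    unfolding sum.cartesian_product
    by (rule sum.reindex_bij_witness[of _
          "\<lambda>(i, j, k, l, a, b). (a, b, l, k, j, i)" "\<lambda>(a, b, l, k, j, i). (i, j, k, l, a, b)"]) auto
  also have "\<dots> = metric_norm_sq G H"
    unfolding metric_norm_sq_def I
    by (intro sum.cong refl)
      (simp add: sum_product sum_distrib_left sum_distrib_right algebra_simps, rule sum.swap)
  finally show ?thesis
    by simp
qed

text \<open>In a frame orthonormal for \<open>G\<close> the two bounds say that the quadratic form
  of the symmetric matrix \<open>N\<close> is at most \<open>c\<close> in absolute value on unit
  vectors. Every column of \<open>N\<close> is the image of a unit vector, so it has length at most
  \<open>c\<close>, and there are \<open>CARD('n)\<close> columns.\<close>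

lemma metric_norm_sq_le:
  fixes G H :: "real^'n^'n"
  assumes G: "pos_def G" and H: "transpose H = H" and "c \<ge> 0"
    and upper: "\<And>v. v \<bullet> (H *v v) \<le> c * (v \<bullet> (G *v v))"
    and lower: "\<And>v. - (c * (v \<bullet> (G *v v))) \<le> v \<bullet> (H *v v)"
  shows "metric_norm_sq G H \<le> real CARD('n) * c\<^sup>2"
proof -
  obtain S where S: "transpose S ** G ** S = mat 1" and "det G * (det S)\<^sup>2 = 1"
    by (rule pos_def_congruent_identity[OF G])
  define N where "N = transpose S ** H ** S"
  have quad: "v \<bullet> ((transpose S ** A ** S) *v v) = (S *v v) \<bullet> (A *v (S *v v))" for A v
    by (simp flip: matrix_vector_mul_assoc) (metis dot_lmul_matrix inner_commute)
  have "transpose N = N"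
    by (simp add: N_def matrix_transpose_mul H matrix_mul_assoc)
  moreover have "\<bar>v \<bullet> (N *v v)\<bar> \<le> c * (v \<bullet> v)" for v
    using upper[of "S *v v"] lower[of "S *v v"] quad[of v H] quad[of v G]
    by (simp add: S N_def[symmetric] abs_le_iff)
  ultimately have nb: "norm (N *v v) \<le> c * norm v" for v
    using symmetric_quadratic_bound \<open>c \<ge> 0\<close> by blast
  have "(\<Sum>a\<in>UNIV. (N $ a $ b)\<^sup>2) \<le> c\<^sup>2" for b
  proof -
    have "norm (N *v axis b 1) \<le> c"
      using nb[of "axis b 1"] by simp
    then have "(norm (N *v axis b 1))\<^sup>2 \<le> c\<^sup>2"
      by (simp add: power_mono)
    then show ?thesis
      by (simp add: matrix_vector_mult_basis norm_vec_def L2_set_def column_def sum_nonneg)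
  qed
  then have "(\<Sum>b\<in>UNIV. \<Sum>a\<in>UNIV. (N $ a $ b)\<^sup>2) \<le> (\<Sum>b\<in>(UNIV :: 'n set). c\<^sup>2)"
    by (rule sum_mono)
  then show ?thesis
    unfolding metric_norm_sq_eq[OF G S] N_def[symmetric] by (subst sum.swap) simp
qed

lemma metric_norm_sq_scaled:
  fixes G :: "real^'n^'n"
  assumes G: "pos_def G"
  shows "metric_norm_sq G (c *\<^sub>R G) = real CARD('n) * c\<^sup>2"
proof -
  obtain S where S: "transpose S ** G ** S = mat 1" and "det G * (det S)\<^sup>2 = 1"
    by (rule pos_def_congruent_identity[OF G])
  have "transpose S ** (c *\<^sub>R G) ** S = c *\<^sub>R (transpose S ** G ** S)"
    by (simp add: vec_eq_iff matrix_matrix_mult_def sum_distrib_left sum_distrib_right mult_ac)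
  then have "transpose S ** (c *\<^sub>R G) ** S = c *\<^sub>R mat 1"
    by (simp add: S)
  moreover have "((c *\<^sub>R mat 1 :: real^'n^'n) $ a $ b)\<^sup>2 = (if a = b then c\<^sup>2 else 0)" for a b
    by (simp add: mat_def)
  ultimately show ?thesis
    unfolding metric_norm_sq_eq[OF G S] by simp
qed

section \<open>Partial derivatives\<close>

lemma partial_deriv_has_derivative:
  "(f has_derivative D) (at x) \<Longrightarrow> partial_deriv i f x = D (axis i 1)"
  by (simp add: partial_deriv_def frechet_derivative_at[symmetric])

lemma has_derivative_cong_open:
  assumes "open S" "x \<in> S" "\<And>y. y \<in> S \<Longrightarrow> f y = g y"
  shows "(f has_derivative D) (at x) \<longleftrightarrow> (g has_derivative D) (at x)"
  using assms has_derivative_transform_within_open[of f D x UNIV S g]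
    has_derivative_transform_within_open[of g D x UNIV S f] by auto

lemma partial_deriv_cong:
  assumes "open S" "x \<in> S" "\<And>y. y \<in> S \<Longrightarrow> f y = g y"
  shows "partial_deriv i f x = partial_deriv i g x"
  using has_derivative_cong_open[OF assms] by (simp add: partial_deriv_def frechet_derivative_def)

lemma differentiable_cong_open:
  assumes "open S" "x \<in> S" "\<And>y. y \<in> S \<Longrightarrow> f y = g y"
  shows "f differentiable at x \<longleftrightarrow> g differentiable at x"
  using has_derivative_cong_open[OF assms] by (simp add: differentiable_def)

lemma differentiable_has_frechet:
  "f differentiable at x \<Longrightarrow> (f has_derivative frechet_derivative f (at x)) (at x)"
  by (simp add: frechet_derivative_works)

lemma differentiable_on_open_at:
  "f differentiable_on S \<Longrightarrow> open S \<Longrightarrow> x \<in> S \<Longrightarrow> f differentiable at x"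
  by (metis at_within_open differentiable_on_def)

lemma differentiable_on_openI:
  "(\<And>x. x \<in> S \<Longrightarrow> f differentiable at x) \<Longrightarrow> f differentiable_on S"
  by (meson differentiable_at_imp_differentiable_on)

lemma partial_deriv_const [simp]: "partial_deriv i (\<lambda>x. c) x = 0"
  by (simp add: partial_deriv_has_derivative[OF has_derivative_const])

lemma partial_deriv_add:
  assumes "f differentiable at x" "g differentiable at x"
  shows "partial_deriv i (\<lambda>y. f y + g y) x = partial_deriv i f x + partial_deriv i g x"
  unfolding partial_deriv_has_derivative[OF has_derivative_add[OF assms[THEN differentiable_has_frechet]]]
  by (simp add: partial_deriv_def)

lemma partial_deriv_diff:
  assumes "f differentiable at x" "g differentiable at x"
  shows "partial_deriv i (\<lambda>y. f y - g y) x = partial_deriv i f x - partial_deriv i g x"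
  unfolding partial_deriv_has_derivative[OF has_derivative_diff[OF assms[THEN differentiable_has_frechet]]]
  by (simp add: partial_deriv_def)

lemma partial_deriv_sum:
  assumes "\<And>a. a \<in> A \<Longrightarrow> f a differentiable at x"
  shows "partial_deriv i (\<lambda>y. \<Sum>a\<in>A. f a y) x = (\<Sum>a\<in>A. partial_deriv i (f a) x)"
  by (rule partial_deriv_has_derivative[OF has_derivative_sum[OF assms[THEN differentiable_has_frechet]],
        THEN trans]) (simp_all add: partial_deriv_def)

lemma partial_deriv_bounded_linear:
  assumes "bounded_linear L" "f differentiable at x"
  shows "partial_deriv i (\<lambda>y. L (f y)) x = L (partial_deriv i f x)"
  unfolding partial_deriv_has_derivative[OF bounded_linear.has_derivative[OF assms(1)
        assms(2)[THEN differentiable_has_frechet]]]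
  by (simp add: partial_deriv_def)

lemma partial_deriv_bounded_bilinear:
  assumes "bounded_bilinear B" "f differentiable at x" "g differentiable at x"
  shows "partial_deriv i (\<lambda>y. B (f y) (g y)) x =
    B (partial_deriv i f x) (g x) + B (f x) (partial_deriv i g x)"
  unfolding partial_deriv_has_derivative[OF bounded_bilinear.FDERIV[OF assms(1)
        assms(2,3)[THEN differentiable_has_frechet]]]
  by (simp add: partial_deriv_def add.commute)

lemma differentiable_bounded_bilinear:
  assumes "bounded_bilinear B" "f differentiable at x" "g differentiable at x"
  shows "(\<lambda>y. B (f y) (g y)) differentiable at x"
  using bounded_bilinear.FDERIV[OF assms(1) assms(2,3)[THEN differentiable_has_frechet]]
  by (auto simp: differentiable_def)

lemma differentiable_bounded_linear:
  assumes "bounded_linear L" "f differentiable at x"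
  shows "(\<lambda>y. L (f y)) differentiable at x"
  using bounded_linear.has_derivative[OF assms(1) assms(2)[THEN differentiable_has_frechet]]
  by (auto simp: differentiable_def)

lemmas partial_deriv_mult = partial_deriv_bounded_bilinear[OF bounded_bilinear_mult]
lemmas partial_deriv_scaleR = partial_deriv_bounded_bilinear[OF bounded_bilinear_scaleR]
lemmas partial_deriv_vec_nth = partial_deriv_bounded_linear[OF bounded_linear_vec_nth]
lemmas differentiable_vec_nth = differentiable_bounded_linear[OF bounded_linear_vec_nth]
lemmas differentiable_scaleR' = differentiable_bounded_bilinear[OF bounded_bilinear_scaleR]

lemma bounded_bilinear_matrix_mult:
  "bounded_bilinear ((**) :: real^'n^'m \<Rightarrow> real^'k^'n \<Rightarrow> real^'k^'m)"
  unfolding bilinear_conv_bounded_bilinear[symmetric] bilinear_def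
  by (auto intro!: linearI simp: matrix_matrix_mult_def vec_eq_iff algebra_simps sum.distrib sum_distrib_left)

lemmas partial_deriv_matrix_mult = partial_deriv_bounded_bilinear[OF bounded_bilinear_matrix_mult]
lemmas differentiable_matrix_mult = differentiable_bounded_bilinear[OF bounded_bilinear_matrix_mult]

lemma differentiable_matrix_entry:
  "f differentiable at x \<Longrightarrow> (\<lambda>y. f y $ i $ j) differentiable at x"
  by (intro differentiable_vec_nth)

lemma partial_deriv_matrix_entry:
  "f differentiable at x \<Longrightarrow> partial_deriv k (\<lambda>y. f y $ i $ j) x = partial_deriv k f x $ i $ j"
  by (simp add: partial_deriv_vec_nth differentiable_vec_nth)

text \<open>The function is the sum of its components, embedded by the bounded linear maps
  \<open>axis i\<close>.\<close>

lemma differentiable_vecI: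
  fixes f :: "'a::real_normed_vector \<Rightarrow> 'b::euclidean_space^'n::finite"
  assumes "\<And>i. (\<lambda>y. f y $ i) differentiable at x"
  shows "f differentiable at x"
proof -
  have "bounded_linear (axis i :: 'b \<Rightarrow> 'b^'n)" for i
    by (simp add: linear_conv_bounded_linear[symmetric] linear_iff axis_def vec_eq_iff)
  from differentiable_bounded_linear[OF this assms]
  have "(\<lambda>y. \<Sum>i\<in>UNIV. axis i (f y $ i)) differentiable at x"
    by (intro differentiable_sum) auto
  moreover have "(\<Sum>i\<in>UNIV. axis i (f y $ i)) = f y" for y
    by (simp add: vec_eq_iff axis_def if_distrib[of "\<lambda>z. _ $ z"] cong: if_cong)
  ultimately show ?thesis
    by simp
qed

lemma differentiable_matrixI:
  fixes f :: "'a::real_normed_vector \<Rightarrow> real^'m::finite^'n::finite"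
  assumes "\<And>i j. (\<lambda>y. f y $ i $ j) differentiable at x"
  shows "f differentiable at x"
  by (intro differentiable_vecI assms)

lemma partial_deriv_chain:
  fixes f :: "real^'m::finite \<Rightarrow> 'b::real_normed_vector" and \<psi> :: "real^'n::finite \<Rightarrow> real^'m"
  assumes f: "f differentiable at (\<psi> x)" and \<psi>: "\<psi> differentiable at x"
  shows "partial_deriv i (\<lambda>y. f (\<psi> y)) x =
    (\<Sum>a\<in>UNIV. (partial_deriv i \<psi> x $ a) *\<^sub>R partial_deriv a f (\<psi> x))"
proof -
  let ?F = "frechet_derivative f (at (\<psi> x))" and ?v = "partial_deriv i \<psi> x"
  have D: "(f has_derivative ?F) (at (\<psi> x))"
    using f by (rule differentiable_has_frechet)
  have "partial_deriv i (\<lambda>y. f (\<psi> y)) x = ?F ?v"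
    using partial_deriv_has_derivative[OF has_derivative_compose[OF \<psi>[THEN differentiable_has_frechet] D]]
    by (simp add: partial_deriv_def)
  also have "\<dots> = ?F (\<Sum>a\<in>UNIV. (?v $ a) *\<^sub>R axis a 1)"
    using basis_expansion[of ?v] by (simp add: scalar_mult_eq_scaleR)
  also have "\<dots> = (\<Sum>a\<in>UNIV. (?v $ a) *\<^sub>R partial_deriv a f (\<psi> x))"
    using has_derivative_linear[OF D] by (simp add: linear_sum linear_scale partial_deriv_def)
  finally show ?thesis .
qed

lemma has_real_derivative_along_axis:
  fixes f :: "real^'n::finite \<Rightarrow> real"
  assumes "f differentiable at (p + t *\<^sub>R axis i 1)"
  shows "((\<lambda>s. f (p + s *\<^sub>R axis i 1)) has_real_derivative partial_deriv i f (p + t *\<^sub>R axis i 1)) (at t)"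
proof -
  let ?q = "p + t *\<^sub>R axis i 1"
  let ?F = "frechet_derivative f (at ?q)"
  have D: "(f has_derivative ?F) (at ?q)"
    using assms by (rule differentiable_has_frechet)
  have "((\<lambda>s. p + s *\<^sub>R axis i 1) has_derivative (\<lambda>s. s *\<^sub>R axis i 1)) (at t)"
    by (auto intro!: derivative_eq_intros)
  from has_derivative_compose[OF this D]
  have "((\<lambda>s. f (p + s *\<^sub>R axis i 1)) has_derivative (\<lambda>s. ?F (s *\<^sub>R axis i 1))) (at t)" .
  also have "(\<lambda>s. ?F (s *\<^sub>R axis i 1)) = (*) (partial_deriv i f ?q)"
    using has_derivative_linear[OF D] by (simp add: fun_eq_iff linear_scale partial_deriv_def)
  finally show ?thesis
    by (simp add: has_field_derivative_def)
qed

text \<open>The mean value theorem in direction \<open>i\<close> reduces the second difference to an increment of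
  \<open>partial_deriv i f\<close>, which is then linearized at \<open>x\<close>.\<close>

lemma second_difference_estimate:
  fixes f :: "real^'n::finite \<Rightarrow> real"
  assumes "open S" "x \<in> S" and f: "f differentiable_on S"
    and fi: "partial_deriv i f differentiable at x" and "e > 0"
  shows "\<exists>d>0. \<forall>s. 0 < s \<and> s < d \<longrightarrow>
    \<bar>f (x + s *\<^sub>R axis i 1 + s *\<^sub>R axis j 1) - f (x + s *\<^sub>R axis i 1)
      - f (x + s *\<^sub>R axis j 1) + f x - s\<^sup>2 * partial_deriv j (partial_deriv i f) x\<bar> \<le> e * s\<^sup>2"
proof -
  define ei ej :: "real^'n" where "ei = axis i 1" and "ej = axis j 1"
  have [simp]: "norm ei = 1" "norm ej = 1"
    by (simp_all add: ei_def ej_def)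
  let ?D = "frechet_derivative (partial_deriv i f) (at x)"
  have D: "(partial_deriv i f has_derivative ?D) (at x)"
    using fi by (rule differentiable_has_frechet)
  obtain r where r: "r > 0" "ball x r \<subseteq> S"
    using assms(1,2) openE by blast
  obtain d0 where d0: "d0 > 0" and bd: "\<And>y. norm (y - x) < d0 \<Longrightarrow>
      norm (partial_deriv i f y - partial_deriv i f x - ?D (y - x)) \<le> e / 4 * norm (y - x)"
    using D \<open>e > 0\<close> unfolding has_derivative_at_alt by (meson divide_pos_pos zero_less_numeral)
  \<comment> \<open>The two increments used below have length at most \<open>2 * s\<close>; halving
    keeps them within \<open>r\<close> and \<open>d0\<close>. Each costs an error of
    \<open>e / 4 * (2 * s)\<close>, which adds up to \<open>e * s\<close>.\<close>
  define d where "d = min r d0 / 2"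
  have "\<bar>f (x + s *\<^sub>R ei + s *\<^sub>R ej) - f (x + s *\<^sub>R ei) - f (x + s *\<^sub>R ej) + f x
      - s\<^sup>2 * partial_deriv j (partial_deriv i f) x\<bar> \<le> e * s\<^sup>2" if s: "0 < s" "s < d" for s
  proof -
    have small: "norm (t *\<^sub>R ei + u *\<^sub>R ej) \<le> 2 * s" if "0 \<le> t" "t \<le> s" "0 \<le> u" "u \<le> s" for t u
      using norm_triangle_ineq[of "t *\<^sub>R ei" "u *\<^sub>R ej"] that by simp
    have inS: "f differentiable at (x + t *\<^sub>R ei + u *\<^sub>R ej)"
      if "0 \<le> t" "t \<le> s" "0 \<le> u" "u \<le> s" for t u
    proof -
      have "dist x (x + t *\<^sub>R ei + u *\<^sub>R ej) < r"
        using small[OF that] s r d0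
        by (metis (no_types, lifting) add.assoc add_diff_cancel_left' dist_commute dist_norm
            le_less_trans d_def min_less_iff_conj mult.commute pos_less_divide_eq zero_less_numeral)
      then show ?thesis
        using r f \<open>open S\<close> by (intro differentiable_on_open_at[of f S]) auto
    qed
    define \<phi> where "\<phi> t = f (x + s *\<^sub>R ej + t *\<^sub>R ei) - f (x + t *\<^sub>R ei)" for t
    define \<phi>' where "\<phi>' t = partial_deriv i f (x + s *\<^sub>R ej + t *\<^sub>R ei) - partial_deriv i f (x + t *\<^sub>R ei)" for t
    have "DERIV \<phi> t :> \<phi>' t" if "0 \<le> t" "t \<le> s" for t
      unfolding \<phi>_def \<phi>'_def ei_def
      using inS[of t s] inS[of t 0] s that
      by (intro DERIV_diff has_real_derivative_along_axis) (auto simp: ei_def algebra_simps)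
    then obtain \<theta> where \<theta>: "0 < \<theta>" "\<theta> < s" "\<phi> s - \<phi> 0 = s * \<phi>' \<theta>"
      using MVT2[of 0 s \<phi> \<phi>'] s by auto
    have lin: "linear ?D"
      using D by (rule has_derivative_linear)
    have est: "\<bar>partial_deriv i f (x + y) - partial_deriv i f x - ?D y\<bar> \<le> e / 2 * s"
      if y: "norm y \<le> 2 * s" for y
    proof -
      have "norm (x + y - x) < d0"
        using y s r d0 by (simp add: d_def)
      from bd[OF this] have "\<bar>partial_deriv i f (x + y) - partial_deriv i f x - ?D y\<bar> \<le> e / 4 * norm y"
        by simp
      also have "\<dots> \<le> e / 4 * (2 * s)"
        using y \<open>e > 0\<close> by (intro mult_left_mono) auto
      finally show ?thesis
        by simp
    qed
    have "?D (s *\<^sub>R ej + \<theta> *\<^sub>R ei) - ?D (\<theta> *\<^sub>R ei) = s * partial_deriv j (partial_deriv i f) x"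
      using lin by (simp add: linear_add linear_scale partial_deriv_def[of j] ej_def)
    moreover have "norm (s *\<^sub>R ej + \<theta> *\<^sub>R ei) \<le> 2 * s" "norm (\<theta> *\<^sub>R ei) \<le> 2 * s"
      using small[of \<theta> s] \<theta> s by (simp_all add: add.commute)
    note est[OF this(1)] est[OF this(2)]
    moreover have "\<phi>' \<theta> = partial_deriv i f (x + (s *\<^sub>R ej + \<theta> *\<^sub>R ei)) - partial_deriv i f (x + \<theta> *\<^sub>R ei)"
      by (simp add: \<phi>'_def add.assoc)
    ultimately have "\<bar>\<phi>' \<theta> - s * partial_deriv j (partial_deriv i f) x\<bar> \<le> e / 2 * s + e / 2 * s"
      by linarith
    then have "\<bar>\<phi>' \<theta> - s * partial_deriv j (partial_deriv i f) x\<bar> \<le> e * s"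
      by simp
    then have "s * \<bar>\<phi>' \<theta> - s * partial_deriv j (partial_deriv i f) x\<bar> \<le> s * (e * s)"
      using s by simp
    then have "\<bar>s * (\<phi>' \<theta> - s * partial_deriv j (partial_deriv i f) x)\<bar> \<le> e * s\<^sup>2"
      using s by (simp add: abs_mult power2_eq_square mult_ac)
    moreover have "s * (\<phi>' \<theta> - s * partial_deriv j (partial_deriv i f) x) =
        f (x + s *\<^sub>R ei + s *\<^sub>R ej) - f (x + s *\<^sub>R ei) - f (x + s *\<^sub>R ej) + f x
        - s\<^sup>2 * partial_deriv j (partial_deriv i f) x"
      using \<theta>(3) by (simp add: \<phi>_def algebra_simps power2_eq_square)
    ultimately show ?thesis
      by simp
  qed
  moreover have "d > 0"
    using r d0 by (simp add: d_def)
  ultimately show ?thesis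
    unfolding ei_def ej_def by blast
qed

text \<open>Young's form of the symmetry of mixed derivatives: the second difference is symmetric in
  \<open>i\<close> and \<open>j\<close>, and after division by the squared step it approximates both
  mixed derivatives at \<open>x\<close>. Continuity of the second derivatives does not
  enter.\<close>

lemma partial_deriv_commute_real:
  fixes f :: "real^'n::finite \<Rightarrow> real"
  assumes S: "open S" "x \<in> S" and f: "f differentiable_on S"
    and fi: "partial_deriv i f differentiable at x" and fj: "partial_deriv j f differentiable at x"
  shows "partial_deriv i (partial_deriv j f) x = partial_deriv j (partial_deriv i f) x"
proof (rule ccontr)
  let ?a = "partial_deriv i (partial_deriv j f) x" and ?b = "partial_deriv j (partial_deriv i f) x"
  assume "?a \<noteq> ?b"
  \<comment> \<open>The two mixed derivatives end up at distance at most \<open>2 * e\<close>,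
    whereas their distance is \<open>3 * e\<close>.\<close>
  define e where "e = \<bar>?a - ?b\<bar> / 3"
  have e: "e > 0"
    using \<open>?a \<noteq> ?b\<close> by (simp add: e_def)
  obtain d1 where d1: "d1 > 0" "\<And>s. 0 < s \<Longrightarrow> s < d1 \<Longrightarrow>
    \<bar>f (x + s *\<^sub>R axis i 1 + s *\<^sub>R axis j 1) - f (x + s *\<^sub>R axis i 1)
      - f (x + s *\<^sub>R axis j 1) + f x - s\<^sup>2 * ?b\<bar> \<le> e * s\<^sup>2"
    using second_difference_estimate[OF S f fi e, of j] by blast
  obtain d2 where d2: "d2 > 0" "\<And>s. 0 < s \<Longrightarrow> s < d2 \<Longrightarrow>
    \<bar>f (x + s *\<^sub>R axis j 1 + s *\<^sub>R axis i 1) - f (x + s *\<^sub>R axis j 1)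
      - f (x + s *\<^sub>R axis i 1) + f x - s\<^sup>2 * ?a\<bar> \<le> e * s\<^sup>2"
    using second_difference_estimate[OF S f fj e, of i] by blast
  define s where "s = min d1 d2 / 2"
  have s: "0 < s" "s < d1" "s < d2"
    using d1 d2 by (auto simp: s_def)
  have comm: "x + s *\<^sub>R axis j 1 + s *\<^sub>R axis i 1 = x + s *\<^sub>R axis i 1 + s *\<^sub>R axis j 1"
    by (simp add: algebra_simps)
  have "\<bar>s\<^sup>2 * ?a - s\<^sup>2 * ?b\<bar> \<le> 2 * (e * s\<^sup>2)"
    using d1(2)[OF s(1,2)] d2(2)[OF s(1,3)] unfolding comm by linarith
  moreover have "\<bar>s\<^sup>2 * ?a - s\<^sup>2 * ?b\<bar> = s\<^sup>2 * \<bar>?a - ?b\<bar>"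
    by (simp add: abs_mult flip: right_diff_distrib)
  ultimately have "s\<^sup>2 * \<bar>?a - ?b\<bar> \<le> s\<^sup>2 * (2 * e)"
    by (simp add: mult_ac)
  then show False
    using s e by (simp add: e_def)
qed

text \<open>The regularity shared by smooth functions and by \<open>holder_on 2\<close>. It suffices
  to define the curvature pointwise and to commute mixed derivatives.\<close>

definition twice_differentiable_on ::
    "(real^'n::finite \<Rightarrow> 'b::real_normed_vector) \<Rightarrow> (real^'n) set \<Rightarrow> bool" where
  "twice_differentiable_on f S \<longleftrightarrow>
     f differentiable_on S \<and> (\<forall>i. partial_deriv i f differentiable_on S)"

lemma twice_differentiable_on_at:
  assumes "twice_differentiable_on f S" "open S" "x \<in> S"
  shows "f differentiable at x" "partial_deriv i f differentiable at x"
  using assms differentiable_on_open_at by (auto simp: twice_differentiable_on_def)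

lemma twice_differentiable_on_vec_nth:
  assumes "twice_differentiable_on f S" "open S"
  shows "twice_differentiable_on (\<lambda>y. f y $ a) S"
proof -
  have "partial_deriv i (\<lambda>y. f y $ a) differentiable at x" if "x \<in> S" for i x
  proof -
    have "(\<lambda>y. partial_deriv i f y $ a) differentiable at x"
      using twice_differentiable_on_at[OF assms that] by (intro differentiable_vec_nth)
    moreover have "partial_deriv i f y $ a = partial_deriv i (\<lambda>y. f y $ a) y" if "y \<in> S" for y
      using twice_differentiable_on_at[OF assms that] by (simp add: partial_deriv_vec_nth)
    ultimately show ?thesis
      by (rule differentiable_cong_open[OF assms(2) that, THEN iffD1, rotated])
  qed
  then show ?thesis
    using twice_differentiable_on_at[OF assms]
    by (auto simp: twice_differentiable_on_def intro!: differentiable_on_openI differentiable_vec_nth)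
qed

lemma partial_deriv_partial_deriv_vec_nth:
  assumes "twice_differentiable_on f S" "open S" "x \<in> S"
  shows "partial_deriv j (partial_deriv i (\<lambda>y. f y $ a)) x = partial_deriv j (partial_deriv i f) x $ a"
proof -
  have "partial_deriv j (partial_deriv i (\<lambda>y. f y $ a)) x = partial_deriv j (\<lambda>y. partial_deriv i f y $ a) x"
    using twice_differentiable_on_at[OF assms(1,2)]
    by (intro partial_deriv_cong[OF assms(2,3)]) (simp add: partial_deriv_vec_nth)
  then show ?thesis
    using twice_differentiable_on_at[OF assms] by (simp add: partial_deriv_vec_nth)
qed

lemma partial_deriv_commute_vec:
  fixes f :: "real^'n::finite \<Rightarrow> real^'m::finite"
  assumes "twice_differentiable_on f S" "open S" "x \<in> S"
  shows "partial_deriv i (partial_deriv j f) x = partial_deriv j (partial_deriv i f) x"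
proof (intro vec_eq_iff[THEN iffD2] allI)
  fix a
  note a = twice_differentiable_on_vec_nth[OF assms(1,2), of a]
  show "partial_deriv i (partial_deriv j f) x $ a = partial_deriv j (partial_deriv i f) x $ a"
    unfolding partial_deriv_partial_deriv_vec_nth[OF assms, symmetric]
    using a assms(2,3) twice_differentiable_on_at[OF a assms(2,3)]
    by (intro partial_deriv_commute_real[of S]) (auto simp: twice_differentiable_on_def)
qed

lemma partial_deriv_commute_matrix:
  fixes f :: "real^'n::finite \<Rightarrow> real^'m::finite^'k::finite"
  assumes "twice_differentiable_on f S" "open S" "x \<in> S"
  shows "partial_deriv i (partial_deriv j f) x = partial_deriv j (partial_deriv i f) x"
proof (intro vec_eq_iff[THEN iffD2] allI)
  fix a b
  show "partial_deriv i (partial_deriv j f) x $ a $ b = partial_deriv j (partial_deriv i f) x $ a $ b"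
    using partial_deriv_commute_vec[OF twice_differentiable_on_vec_nth[OF assms(1,2)] assms(2,3)]
    unfolding partial_deriv_partial_deriv_vec_nth[OF assms, symmetric] by metis
qed

section \<open>Regularity of determinant and inverse matrix\<close>

lemma differentiable_prod:
  fixes f :: "'i \<Rightarrow> 'a::real_normed_vector \<Rightarrow> real"
  assumes "finite I" "\<And>i. i \<in> I \<Longrightarrow> f i differentiable at x"
  shows "(\<lambda>y. \<Prod>i\<in>I. f i y) differentiable at x"
  using assms by (induction I rule: finite_induct) (auto intro!: differentiable_mult)

lemma differentiable_det:
  fixes A :: "'a::real_normed_vector \<Rightarrow> real^'n^'n"
  assumes "\<And>i j. (\<lambda>y. A y $ i $ j) differentiable at x"
  shows "(\<lambda>y. det (A y)) differentiable at x"
  unfolding det_def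
  by (auto intro!: differentiable_sum differentiable_mult differentiable_prod assms)

text \<open>Cramer's rule for the columns of the inverse. It exhibits the entries as quotients of
  determinants, hence as differentiable functions of the matrix where the determinant does not
  vanish.\<close>

lemma matrix_inv_cramer:
  fixes A :: "real^'n^'n"
  assumes "det A \<noteq> 0"
  shows "matrix_inv A $ k $ l = det (\<chi> i j. if j = k then axis l 1 $ i else A $ i $ j) / det A"
proof -
  have "A *v (matrix_inv A *v axis l 1) = axis l 1"
    by (simp add: matrix_vector_mul_assoc matrix_inv_mult[OF assms])
  from this[unfolded cramer[OF assms]] show ?thesis
    by (simp add: matrix_vector_mult_basis column_def vec_eq_iff)
qed

lemma isCont_det: "isCont (det :: real^'n^'n \<Rightarrow> real) A"
proof -
  have "(\<lambda>B :: real^'n^'n. det B) differentiable at A"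
    by (intro differentiable_det differentiable_matrix_entry) simp
  then show ?thesis
    by (rule differentiable_imp_continuous_within)
qed

lemma open_det_nonzero: "open {A :: real^'n^'n. det A \<noteq> 0}"
proof -
  have "continuous_on UNIV (det :: real^'n^'n \<Rightarrow> real)"
    by (simp add: continuous_on_eq_continuous_at isCont_det)
  then have "open (det -` (- {0 :: real}) :: (real^'n^'n) set)"
    by (rule open_vimage[rotated]) auto
  then show ?thesis
    by (simp add: vimage_def)
qed

lemma differentiable_matrix_inv:
  fixes A :: "'a::real_normed_vector \<Rightarrow> real^'n^'n"
  assumes A: "A differentiable at x" and "det (A x) \<noteq> 0"
  shows "(\<lambda>y. matrix_inv (A y)) differentiable at x"
proof -
  have "matrix_inv differentiable at (A x)"
  proof (rule differentiable_matrixI)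
    fix k l
    have "(\<lambda>B. (\<chi> i j. if j = k then axis l 1 $ i else B $ i $ j) $ a $ b) differentiable at (A x)" for a b
      by (cases "b = k") (auto intro: differentiable_matrix_entry)
    then have "(\<lambda>B. det (\<chi> i j. if j = k then axis l 1 $ i else B $ i $ j) / det B) differentiable at (A x)"
      using assms(2)
      by (intro differentiable_divide differentiable_det) (auto intro: differentiable_matrix_entry)
    then show "(\<lambda>B. matrix_inv B $ k $ l) differentiable at (A x)"
      using differentiable_cong_open[OF open_det_nonzero, of "A x" "\<lambda>B. matrix_inv B $ k $ l"]
        assms(2) by (simp add: matrix_inv_cramer)
  qed
  from differentiable_chain_at[OF A this] show ?thesis
    by (simp add: o_def)
qed

text \<open>Differentiate \<open>matrix_inv (A y) ** A y = mat 1\<close>, which holds throughout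
  \<open>S\<close>, and multiply by the inverse on the right.\<close>

lemma partial_deriv_matrix_inv:
  fixes A :: "real^'m::finite \<Rightarrow> real^'n^'n"
  assumes A: "A differentiable at x" and S: "open S" "x \<in> S" "\<And>y. y \<in> S \<Longrightarrow> det (A y) \<noteq> 0"
  shows "partial_deriv i (\<lambda>y. matrix_inv (A y)) x =
    - (matrix_inv (A x) ** partial_deriv i A x ** matrix_inv (A x))"
proof -
  let ?I = "\<lambda>y. matrix_inv (A y)"
  have I: "?I differentiable at x"
    using A S by (intro differentiable_matrix_inv) auto
  have "partial_deriv i (\<lambda>y. ?I y ** A y) x = partial_deriv i (\<lambda>y. mat 1 :: real^'n^'n) x"
    using S by (intro partial_deriv_cong[OF S(1,2)]) (simp add: matrix_inv_mult)
  then have "partial_deriv i ?I x ** A x + ?I x ** partial_deriv i A x = 0"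
    by (simp add: partial_deriv_matrix_mult[OF I A])
  then have "partial_deriv i ?I x ** A x = - (?I x ** partial_deriv i A x)"
    by (simp add: add_eq_0_iff2)
  then have "partial_deriv i ?I x ** A x ** ?I x = - (?I x ** partial_deriv i A x) ** ?I x"
    by simp
  moreover have "- (?I x ** partial_deriv i A x) ** ?I x = - (?I x ** partial_deriv i A x ** ?I x)"
    by (simp add: vec_eq_iff matrix_matrix_mult_def sum_negf)
  ultimately show ?thesis
    using S by (simp add: matrix_mul_assoc[symmetric] matrix_inv_mult)
qed

section \<open>The Ricci tensor as a function of the 2-jet of the metric\<close>

text \<open>\<open>M\<close>, \<open>D $ i\<close> and \<open>E $ m $ i\<close> stand for \<open>G\<close>, \<open>\<partial>\<^sub>i G\<close> and \<open>\<partial>\<^sub>m \<partial>\<^sub>i G\<close>; the derivative of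
  the inverse matrix is expanded as \<open>- M\<inverse> (\<partial>\<^sub>m G) M\<inverse>\<close>.\<close>

definition jet_christoffel ::
    "real^'n^'n \<Rightarrow> real^'n^'n^'n \<Rightarrow> 'n::finite \<Rightarrow> 'n \<Rightarrow> 'n \<Rightarrow> real" where
  "jet_christoffel M D k i j =
     (\<Sum>l\<in>UNIV. matrix_inv M $ k $ l * (D $ i $ j $ l + D $ j $ i $ l - D $ l $ i $ j)) / 2"

definition jet_christoffel_deriv ::
    "real^'n^'n \<Rightarrow> real^'n^'n^'n \<Rightarrow> real^'n^'n^'n^'n \<Rightarrow> 'n::finite \<Rightarrow> 'n \<Rightarrow> 'n \<Rightarrow> 'n \<Rightarrow> real" where
  "jet_christoffel_deriv M D E m k i j =
     (\<Sum>l\<in>UNIV. matrix_inv M $ k $ l * (E $ m $ i $ j $ l + E $ m $ j $ i $ l - E $ m $ l $ i $ j)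
        - (matrix_inv M ** D $ m ** matrix_inv M) $ k $ l * (D $ i $ j $ l + D $ j $ i $ l - D $ l $ i $ j)) / 2"

definition jet_ricci ::
    "real^'n^'n \<Rightarrow> real^'n^'n^'n \<Rightarrow> real^'n^'n^'n^'n \<Rightarrow> real^'n^'n::finite" where
  "jet_ricci M D E = (\<chi> i j. \<Sum>l\<in>UNIV.
     jet_christoffel_deriv M D E l l i j - jet_christoffel_deriv M D E i l l j
     + (\<Sum>m\<in>UNIV. jet_christoffel M D m i j * jet_christoffel M D l l m
                    - jet_christoffel M D m l j * jet_christoffel M D l i m))"

definition jet1 :: "(real^'n \<Rightarrow> 'b::real_normed_vector) \<Rightarrow> real^'n \<Rightarrow> 'b^'n" where
  "jet1 G x = (\<chi> i. partial_deriv i G x)"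

definition jet2 :: "(real^'n \<Rightarrow> 'b::real_normed_vector) \<Rightarrow> real^'n \<Rightarrow> 'b^'n^'n" where
  "jet2 G x = (\<chi> m i. partial_deriv m (partial_deriv i G) x)"

lemma christoffel_eq_jet:
  assumes "G differentiable at x"
  shows "christoffel G k i j x = jet_christoffel (G x) (jet1 G x) k i j"
  by (simp add: christoffel_def jet_christoffel_def jet1_def partial_deriv_matrix_entry assms)

lemma christoffel_derivative:
  fixes G :: "real^'n::finite \<Rightarrow> real^'n^'n"
  assumes G: "twice_differentiable_on G S" and S: "open S" "x \<in> S"
    and det: "\<And>y. y \<in> S \<Longrightarrow> det (G y) \<noteq> 0"
  shows "christoffel G k i j differentiable at x"
    and "partial_deriv m (christoffel G k i j) x =
           jet_christoffel_deriv (G x) (jet1 G x) (jet2 G x) m k i j"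
proof -
  define I where "I y = matrix_inv (G y)" for y
  define A where "A l y = partial_deriv i G y $ j $ l + partial_deriv j G y $ i $ l - partial_deriv l G y $ i $ j"
    for l y
  note dG = twice_differentiable_on_at[OF G S]
  have dI: "I differentiable at x"
    unfolding I_def by (intro differentiable_matrix_inv dG det S)
  have dA: "A l differentiable at x" for l
    unfolding A_def by (intro differentiable_add differentiable_diff differentiable_matrix_entry dG)
  have pA: "partial_deriv m (A l) x = jet2 G x $ m $ i $ j $ l + jet2 G x $ m $ j $ i $ l - jet2 G x $ m $ l $ i $ j" for l
    unfolding A_def
    by (simp add: partial_deriv_add partial_deriv_diff differentiable_add differentiable_matrix_entry dG
        partial_deriv_matrix_entry jet2_def)
  have pI: "partial_deriv m I x = - (I x ** jet1 G x $ m ** I x)"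
    unfolding I_def jet1_def by (simp add: partial_deriv_matrix_inv[OF dG(1) S det])
  have eq: "christoffel G k i j y = (\<Sum>l\<in>UNIV. I y $ k $ l * A l y) / 2" if "y \<in> S" for y
    using twice_differentiable_on_at[OF G S(1) that]
    by (simp add: christoffel_def I_def A_def partial_deriv_matrix_entry)
  have dt: "(\<lambda>y. I y $ k $ l * A l y) differentiable at x" for l
    by (intro differentiable_mult differentiable_matrix_entry dI dA)
  then have ds: "(\<lambda>y. \<Sum>l\<in>UNIV. I y $ k $ l * A l y) differentiable at x"
    by (intro differentiable_sum) auto
  then show "christoffel G k i j differentiable at x"
    by (intro differentiable_cong_open[OF S eq, THEN iffD2] differentiable_bounded_linear[OF bounded_linear_divide])
  have "partial_deriv m (christoffel G k i j) x = partial_deriv m (\<lambda>y. (\<Sum>l\<in>UNIV. I y $ k $ l * A l y) / 2) x"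
    by (rule partial_deriv_cong[OF S eq])
  also have "\<dots> = (\<Sum>l\<in>UNIV. partial_deriv m I x $ k $ l * A l x + I x $ k $ l * partial_deriv m (A l) x) / 2"
    by (simp add: partial_deriv_bounded_linear[OF bounded_linear_divide ds] partial_deriv_sum dt
        partial_deriv_mult differentiable_matrix_entry dI dA partial_deriv_matrix_entry)
  also have "\<dots> = jet_christoffel_deriv (G x) (jet1 G x) (jet2 G x) m k i j"
    unfolding pI pA by (simp add: jet_christoffel_deriv_def I_def A_def jet1_def algebra_simps)
  finally show "partial_deriv m (christoffel G k i j) x =
      jet_christoffel_deriv (G x) (jet1 G x) (jet2 G x) m k i j" .
qed

lemma ricci_eq_jet:
  assumes "twice_differentiable_on (g c) S" "open S" "x \<in> S" "\<And>y. y \<in> S \<Longrightarrow> det (g c y) \<noteq> 0"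
  shows "ricci g c x = jet_ricci (g c x) (jet1 (g c) x) (jet2 (g c) x)"
  by (simp add: ricci_def riemann_def jet_ricci_def christoffel_derivative(2)[OF assms]
      christoffel_eq_jet twice_differentiable_on_at[OF assms(1-3)])

lemma transpose_eq_entry:
  assumes "transpose A = A"
  shows "A $ a $ b = A $ b $ a"
  using arg_cong[OF assms, of "\<lambda>B. B $ b $ a"] by (simp add: transpose_def)

text \<open>Most contractions are symmetric because the Christoffel symbols are symmetric in their
  lower indices. The exception is the derivative of the contracted symbol; as the contracted symbol
  is the gradient of the logarithm of the volume density, its derivative is a Hessian.\<close>

lemma jet_ricci_symmetric:
  fixes M :: "real^'n^'n::finite"
  assumes M: "det M \<noteq> 0" "transpose M = M" and D: "\<And>i. transpose (D $ i) = D $ i"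
    and E: "\<And>i j. E $ i $ j = E $ j $ i" and Es: "\<And>i j. transpose (E $ i $ j) = E $ i $ j"
  shows "transpose (jet_ricci M D E) = jet_ricci M D E"
proof -
  let ?I = "matrix_inv M"
  let ?\<Gamma> = "jet_christoffel M D" and ?d = "jet_christoffel_deriv M D E"
  have sI: "transpose ?I = ?I"
  proof (rule matrix_inv_eqI[symmetric])
    have "transpose (?I ** M) = mat 1"
      by (simp add: matrix_inv_mult M)
    then show "M ** transpose ?I = mat 1"
      by (simp add: matrix_transpose_mul M)
  qed
  have I: "?I $ a $ b = ?I $ b $ a" for a b
    using sI by (rule transpose_eq_entry)
  have D': "D $ i $ a $ b = D $ i $ b $ a" for i a b
    using D by (rule transpose_eq_entry)
  have E': "E $ i $ j $ a $ b = E $ i $ j $ b $ a" for i j a b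
    using Es by (rule transpose_eq_entry)
  have J: "(?I ** D $ m ** ?I) $ a $ b = (?I ** D $ m ** ?I) $ b $ a" for m a b
  proof -
    have "transpose (?I ** D $ m ** ?I) = ?I ** D $ m ** ?I"
      by (simp add: matrix_transpose_mul sI D matrix_mul_assoc)
    then show ?thesis
      by (rule transpose_eq_entry)
  qed
  have \<Gamma>: "?\<Gamma> k i j = ?\<Gamma> k j i" for k i j
    unfolding jet_christoffel_def by (simp add: D'[of _ i j] add.commute)
  have d: "?d m k i j = ?d m k j i" for m k i j
    unfolding jet_christoffel_deriv_def by (simp add: D'[of _ i j] E'[of _ _ i j] add.commute)
  have antisym: "(\<Sum>l\<in>UNIV. \<Sum>k\<in>UNIV. X l k * (Y l k - Y k l)) = 0"
    if "\<And>l k. X l k = X k l" for X Y :: "'n \<Rightarrow> 'n \<Rightarrow> real"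
  proof -
    have "(\<Sum>l\<in>UNIV. \<Sum>k\<in>UNIV. X l k * Y k l) = (\<Sum>l\<in>UNIV. \<Sum>k\<in>UNIV. X l k * Y l k)"
      by (subst sum.swap) (simp add: that)
    then show ?thesis
      by (simp add: right_diff_distrib sum_subtractf)
  qed
  define T where "T i j = (\<Sum>l\<in>UNIV. ?d i l l j)" for i j
  \<comment> \<open>The discarded terms contract a matrix symmetric in \<open>l\<close> and
    \<open>k\<close> with an expression antisymmetric in them.\<close>
  have T: "T i j = (\<Sum>l\<in>UNIV. \<Sum>k\<in>UNIV. ?I $ l $ k * E $ i $ j $ l $ k - (?I ** D $ i ** ?I) $ l $ k * D $ j $ l $ k) / 2"
    for i j
  proof -
    have "T i j = (\<Sum>l\<in>UNIV. \<Sum>k\<in>UNIV.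
        (?I $ l $ k * E $ i $ j $ l $ k - (?I ** D $ i ** ?I) $ l $ k * D $ j $ l $ k)
        + (?I $ l $ k * (E $ i $ l $ j $ k - E $ i $ k $ j $ l)
        - (?I ** D $ i ** ?I) $ l $ k * (D $ l $ j $ k - D $ k $ j $ l))) / 2"
      unfolding T_def jet_christoffel_deriv_def sum_divide_distrib[symmetric]
      by (intro arg_cong[where f = "\<lambda>z. z / 2"] sum.cong refl)
        (simp add: D'[of _ _ j] E'[of _ _ _ j] algebra_simps)
    then show ?thesis
      by (simp add: sum.distrib sum_subtractf antisym[of "\<lambda>l k. ?I $ l $ k" "\<lambda>l k. E $ i $ l $ j $ k" for i j, OF I]
          antisym[of "\<lambda>l k. (?I ** D $ i ** ?I) $ l $ k" "\<lambda>l k. D $ l $ j $ k", OF J])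
  qed
  \<comment> \<open>Written as a trace, the quadratic part is symmetric in \<open>i\<close> and
    \<open>j\<close> by cyclicity.\<close>
  have tr: "(\<Sum>l\<in>UNIV. \<Sum>k\<in>UNIV. (?I ** D $ i ** ?I) $ l $ k * D $ j $ l $ k) = trace (?I ** D $ i ** (?I ** D $ j))" for i j
    by (simp add: matrix_mul_assoc trace_def matrix_matrix_mult_def[of "?I ** D $ i ** ?I"] D'[of j])
  have Tsym: "T i j = T j i" for i j
    unfolding T sum_subtractf tr E[of i j] by (simp add: trace_mul_sym[of "?I ** D $ i"])
  have Q: "(\<Sum>l\<in>UNIV. \<Sum>m\<in>UNIV. ?\<Gamma> m l j * ?\<Gamma> l i m) = (\<Sum>l\<in>UNIV. \<Sum>m\<in>UNIV. ?\<Gamma> m l i * ?\<Gamma> l j m)" for i j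
    by (subst sum.swap) (simp add: \<Gamma>[of _ j] \<Gamma>[of _ i] mult.commute)
  have R: "jet_ricci M D E $ i $ j = (\<Sum>l\<in>UNIV. ?d l l i j) - T i j
      + (\<Sum>l\<in>UNIV. \<Sum>m\<in>UNIV. ?\<Gamma> m i j * ?\<Gamma> l l m) - (\<Sum>l\<in>UNIV. \<Sum>m\<in>UNIV. ?\<Gamma> m l j * ?\<Gamma> l i m)" for i j
    by (simp add: jet_ricci_def T_def sum.distrib sum_subtractf)
  have "jet_ricci M D E $ j $ i = jet_ricci M D E $ i $ j" for i j
  proof -
    have "(\<Sum>l\<in>UNIV. ?d l l j i) = (\<Sum>l\<in>UNIV. ?d l l i j)"
      by (intro sum.cong refl d)
    moreover have "(\<Sum>l\<in>UNIV. \<Sum>m\<in>UNIV. ?\<Gamma> m j i * ?\<Gamma> l l m) = (\<Sum>l\<in>UNIV. \<Sum>m\<in>UNIV. ?\<Gamma> m i j * ?\<Gamma> l l m)"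
      by (intro sum.cong refl arg_cong2[where f = "(*)"] \<Gamma>)
    ultimately show ?thesis
      using Q[of i j] Tsym[of i j] by (simp only: R)
  qed
  then show ?thesis
    by (simp add: vec_eq_iff transpose_def)
qed

lemma partial_deriv_transpose:
  fixes f :: "real^'n::finite \<Rightarrow> real^'m::finite^'k::finite"
  assumes "f differentiable at x"
  shows "partial_deriv i (\<lambda>y. transpose (f y)) x = transpose (partial_deriv i f x)"
proof (rule partial_deriv_bounded_linear[OF _ assms])
  show "bounded_linear (transpose :: real^'m^'k \<Rightarrow> _)"
    by (simp add: linear_conv_bounded_linear[symmetric] linear_iff transpose_def vec_eq_iff)
qed

text \<open>The defining formula treats the two indices differently, yet
  \<open>metric_norm_sq_le\<close> asks for a symmetric matrix. Symmetry of \<open>g c\<close>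
  passes to its derivatives, and mixed derivatives commute, so the jet satisfies the conditions of
  \<open>jet_ricci_symmetric\<close>.\<close>

lemma ricci_symmetric:
  assumes G: "twice_differentiable_on (g c) S" and S: "open S" "x \<in> S"
    and det: "\<And>y. y \<in> S \<Longrightarrow> det (g c y) \<noteq> 0" and sym: "\<And>y. y \<in> S \<Longrightarrow> transpose (g c y) = g c y"
  shows "transpose (ricci g c x) = ricci g c x"
proof -
  note d = twice_differentiable_on_at[OF G S(1)]
  have sD: "transpose (partial_deriv i (g c) y) = partial_deriv i (g c) y" if "y \<in> S" for i y
    unfolding partial_deriv_transpose[OF d(1)[OF that], symmetric]
    by (rule partial_deriv_cong[OF S(1) that sym])
  have sE: "transpose (partial_deriv m (partial_deriv i (g c)) x) = partial_deriv m (partial_deriv i (g c)) x" for m i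
    unfolding partial_deriv_transpose[OF d(2)[OF S(2)], symmetric]
    by (rule partial_deriv_cong[OF S sD])
  have "ricci g c x = jet_ricci (g c x) (jet1 (g c) x) (jet2 (g c) x)"
    using G S det by (rule ricci_eq_jet)
  moreover have "transpose (jet_ricci (g c x) (jet1 (g c) x) (jet2 (g c) x)) = jet_ricci (g c x) (jet1 (g c) x) (jet2 (g c) x)"
    by (rule jet_ricci_symmetric)
      (simp_all add: jet1_def jet2_def det S sym sD sE partial_deriv_commute_matrix[OF G S])
  ultimately show ?thesis
    by simp
qed

lemma continuous_on_matrix_inv:
  assumes "continuous_on S f" "\<And>x. x \<in> S \<Longrightarrow> det (f x :: real^'n^'n) \<noteq> 0"
  shows "continuous_on S (\<lambda>x. matrix_inv (f x))"
proof -
  have "continuous_on {A :: real^'n^'n. det A \<noteq> 0} matrix_inv"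
    using differentiable_matrix_inv[of "\<lambda>A. A :: real^'n^'n"]
    by (intro continuous_at_imp_continuous_on ballI differentiable_imp_continuous_within) simp
  from continuous_on_compose2[OF this assms(1)] assms(2) show ?thesis
    by auto
qed

lemma continuous_on_matrix_mult:
  fixes f :: "'a::topological_space \<Rightarrow> real^'n::finite^'m::finite" and g :: "'a \<Rightarrow> real^'k::finite^'n"
  assumes "continuous_on S f" "continuous_on S g"
  shows "continuous_on S (\<lambda>x. f x ** g x)"
  using assms by (rule bounded_bilinear.continuous_on[OF bounded_bilinear_matrix_mult])

text \<open>This continuity is what transfers closeness of metrics up to second derivatives to their
  Ricci tensors.\<close>

lemma continuous_on_jet_ricci:
  assumes M: "continuous_on S M" "\<And>x. x \<in> S \<Longrightarrow> det (M x :: real^'n^'n::finite) \<noteq> 0"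
    and D: "continuous_on S D" and E: "continuous_on S E"
  shows "continuous_on S (\<lambda>x. jet_ricci (M x) (D x) (E x))"
  unfolding jet_ricci_def jet_christoffel_def jet_christoffel_deriv_def
  by (intro continuous_intros continuous_on_vec_lambda continuous_on_matrix_mult continuous_on_matrix_inv M D E) simp_all

section \<open>Tensoriality of the Ricci tensor\<close>

definition jac :: "(real^'n::finite \<Rightarrow> real^'m::finite) \<Rightarrow> real^'n \<Rightarrow> real^'n^'m" where
  "jac \<psi> x = matrix (frechet_derivative \<psi> (at x))"

lemma jac_entry: "jac \<psi> x $ a $ i = partial_deriv i \<psi> x $ a"
  by (simp add: jac_def matrix_def partial_deriv_def)

text \<open>The connection form: one matrix per direction \<open>i\<close>, with the upper index as
  row. Matrix products then replace the index sums of the curvature formula.\<close>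

definition connection :: "(real^'n \<Rightarrow> real^'n^'n) \<Rightarrow> 'n::finite \<Rightarrow> real^'n \<Rightarrow> real^'n^'n" where
  "connection G i x = (\<chi> l m. christoffel G l i m x)"

text \<open>The curvature form dA + A wedge A of the connection form A, evaluated on the coordinate
  directions \<open>i\<close> and \<open>j\<close>.\<close>

definition curvature :: "(real^'n \<Rightarrow> real^'n^'n) \<Rightarrow> 'n::finite \<Rightarrow> 'n \<Rightarrow> real^'n \<Rightarrow> real^'n^'n" where
  "curvature G i j x = partial_deriv i (connection G j) x - partial_deriv j (connection G i) x
     + (connection G i x ** connection G j x - connection G j x ** connection G i x)"

lemma differentiable_connection:
  assumes "twice_differentiable_on G S" "open S" "x \<in> S" "\<And>y. y \<in> S \<Longrightarrow> det (G y) \<noteq> 0"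
  shows "connection G i differentiable at x"
proof (rule differentiable_matrixI)
  fix l m
  have "(\<lambda>y. connection G i y $ l $ m) = christoffel G l i m"
    by (simp add: connection_def fun_eq_iff)
  then show "(\<lambda>y. connection G i y $ l $ m) differentiable at x"
    using christoffel_derivative(1)[OF assms] by simp
qed

lemma ricci_eq_curvature:
  assumes "twice_differentiable_on (g c) S" "open S" "x \<in> S" "\<And>y. y \<in> S \<Longrightarrow> det (g c y) \<noteq> 0"
  shows "ricci g c x = (\<chi> i j. \<Sum>l\<in>UNIV. curvature (g c) l i x $ l $ j)"
proof -
  have "partial_deriv i (christoffel (g c) l j k) x = partial_deriv i (connection (g c) j) x $ l $ k" for i j k l
    using partial_deriv_matrix_entry[OF differentiable_connection[OF assms, of j], of i l k]
    by (simp add: connection_def)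
  then show ?thesis
    by (simp add: ricci_def riemann_def curvature_def vec_eq_iff sum_subtractf)
      (simp add: connection_def matrix_matrix_mult_def mult.commute)
qed

lemmas matrix_mult_simps =
  bounded_bilinear.add_left[OF bounded_bilinear_matrix_mult]
  bounded_bilinear.add_right[OF bounded_bilinear_matrix_mult]
  bounded_bilinear.diff_left[OF bounded_bilinear_matrix_mult]
  bounded_bilinear.diff_right[OF bounded_bilinear_matrix_mult]

text \<open>The local picture of a change of charts: \<open>G\<close> and \<open>H\<close> are the
  components of one metric and \<open>\<psi>\<close> is the transition map. The regularity
  \<open>dJ\<close> of the Jacobian accounts for the third derivatives of \<open>\<psi>\<close> that
  appear when the law for the connection is differentiated.\<close>

locale metric_transition =
  fixes \<psi> :: "real^'n::finite \<Rightarrow> real^'n" and S T :: "(real^'n) set"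
    and G H :: "real^'n \<Rightarrow> real^'n^'n"
  assumes S: "open S" and T: "open T" and \<psi>: "\<And>x. x \<in> S \<Longrightarrow> \<psi> x \<in> T"
    and d\<psi>: "twice_differentiable_on \<psi> S" and dJ: "twice_differentiable_on (jac \<psi>) S"
    and dG: "twice_differentiable_on G S" and dH: "twice_differentiable_on H T"
    and detG: "\<And>x. x \<in> S \<Longrightarrow> det (G x) \<noteq> 0" and detH: "\<And>x. x \<in> T \<Longrightarrow> det (H x) \<noteq> 0"
    and symH: "\<And>x. x \<in> T \<Longrightarrow> transpose (H x) = H x"
    and GH: "\<And>x. x \<in> S \<Longrightarrow> G x = transpose (jac \<psi> x) ** H (\<psi> x) ** jac \<psi> x"
begin

abbreviation "J \<equiv> jac \<psi>"

lemma det_J: "x \<in> S \<Longrightarrow> det (J x) \<noteq> 0"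
  using GH[of x] detG[of x] by (auto simp: det_mul)

lemma partial_deriv_J:
  assumes "x \<in> S"
  shows "partial_deriv i J x $ a $ j = partial_deriv i (partial_deriv j \<psi>) x $ a"
proof -
  have "partial_deriv i J x $ a $ j = partial_deriv i (\<lambda>y. partial_deriv j \<psi> y $ a) x"
    using partial_deriv_matrix_entry[OF twice_differentiable_on_at(1)[OF dJ S assms], of i a j]
    by (simp add: jac_entry)
  then show ?thesis
    using twice_differentiable_on_at[OF d\<psi> S assms] by (simp add: partial_deriv_vec_nth)
qed

lemma partial_deriv_J_sym:
  assumes "x \<in> S"
  shows "partial_deriv i J x $ a $ j = partial_deriv j J x $ a $ i"
  by (simp add: partial_deriv_J assms partial_deriv_commute_vec[OF d\<psi> S assms, of i j])

text \<open>\<open>B i\<close> is the pullback of the connection form of \<open>H\<close>; \<open>connection G i\<close> is its gauge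
  transform by \<open>J\<close>.\<close>

definition B :: "'n \<Rightarrow> real^'n \<Rightarrow> real^'n^'n" where
  "B i x = (\<Sum>c\<in>UNIV. (J x $ c $ i) *\<^sub>R connection H c (\<psi> x))"

text \<open>Differentiate \<open>GH\<close> and form the combination of three derivatives that
  defines the Christoffel symbols. By symmetry of the second derivatives of \<open>\<psi>\<close>,
  the terms containing them cancel except for two equal ones, which become the derivative of
  \<open>J\<close>; the rest is the Christoffel expression of \<open>H\<close>.\<close>

lemma connection_transform:
  assumes x: "x \<in> S"
  shows "J x ** connection G i x = B i x ** J x + partial_deriv i J x"
proof -
  define h where "h = H (\<psi> x)"
  define D where "D c = partial_deriv c H (\<psi> x)" for c
  define K where "K a i j = partial_deriv i J x $ a $ j" for a i j
  \<comment> \<open>In the derivative of \<open>G\<close>, \<open>t\<close> is a term in which a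
    Jacobian is differentiated and \<open>q\<close> the one in which \<open>H\<close> is.\<close>
  define t where "t i j l = (\<Sum>a\<in>UNIV. \<Sum>b\<in>UNIV. K a i j * h $ a $ b * J x $ b $ l)" for i j l
  define q where "q i j l = (\<Sum>b\<in>UNIV. \<Sum>c\<in>UNIV. \<Sum>a\<in>UNIV. J x $ b $ l * (J x $ c $ i * J x $ a $ j * D c $ a $ b))" for i j l
  have K: "K a i j = K a j i" for a i j
    unfolding K_def by (rule partial_deriv_J_sym[OF x])
  have h: "h $ a $ b = h $ b $ a" for a b
    unfolding h_def using symH[OF \<psi>[OF x]] by (rule transpose_eq_entry)
  have D: "D c $ a $ b = D c $ b $ a" for c a b
  proof (rule transpose_eq_entry)
    have "transpose (D c) = partial_deriv c (\<lambda>y. transpose (H y)) (\<psi> x)"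
      unfolding D_def using partial_deriv_transpose[OF twice_differentiable_on_at(1)[OF dH T \<psi>[OF x]]] by simp
    also have "\<dots> = D c"
      unfolding D_def by (rule partial_deriv_cong[OF T \<psi>[OF x] symH])
    finally show "transpose (D c) = D c" .
  qed
  have dGx: "partial_deriv i G x $ j $ l = t i j l + t i l j + q i j l" for i j l
  proof -
    have dJx: "J differentiable at x"
      by (rule twice_differentiable_on_at[OF dJ S x])
    have dHx: "(\<lambda>y. H (\<psi> y)) differentiable at x"
      using differentiable_chain_at[OF twice_differentiable_on_at(1)[OF d\<psi> S x]
          twice_differentiable_on_at(1)[OF dH T \<psi>[OF x]]] by (simp add: o_def)
    have dJt: "(\<lambda>y. transpose (J y)) differentiable at x"
      by (rule differentiable_matrixI) (simp add: transpose_def differentiable_matrix_entry dJx)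
    have pH: "partial_deriv i (\<lambda>y. H (\<psi> y)) x = (\<Sum>c\<in>UNIV. J x $ c $ i *\<^sub>R D c)"
      unfolding D_def jac_entry
      by (rule partial_deriv_chain[OF twice_differentiable_on_at(1)[OF dH T \<psi>[OF x]]
            twice_differentiable_on_at(1)[OF d\<psi> S x]])
    have "partial_deriv i G x = partial_deriv i (\<lambda>y. transpose (J y) ** H (\<psi> y) ** J y) x"
      by (rule partial_deriv_cong[OF S x GH])
    also have "\<dots> = transpose (partial_deriv i J x) ** h ** J x
        + transpose (J x) ** (\<Sum>c\<in>UNIV. J x $ c $ i *\<^sub>R D c) ** J x
        + transpose (J x) ** h ** partial_deriv i J x"
      unfolding partial_deriv_matrix_mult[OF differentiable_matrix_mult[OF dJt dHx] dJx]
        partial_deriv_matrix_mult[OF dJt dHx] partial_deriv_transpose[OF dJx] pH h_def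
      by (simp add: matrix_mult_simps)
    finally have eq: "partial_deriv i G x $ j $ l =
        (transpose (partial_deriv i J x) ** h ** J x) $ j $ l
        + (transpose (J x) ** (\<Sum>c\<in>UNIV. J x $ c $ i *\<^sub>R D c) ** J x) $ j $ l
        + (transpose (J x) ** h ** partial_deriv i J x) $ j $ l"
      by simp
    have 1: "(transpose (partial_deriv i J x) ** h ** J x) $ j $ l = t i j l"
      unfolding t_def K_def
      by (simp add: matrix_matrix_mult_def transpose_def sum_distrib_right) (rule sum.swap)
    have 2: "(transpose (J x) ** h ** partial_deriv i J x) $ j $ l = t i l j"
      unfolding t_def K_def
      by (simp add: matrix_matrix_mult_def transpose_def sum_distrib_left sum_distrib_right h mult_ac)
    have 3: "(transpose (J x) ** (\<Sum>c\<in>UNIV. J x $ c $ i *\<^sub>R D c) ** J x) $ j $ l = q i j l"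
    proof -
      have "(transpose (J x) ** (\<Sum>c\<in>UNIV. J x $ c $ i *\<^sub>R D c) ** J x) $ j $ l =
        (\<Sum>b\<in>UNIV. \<Sum>a\<in>UNIV. \<Sum>c\<in>UNIV. J x $ b $ l * (J x $ c $ i * J x $ a $ j * D c $ a $ b))"
        by (simp add: matrix_matrix_mult_def transpose_def sum_distrib_right sum_distrib_left mult_ac)
      also have "\<dots> = q i j l"
        unfolding q_def by (rule sum.cong[OF refl sum.swap])
      finally show ?thesis .
    qed
    show ?thesis
      unfolding eq 1 2 3 by simp
  qed
  \<comment> \<open>Twice the Christoffel symbols of \<open>H\<close> with all indices lowered, two
    of the indices being pulled back by \<open>J\<close>.\<close>
  define Z where "Z i j b = (\<Sum>c\<in>UNIV. \<Sum>a\<in>UNIV. J x $ c $ i * J x $ a $ j * (D c $ a $ b + D a $ c $ b - D b $ c $ a))"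
    for i j b
  have lower: "partial_deriv i G x $ j $ l + partial_deriv j G x $ i $ l - partial_deriv l G x $ i $ j
      = (\<Sum>b\<in>UNIV. J x $ b $ l * (2 * (\<Sum>a\<in>UNIV. K a i j * h $ a $ b) + Z i j b))" for i j l
  proof -
    have t1: "t i j l = (\<Sum>b\<in>UNIV. J x $ b $ l * (\<Sum>a\<in>UNIV. K a i j * h $ a $ b))"
      unfolding t_def by (subst sum.swap) (simp add: sum_distrib_left mult_ac)
    have q2: "q j i l = (\<Sum>b\<in>UNIV. \<Sum>c\<in>UNIV. \<Sum>a\<in>UNIV. J x $ b $ l * (J x $ c $ i * J x $ a $ j * D a $ c $ b))"
      unfolding q_def by (rule sum.cong[OF refl], subst sum.swap) (simp add: mult_ac)
    have q3: "q l i j = (\<Sum>b\<in>UNIV. \<Sum>c\<in>UNIV. \<Sum>a\<in>UNIV. J x $ b $ l * (J x $ c $ i * J x $ a $ j * D b $ c $ a))"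
    proof -
      have "q l i j = (\<Sum>c\<in>UNIV. \<Sum>b\<in>UNIV. \<Sum>a\<in>UNIV. J x $ b $ j * (J x $ c $ l * J x $ a $ i * D c $ a $ b))"
        unfolding q_def by (rule sum.swap)
      also have "\<dots> = (\<Sum>c\<in>UNIV. \<Sum>a\<in>UNIV. \<Sum>b\<in>UNIV. J x $ b $ j * (J x $ c $ l * J x $ a $ i * D c $ a $ b))"
        by (rule sum.cong[OF refl sum.swap])
      finally show ?thesis
        by (simp add: mult_ac)
    qed
    have qs: "q i j l + q j i l - q l i j = (\<Sum>b\<in>UNIV. J x $ b $ l * Z i j b)"
      unfolding q2 q3 unfolding q_def Z_def
      by (simp add: sum_distrib_left right_diff_distrib distrib_left sum.distrib sum_subtractf mult_ac)
    have "t i j l = t j i l" "t i l j = t l i j" "t j l i = t l j i"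
      unfolding t_def by (simp_all add: K)
    then have "partial_deriv i G x $ j $ l + partial_deriv j G x $ i $ l - partial_deriv l G x $ i $ j
        = 2 * t i j l + (q i j l + q j i l - q l i j)"
      unfolding dGx by simp
    then show ?thesis
      unfolding qs t1 by (simp add: sum.distrib distrib_left sum_distrib_left mult_ac)
  qed
  \<comment> \<open>Converts the index raised with \<open>G\<close> into an index raised with
    \<open>H\<close>.\<close>
  have inv: "J x ** matrix_inv (G x) ** transpose (J x) = matrix_inv h"
  proof (rule matrix_inv_eqI[symmetric])
    have "transpose (J x) ** (h ** (J x ** matrix_inv (G x))) = mat 1"
      using matrix_inv_mult(2)[OF detG[OF x]] unfolding GH[OF x, folded h_def] by (simp add: matrix_mul_assoc)
    then have "(h ** (J x ** matrix_inv (G x))) ** transpose (J x) = mat 1"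
      by (rule matrix_left_right_inverse1)
    then show "h ** (J x ** matrix_inv (G x) ** transpose (J x)) = mat 1"
      by (simp add: matrix_mul_assoc)
  qed
  have "(J x ** connection G i x) $ m $ j = (B i x ** J x + partial_deriv i J x) $ m $ j" for m j
  proof -
    define W where "W b = 2 * (\<Sum>a\<in>UNIV. K a i j * h $ a $ b) + Z i j b" for b
    have "(J x ** connection G i x) $ m $ j = (\<Sum>k\<in>UNIV. J x $ m $ k * christoffel G k i j x)"
      by (simp add: matrix_matrix_mult_def connection_def)
    also have "\<dots> = (\<Sum>k\<in>UNIV. J x $ m $ k * (\<Sum>l\<in>UNIV. matrix_inv (G x) $ k $ l * (\<Sum>b\<in>UNIV. J x $ b $ l * W b))) / 2"
      unfolding W_def lower[symmetric]
      by (simp add: christoffel_def partial_deriv_matrix_entry twice_differentiable_on_at[OF dG S x]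
          flip: sum_divide_distrib)
    also have "(\<Sum>k\<in>UNIV. J x $ m $ k * (\<Sum>l\<in>UNIV. matrix_inv (G x) $ k $ l * (\<Sum>b\<in>UNIV. J x $ b $ l * W b)))
        = ((J x ** (matrix_inv (G x) ** transpose (J x))) *v (\<chi> b. W b)) $ m"
      unfolding matrix_vector_mul_assoc[symmetric]
      by (simp only: matrix_vector_mult_def transpose_def vec_lambda_beta)
    also have "\<dots> = (\<Sum>b\<in>UNIV. matrix_inv h $ m $ b * W b)"
      unfolding matrix_mul_assoc inv by (simp add: matrix_vector_mult_def)
    also have "\<dots> = 2 * (\<Sum>b\<in>UNIV. \<Sum>a\<in>UNIV. matrix_inv h $ m $ b * h $ b $ a * K a i j) + (\<Sum>b\<in>UNIV. matrix_inv h $ m $ b * Z i j b)"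
      unfolding W_def by (simp add: distrib_left sum.distrib sum_distrib_left h mult_ac)
    also have "(\<Sum>b\<in>UNIV. \<Sum>a\<in>UNIV. matrix_inv h $ m $ b * h $ b $ a * K a i j) = K m i j"
    proof -
      have "(\<Sum>b\<in>UNIV. \<Sum>a\<in>UNIV. matrix_inv h $ m $ b * h $ b $ a * K a i j) = (\<Sum>a\<in>UNIV. (matrix_inv h ** h) $ m $ a * K a i j)"
        by (subst sum.swap) (simp add: matrix_matrix_mult_def sum_distrib_right)
      also have "matrix_inv h ** h = mat 1"
        unfolding h_def by (rule matrix_inv_mult[OF detH[OF \<psi>[OF x]]])
      finally show ?thesis
        by (simp add: mat_def if_distrib[of "\<lambda>z. z * _"] cong: if_cong)
    qed
    also have "(\<Sum>b\<in>UNIV. matrix_inv h $ m $ b * Z i j b) =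
        2 * (\<Sum>c\<in>UNIV. \<Sum>a\<in>UNIV. J x $ c $ i * J x $ a $ j * christoffel H m c a (\<psi> x))"
    proof -
      have chr: "2 * christoffel H m c a (\<psi> x) =
          (\<Sum>b\<in>UNIV. matrix_inv h $ m $ b * (D c $ a $ b + D a $ c $ b - D b $ c $ a))" for c a
        by (simp add: christoffel_def h_def D_def partial_deriv_matrix_entry
            twice_differentiable_on_at[OF dH T \<psi>[OF x]])
      have "(\<Sum>b\<in>UNIV. matrix_inv h $ m $ b * Z i j b) = (\<Sum>b\<in>UNIV. \<Sum>c\<in>UNIV. \<Sum>a\<in>UNIV.
          J x $ c $ i * J x $ a $ j * (matrix_inv h $ m $ b * (D c $ a $ b + D a $ c $ b - D b $ c $ a)))"
        unfolding Z_def by (simp add: sum_distrib_left mult_ac)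
      also have "\<dots> = (\<Sum>c\<in>UNIV. \<Sum>a\<in>UNIV. \<Sum>b\<in>UNIV.
          J x $ c $ i * J x $ a $ j * (matrix_inv h $ m $ b * (D c $ a $ b + D a $ c $ b - D b $ c $ a)))"
        by (subst sum.swap) (rule sum.cong[OF refl sum.swap])
      also have "\<dots> = (\<Sum>c\<in>UNIV. \<Sum>a\<in>UNIV. J x $ c $ i * J x $ a $ j * (2 * christoffel H m c a (\<psi> x)))"
        unfolding chr by (simp add: sum_distrib_left)
      finally show ?thesis
        by (simp add: sum_distrib_left mult_ac)
    qed
    also have "(2 * K m i j + 2 * (\<Sum>c\<in>UNIV. \<Sum>a\<in>UNIV. J x $ c $ i * J x $ a $ j * christoffel H m c a (\<psi> x))) / 2
        = (\<Sum>a\<in>UNIV. \<Sum>c\<in>UNIV. J x $ c $ i * J x $ a $ j * christoffel H m c a (\<psi> x)) + K m i j"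
      by (subst sum.swap) simp
    also have "\<dots> = (B i x ** J x + partial_deriv i J x) $ m $ j"
      by (simp add: B_def K_def matrix_matrix_mult_def connection_def sum_distrib_left sum_distrib_right mult_ac)
    finally show ?thesis .
  qed
  then show ?thesis
    by (simp add: vec_eq_iff)
qed

lemma differentiable_B: "x \<in> S \<Longrightarrow> B i differentiable at x"
  and partial_deriv_B: "x \<in> S \<Longrightarrow> partial_deriv i (B j) x =
    (\<Sum>c\<in>UNIV. (partial_deriv i J x $ c $ j) *\<^sub>R connection H c (\<psi> x))
    + (\<Sum>a\<in>UNIV. \<Sum>c\<in>UNIV. (J x $ a $ i * J x $ c $ j) *\<^sub>R partial_deriv a (connection H c) (\<psi> x))"
proof -
  assume x: "x \<in> S"
  note dJx = twice_differentiable_on_at(1)[OF dJ S x]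
  note d\<psi>x = twice_differentiable_on_at(1)[OF d\<psi> S x]
  note dC = differentiable_connection[OF dH T \<psi>[OF x] detH]
  have dC': "(\<lambda>y. connection H c (\<psi> y)) differentiable at x" for c
    using differentiable_chain_at[OF d\<psi>x dC] by (simp add: o_def)
  have dt: "(\<lambda>y. (J y $ c $ i) *\<^sub>R connection H c (\<psi> y)) differentiable at x" for c i
    by (intro differentiable_scaleR' differentiable_matrix_entry dJx dC')
  have B: "B i = (\<lambda>y. \<Sum>c\<in>UNIV. (J y $ c $ i) *\<^sub>R connection H c (\<psi> y))" for i
    by (simp add: B_def fun_eq_iff)
  show "B i differentiable at x"
    unfolding B by (intro differentiable_sum ballI dt) simp
  have "partial_deriv i (B j) x = (\<Sum>c\<in>UNIV. (partial_deriv i J x $ c $ j) *\<^sub>R connection H c (\<psi> x)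
      + (J x $ c $ j) *\<^sub>R (\<Sum>a\<in>UNIV. (J x $ a $ i) *\<^sub>R partial_deriv a (connection H c) (\<psi> x)))"
    unfolding B partial_deriv_sum[OF dt]
    by (rule sum.cong)
      (simp_all add: partial_deriv_scaleR[OF differentiable_matrix_entry[OF dJx] dC']
        partial_deriv_matrix_entry[OF dJx] partial_deriv_chain[OF dC d\<psi>x] flip: jac_entry)
  also have "(\<Sum>c\<in>UNIV. (J x $ c $ j) *\<^sub>R (\<Sum>a\<in>UNIV. (J x $ a $ i) *\<^sub>R partial_deriv a (connection H c) (\<psi> x)))
      = (\<Sum>a\<in>UNIV. \<Sum>c\<in>UNIV. (J x $ a $ i * J x $ c $ j) *\<^sub>R partial_deriv a (connection H c) (\<psi> x))"
    by (subst sum.swap) (simp add: scaleR_sum_right mult_ac)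
  then have "(\<Sum>c\<in>UNIV. (partial_deriv i J x $ c $ j) *\<^sub>R connection H c (\<psi> x)
      + (J x $ c $ j) *\<^sub>R (\<Sum>a\<in>UNIV. (J x $ a $ i) *\<^sub>R partial_deriv a (connection H c) (\<psi> x)))
      = (\<Sum>c\<in>UNIV. (partial_deriv i J x $ c $ j) *\<^sub>R connection H c (\<psi> x))
      + (\<Sum>a\<in>UNIV. \<Sum>c\<in>UNIV. (J x $ a $ i * J x $ c $ j) *\<^sub>R partial_deriv a (connection H c) (\<psi> x))"
    by (simp add: sum.distrib)
  finally show "partial_deriv i (B j) x =
    (\<Sum>c\<in>UNIV. (partial_deriv i J x $ c $ j) *\<^sub>R connection H c (\<psi> x))
    + (\<Sum>a\<in>UNIV. \<Sum>c\<in>UNIV. (J x $ a $ i * J x $ c $ j) *\<^sub>R partial_deriv a (connection H c) (\<psi> x))" .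
qed

text \<open>The terms with a derivative of \<open>J\<close> are symmetric in \<open>i\<close> and
  \<open>j\<close> by \<open>partial_deriv_J_sym\<close> and drop out of the antisymmetrization.
  What remains is the curvature of \<open>H\<close> with both form indices pulled back.\<close>

lemma curvature_B:
  assumes x: "x \<in> S"
  shows "partial_deriv i (B j) x - partial_deriv j (B i) x + (B i x ** B j x - B j x ** B i x) =
    (\<Sum>a\<in>UNIV. \<Sum>c\<in>UNIV. (J x $ a $ i * J x $ c $ j) *\<^sub>R curvature H a c (\<psi> x))"
proof -
  let ?C = "\<lambda>c. connection H c (\<psi> x)"
  have BB: "B i x ** B j x = (\<Sum>a\<in>UNIV. \<Sum>c\<in>UNIV. (J x $ a $ i * J x $ c $ j) *\<^sub>R (?C a ** ?C c))" for i j
    unfolding B_def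
    by (simp add: bounded_bilinear.sum_left[OF bounded_bilinear_matrix_mult]
        bounded_bilinear.sum_right[OF bounded_bilinear_matrix_mult]
        bounded_bilinear.scaleR_left[OF bounded_bilinear_matrix_mult]
        bounded_bilinear.scaleR_right[OF bounded_bilinear_matrix_mult] scaleR_sum_right mult_ac,
        subst sum.swap, simp add: mult.commute)
  have swap: "(\<Sum>a\<in>UNIV. \<Sum>c\<in>UNIV. (J x $ a $ j * J x $ c $ i) *\<^sub>R X a c)
      = (\<Sum>a\<in>UNIV. \<Sum>c\<in>UNIV. (J x $ a $ i * J x $ c $ j) *\<^sub>R X c a)" for X :: "'n \<Rightarrow> 'n \<Rightarrow> real^'n^'n"
    by (subst sum.swap) (simp add: mult_ac)
  have sym: "(\<Sum>c\<in>UNIV. (partial_deriv i J x $ c $ j) *\<^sub>R ?C c) = (\<Sum>c\<in>UNIV. (partial_deriv j J x $ c $ i) *\<^sub>R ?C c)"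
    by (simp add: partial_deriv_J_sym[OF x, of i _ j])
  show ?thesis
    unfolding partial_deriv_B[OF x] BB sym
      swap[of "\<lambda>a c. partial_deriv a (connection H c) (\<psi> x)"] swap[of "\<lambda>a c. ?C a ** ?C c"]
    unfolding curvature_def
    by (simp add: sum.distrib sum_subtractf scaleR_add_right scaleR_diff_right)
qed

text \<open>Differentiate \<open>connection_transform\<close> and antisymmetrize: the second
  derivatives of \<open>J\<close> commute, and the terms with a single derivative of
  \<open>J\<close> cancel against those from the commutator. Keeping \<open>J\<close> as a left
  factor avoids differentiating its inverse.\<close>

lemma curvature_transform:
  assumes x: "x \<in> S"
  shows "J x ** curvature G i j x =
    (\<Sum>a\<in>UNIV. \<Sum>c\<in>UNIV. (J x $ a $ i * J x $ c $ j) *\<^sub>R curvature H a c (\<psi> x)) ** J x"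
proof -
  note dJx = twice_differentiable_on_at[OF dJ S x]
  note dA = differentiable_connection[OF dG S x detG]
  let ?A = "\<lambda>i. connection G i x"
  have der: "partial_deriv i J x ** ?A j + J x ** partial_deriv i (connection G j) x =
      partial_deriv i (B j) x ** J x + B j x ** partial_deriv i J x + partial_deriv i (partial_deriv j J) x" for i j
  proof -
    have "partial_deriv i (\<lambda>y. J y ** connection G j y) x = partial_deriv i (\<lambda>y. B j y ** J y + partial_deriv j J y) x"
      by (rule partial_deriv_cong[OF S x connection_transform])
    then show ?thesis
      by (simp add: partial_deriv_matrix_mult dJx dA partial_deriv_add differentiable_B[OF x]
          differentiable_matrix_mult)
  qed
  have com: "J x ** (?A i ** ?A j) = B i x ** (B j x ** J x + partial_deriv j J x) + partial_deriv i J x ** ?A j" for i j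
  proof -
    have "J x ** (?A i ** ?A j) = (B i x ** J x + partial_deriv i J x) ** ?A j"
      by (simp add: matrix_mul_assoc connection_transform[OF x])
    also have "\<dots> = B i x ** (J x ** ?A j) + partial_deriv i J x ** ?A j"
      by (simp add: matrix_mult_simps matrix_mul_assoc)
    finally show ?thesis
      by (simp add: connection_transform[OF x])
  qed
  have d: "J x ** partial_deriv i (connection G j) x = partial_deriv i (B j) x ** J x + B j x ** partial_deriv i J x
      + partial_deriv i (partial_deriv j J) x - partial_deriv i J x ** ?A j" for i j
    using der[of i j] by (simp add: algebra_simps)
  have "J x ** curvature G i j x = (partial_deriv i (B j) x - partial_deriv j (B i) x + (B i x ** B j x - B j x ** B i x)) ** J x"
    unfolding curvature_def matrix_mult_simps d com
    by (simp add: partial_deriv_commute_matrix[OF dJ S x, of j i] matrix_mul_assoc)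
  then show ?thesis
    unfolding curvature_B[OF x] .
qed

end

text \<open>In the trace over the upper index and the first form index, \<open>J\<close> meets its
  inverse and both disappear. Each of the two free indices keeps one factor
  \<open>J\<close>.\<close>

lemma ricci_transform:
  assumes "metric_transition \<psi> S T (g c) (g d)" and x: "x \<in> S"
  shows "ricci g c x = transpose (jac \<psi> x) ** ricci g d (\<psi> x) ** jac \<psi> x"
proof -
  interpret metric_transition \<psi> S T "g c" "g d"
    by (rule assms(1))
  define I where "I = matrix_inv (J x)"
  have IJ: "I ** J x = mat 1" and JI: "J x ** I = mat 1"
    unfolding I_def by (rule matrix_inv_mult[OF det_J[OF x]])+
  let ?F = "\<lambda>a b. curvature (g d) a b (\<psi> x)"
  have F: "curvature (g c) l i x = I ** (\<Sum>a\<in>UNIV. \<Sum>b\<in>UNIV. (J x $ a $ l * J x $ b $ i) *\<^sub>R ?F a b) ** J x" for l i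
  proof -
    have "curvature (g c) l i x = I ** (J x ** curvature (g c) l i x)"
      by (simp add: matrix_mul_assoc IJ)
    then show ?thesis
      unfolding curvature_transform[OF x] by (simp add: matrix_mul_assoc)
  qed
  have "(\<Sum>l\<in>UNIV. curvature (g c) l i x $ l $ j) = (\<Sum>b\<in>UNIV. \<Sum>q\<in>UNIV. J x $ b $ i * (\<Sum>a\<in>UNIV. ?F a b $ a $ q) * J x $ q $ j)" for i j
  proof -
    have "(\<Sum>l\<in>UNIV. curvature (g c) l i x $ l $ j) = (\<Sum>l\<in>UNIV. \<Sum>q\<in>UNIV. \<Sum>p\<in>UNIV. \<Sum>a\<in>UNIV. \<Sum>b\<in>UNIV.
        (J x $ a $ l * I $ l $ p) * (J x $ b $ i * ?F a b $ p $ q * J x $ q $ j))"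
      unfolding F by (simp add: matrix_matrix_mult_def sum_distrib_left sum_distrib_right mult_ac)
    \<comment> \<open>Putting the sum over \<open>l\<close> innermost exposes the product
      \<open>J x ** I\<close>.\<close>
    also have "\<dots> = (\<Sum>b\<in>UNIV. \<Sum>q\<in>UNIV. \<Sum>a\<in>UNIV. \<Sum>p\<in>UNIV. \<Sum>l\<in>UNIV.
        (J x $ a $ l * I $ l $ p) * (J x $ b $ i * ?F a b $ p $ q * J x $ q $ j))"
      unfolding sum.cartesian_product
      by (rule sum.reindex_bij_witness[of _
            "\<lambda>(b, q, a, p, l). (l, q, p, a, b)" "\<lambda>(l, q, p, a, b). (b, q, a, p, l)"]) auto
    also have "\<dots> = (\<Sum>b\<in>UNIV. \<Sum>q\<in>UNIV. \<Sum>a\<in>UNIV. \<Sum>p\<in>UNIV.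
        (J x ** I) $ a $ p * (J x $ b $ i * ?F a b $ p $ q * J x $ q $ j))"
      by (simp add: matrix_matrix_mult_def sum_distrib_right)
    also have "\<dots> = (\<Sum>b\<in>UNIV. \<Sum>q\<in>UNIV. \<Sum>a\<in>UNIV. J x $ b $ i * ?F a b $ a $ q * J x $ q $ j)"
      unfolding JI by (simp add: mat_def if_distrib[of "\<lambda>z. z * _"] cong: if_cong)
    finally show ?thesis
      by (simp add: sum_distrib_left sum_distrib_right)
  qed
  moreover have "(transpose (J x) ** (\<chi> b q. \<Sum>a\<in>UNIV. ?F a b $ a $ q) ** J x) $ i $ j =
      (\<Sum>b\<in>UNIV. \<Sum>q\<in>UNIV. J x $ b $ i * (\<Sum>a\<in>UNIV. ?F a b $ a $ q) * J x $ q $ j)" for i j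
    by (subst sum.swap) (simp add: matrix_matrix_mult_def transpose_def sum_distrib_right)
  moreover have r1: "ricci g c x = (\<chi> i j. \<Sum>l\<in>UNIV. curvature (g c) l i x $ l $ j)"
    using dG S x detG by (rule ricci_eq_curvature)
  moreover have r2: "ricci g d (\<psi> x) = (\<chi> i j. \<Sum>l\<in>UNIV. curvature (g d) l i (\<psi> x) $ l $ j)"
    using dH T \<psi>[OF x] detH by (rule ricci_eq_curvature)
  ultimately show ?thesis
    unfolding r1 r2 by (simp only: vec_eq_iff vec_lambda_beta simp_thms)
qed

section \<open>The Riemannian measure\<close>

lemma jacobian_eq_jac: "jacobian \<phi> c d p = jac (chart_map d \<circ> \<phi> \<circ> chart_inv c) (chart_map c p)"
  by (simp add: jacobian_def jac_def)

section \<open>Charts as homeomorphisms onto open sets\<close>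

context
  fixes c :: "('a::topological_space, 'n::finite) chart"
  assumes c: "is_chart c"
begin

lemma chart_open: "open (chart_dom c)" "open (chart_img c)"
  using c by (auto simp: is_chart_def)

lemma chart_homeo: "homeomorphism (chart_dom c) (chart_img c) (chart_map c) (chart_inv c)"
  using c by (auto simp: is_chart_def)

lemma chart_inv_map: "p \<in> chart_dom c \<Longrightarrow> chart_inv c (chart_map c p) = p"
  using homeomorphism_apply1[OF chart_homeo] .

lemma chart_inj: "inj_on (chart_map c) (chart_dom c)"
  by (metis chart_inv_map inj_onI)

lemma chart_image_eq:
  assumes "B \<subseteq> chart_dom c"
  shows "chart_map c ` B = chart_inv c -` B \<inter> chart_img c"
  using assms chart_inv_map by (force simp: image_iff)

lemma chart_image_open:
  assumes "open B" "B \<subseteq> chart_dom c"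
  shows "open (chart_map c ` B)"
  unfolding chart_image_eq[OF assms(2)]
  using homeomorphism_cont2[OF chart_homeo] chart_open assms(1)
  by (metis continuous_on_open_vimage)

lemma chart_image_borel:
  assumes "B \<in> sets borel" "B \<subseteq> chart_dom c"
  shows "chart_map c ` B \<in> sets borel"
proof -
  have "chart_inv c \<in> borel_measurable (restrict_space borel (chart_img c))"
    by (rule borel_measurable_continuous_on_restrict[OF homeomorphism_cont2[OF chart_homeo]])
  from measurable_sets[OF this assms(1)]
  have "chart_inv c -` B \<inter> chart_img c \<in> sets (restrict_space borel (chart_img c))"
    by (simp add: space_restrict_space)
  then show ?thesis
    unfolding chart_image_eq[OF assms(2)]
    using chart_open by (subst (asm) sets_restrict_space_iff) auto
qed

end

lemma smooth_atlas_chart: "smooth_atlas \<A> \<Longrightarrow> c \<in> \<A> \<Longrightarrow> is_chart c"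
  by (simp add: smooth_atlas_def)

lemma smooth_atlas_cover:
  assumes "smooth_atlas \<A>"
  shows "\<exists>c\<in>\<A>. p \<in> chart_dom c"
proof -
  have "p \<in> (\<Union>c\<in>\<A>. chart_dom c)"
    using assms by (simp add: smooth_atlas_def)
  then show ?thesis
    by blast
qed

section \<open>Volume in a single chart\<close>

definition metric_density :: "('a, 'n::finite) tensor2 \<Rightarrow> ('a, 'n) chart \<Rightarrow> real^'n \<Rightarrow> real" where
  "metric_density g c x = sqrt (det (g c x))"

definition chart_volume ::
    "('a, 'n::finite) tensor2 \<Rightarrow> ('a, 'n) chart \<Rightarrow> 'a set \<Rightarrow> ennreal" where
  "chart_volume g c B = (\<integral>\<^sup>+x\<in>chart_map c ` B. ennreal (metric_density g c x) \<partial>lborel)"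

text \<open>The indicator removes the values of \<open>g\<close> outside the chart image, which are
  arbitrary and might not be measurable. As a genuine measure on coordinates it lends its additivity
  to \<open>chart_volume\<close>.\<close>

definition chart_measure :: "('a, 'n::finite) tensor2 \<Rightarrow> ('a, 'n) chart \<Rightarrow> (real^'n) measure" where
  "chart_measure g c = density lborel (\<lambda>x. ennreal (indicator (chart_img c) x *\<^sub>R metric_density g c x))"

text \<open>The common ground of \<open>smooth_metric\<close> and \<open>holder_metric 2\<close>, so
  that the measure theory covers \<open>g\<close> and its competitors at once.\<close>

definition continuous_metric ::
    "('a, 'n::finite) chart set \<Rightarrow> ('a, 'n) tensor2 \<Rightarrow> bool" where
  "continuous_metric \<A> g \<longleftrightarrow>
     riemannian_metric \<A> g \<and> (\<forall>c\<in>\<A>. continuous_on (chart_img c) (g c))"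

lemma riemannian_metric_pos_def:
  "riemannian_metric \<A> g \<Longrightarrow> c \<in> \<A> \<Longrightarrow> x \<in> chart_img c \<Longrightarrow> pos_def (g c x)"
  unfolding riemannian_metric_def pos_def_def by blast

lemma riemannian_metric_transform:
  "riemannian_metric \<A> g \<Longrightarrow> c \<in> \<A> \<Longrightarrow> d \<in> \<A> \<Longrightarrow> p \<in> chart_dom c \<Longrightarrow> p \<in> chart_dom d \<Longrightarrow>
   g c (chart_map c p) = transpose (jacobian id c d p) ** g d (chart_map d p) ** jacobian id c d p"
  unfolding riemannian_metric_def by blast

lemma continuous_metricD:
  assumes "continuous_metric \<A> g"
  shows "riemannian_metric \<A> g" "c \<in> \<A> \<Longrightarrow> continuous_on (chart_img c) (g c)"
  using assms unfolding continuous_metric_def by blast+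

lemmas continuous_metric_pos_def = riemannian_metric_pos_def[OF continuous_metricD(1)]

lemma metric_density_pos:
  "continuous_metric \<A> g \<Longrightarrow> c \<in> \<A> \<Longrightarrow> x \<in> chart_img c \<Longrightarrow> metric_density g c x > 0"
  using pos_def_det_pos[OF continuous_metric_pos_def] by (simp add: metric_density_def)

lemma continuous_on_metric_density:
  assumes "continuous_metric \<A> g" "c \<in> \<A>"
  shows "continuous_on (chart_img c) (metric_density g c)"
proof -
  have "continuous_on UNIV (det :: real^'n^'n \<Rightarrow> real)"
    by (simp add: continuous_on_eq_continuous_at isCont_det)
  then have "continuous_on (chart_img c) (\<lambda>x. det (g c x))"
    using continuous_metricD(2)[OF assms] by (rule continuous_on_compose2) simp
  then show ?thesis
    unfolding metric_density_def[abs_def] by (intro continuous_intros)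
qed

lemma measurable_metric_density:
  assumes g: "continuous_metric \<A> g" "c \<in> \<A>" "is_chart c" and S: "S \<in> sets borel" "S \<subseteq> chart_img c"
  shows "(\<lambda>x. indicator S x *\<^sub>R metric_density g c x) \<in> borel_measurable borel"
proof -
  have "(\<lambda>x. indicator (chart_img c) x *\<^sub>R metric_density g c x) \<in> borel_measurable borel"
    using chart_open[OF g(3)] continuous_on_metric_density[OF g(1,2)]
    by (intro borel_measurable_continuous_on_indicator) auto
  then have "(\<lambda>x. indicator S x *\<^sub>R (indicator (chart_img c) x *\<^sub>R metric_density g c x)) \<in> borel_measurable borel"
    using S by measurable
  also have "(\<lambda>x. indicator S x *\<^sub>R (indicator (chart_img c) x *\<^sub>R metric_density g c x)) =
      (\<lambda>x. indicator S x *\<^sub>R metric_density g c x)"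
    using S by (auto simp: fun_eq_iff split: split_indicator)
  finally show ?thesis .
qed

lemma sets_chart_measure [simp]: "sets (chart_measure g c) = sets borel"
  by (simp add: chart_measure_def)

lemma chart_volume_eq_measure:
  assumes g: "continuous_metric \<A> g" "c \<in> \<A>" "is_chart c" and B: "B \<in> sets borel" "B \<subseteq> chart_dom c"
  shows "chart_volume g c B = emeasure (chart_measure g c) (chart_map c ` B)"
proof -
  have "(\<lambda>x. ennreal (indicator (chart_img c) x *\<^sub>R metric_density g c x)) \<in> borel_measurable borel"
    using measurable_metric_density[OF g, of "chart_img c"] chart_open[OF g(3)] by measurable
  then have "emeasure (chart_measure g c) (chart_map c ` B) =
      (\<integral>\<^sup>+x\<in>chart_map c ` B. ennreal (indicator (chart_img c) x *\<^sub>R metric_density g c x) \<partial>lborel)"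
    unfolding chart_measure_def using chart_image_borel[OF g(3) B]
    by (subst emeasure_density) (auto simp: mult.commute)
  also have "\<dots> = chart_volume g c B"
    unfolding chart_volume_def using B by (intro nn_integral_cong) (auto split: split_indicator)
  finally show ?thesis
    by simp
qed

text \<open>The density of \<open>h\<close> is that of \<open>g\<close> after \<open>\<phi>\<close>
  times the Jacobian factor of \<open>\<phi>\<close> and the square root of the scaling of the
  determinant, so this is change of variables in coordinates. With the identity and
  \<open>r = 1\<close> it says that two charts measure a set alike; with a diffeomorphism it
  computes the volume of a rescaled pullback.\<close>

lemma chart_volume_transform:
  fixes \<phi> :: "'a::topological_space \<Rightarrow> 'a" and c d :: "('a, 'n::finite) chart"
  assumes h: "continuous_metric \<A> h" and g: "continuous_metric \<A> g"
    and c: "c \<in> \<A>" "is_chart c" and d: "d \<in> \<A>" "is_chart d"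
    and B: "B \<in> sets borel" "B \<subseteq> chart_dom c"
    and \<phi>B: "\<phi> ` B \<in> sets borel" "\<phi> ` B \<subseteq> chart_dom d" and inj: "inj_on \<phi> B"
    and diff: "\<And>p. p \<in> B \<Longrightarrow> (chart_map d \<circ> \<phi> \<circ> chart_inv c) differentiable at (chart_map c p)"
    and r: "r > 0" and eq: "\<And>p. p \<in> B \<Longrightarrow> h c (chart_map c p) =
      r *\<^sub>R (transpose (jacobian \<phi> c d p) ** g d (chart_map d (\<phi> p)) ** jacobian \<phi> c d p)"
  shows "chart_volume h c B = ennreal (sqrt (r ^ CARD('n))) * chart_volume g d (\<phi> ` B)"
proof -
  define \<psi> where "\<psi> = chart_map d \<circ> \<phi> \<circ> chart_inv c"
  define S where "S = chart_map c ` B"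
  define k where "k = sqrt (r ^ CARD('n))"
  have k: "k > 0"
    using r by (simp add: k_def)
  have \<psi>: "\<psi> (chart_map c p) = chart_map d (\<phi> p)" if "p \<in> B" for p
    using that B chart_inv_map[OF c(2)] by (auto simp: \<psi>_def)
  have img: "\<psi> ` S = chart_map d ` \<phi> ` B"
    using \<psi> by (force simp: S_def)
  have S: "S \<in> sets borel" "S \<subseteq> chart_img c"
    using chart_image_borel[OF c(2) B] B by (auto simp: S_def)
  have T: "\<psi> ` S \<in> sets borel" "\<psi> ` S \<subseteq> chart_img d"
    using chart_image_borel[OF d(2) \<phi>B] \<phi>B by (auto simp: img)
  have dens: "metric_density h c x = k * (\<bar>det (matrix (frechet_derivative \<psi> (at x)))\<bar> * metric_density g d (\<psi> x))"
    if x: "x \<in> S" for x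
  proof -
    obtain p where p: "p \<in> B" "x = chart_map c p"
      using x unfolding S_def by blast
    let ?J = "matrix (frechet_derivative \<psi> (at x))"
    have J: "jacobian \<phi> c d p = ?J"
      by (simp add: jacobian_def \<psi>_def p)
    have "r *\<^sub>R A = (\<chi> i. r *s A $ i)" for A :: "real^'n^'n"
      by (simp add: vec_eq_iff)
    then have "det (r *\<^sub>R A) = r ^ CARD('n) * det A" for A :: "real^'n^'n"
      using det_rows_mul[of "\<lambda>i. r" "\<lambda>i. A $ i"] by simp
    then have "det (h c x) = r ^ CARD('n) * ((det ?J)\<^sup>2 * det (g d (\<psi> x)))"
      using eq[OF p(1)] \<psi>[OF p(1)] by (simp add: p(2)[symmetric] J det_mul power2_eq_square)
    then show ?thesis
      by (simp add: metric_density_def real_sqrt_mult k_def)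
  qed
  have inj\<psi>: "inj_on \<psi> S"
  proof (rule inj_onI)
    fix x y
    assume "x \<in> S" "y \<in> S" "\<psi> x = \<psi> y"
    then obtain p q where pq: "p \<in> B" "q \<in> B" "x = chart_map c p" "y = chart_map c q"
      "chart_map d (\<phi> p) = chart_map d (\<phi> q)"
      using \<psi> by (auto simp: S_def)
    then have "\<phi> p = \<phi> q"
      using chart_inj[OF d(2)] \<phi>B by (auto dest: inj_onD)
    then show "x = y"
      using inj pq by (auto dest: inj_onD)
  qed
  \<comment> \<open>The derivative of \<open>\<psi>\<close> is only known pointwise. Measurability
    of the Jacobian factor comes from \<open>dens\<close>, which identifies the integrand with a
    multiple of the density of \<open>h\<close>.\<close>
  have mh: "(\<lambda>x. indicator S x *\<^sub>R (\<bar>det (matrix (frechet_derivative \<psi> (at x)))\<bar> * metric_density g d (\<psi> x)))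
      \<in> borel_measurable borel"
  proof -
    have "(\<lambda>x. (1 / k) *\<^sub>R (indicator S x *\<^sub>R metric_density h c x)) \<in> borel_measurable borel"
      using measurable_metric_density[OF h c S] by measurable
    also have "(\<lambda>x. (1 / k) *\<^sub>R (indicator S x *\<^sub>R metric_density h c x)) =
        (\<lambda>x. indicator S x *\<^sub>R (\<bar>det (matrix (frechet_derivative \<psi> (at x)))\<bar> * metric_density g d (\<psi> x)))"
      using k dens by (auto simp: fun_eq_iff split: split_indicator)
    finally show ?thesis .
  qed
  have nonneg: "0 \<le> metric_density g d y" if "y \<in> \<psi> ` S" for y
    using metric_density_pos[OF g d(1)] T that by (force intro: less_imp_le)
  have der: "(\<psi> has_derivative frechet_derivative \<psi> (at x)) (at x)" if "x \<in> S" for x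
    using diff that by (auto simp: S_def \<psi>_def intro!: differentiable_has_frechet)
  have cv: "(\<integral>\<^sup>+x\<in>S. ennreal (\<bar>det (matrix (frechet_derivative \<psi> (at x)))\<bar> * metric_density g d (\<psi> x)) \<partial>lborel)
      = chart_volume g d (\<phi> ` B)"
    unfolding chart_volume_def img[symmetric]
    by (rule nn_integral_change_of_variables[OF S(1) T(1) der inj\<psi> nonneg measurable_metric_density[OF g d T] mh])
  let ?e = "\<lambda>x. \<bar>det (matrix (frechet_derivative \<psi> (at x)))\<bar> * metric_density g d (\<psi> x)"
  have "chart_volume h c B = (\<integral>\<^sup>+x. ennreal k * (ennreal (?e x) * indicator S x) \<partial>lborel)"
    unfolding chart_volume_def S_def[symmetric]
    using dens k nonneg
    by (intro nn_integral_cong) (auto simp: ennreal_mult split: split_indicator)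
  also have "\<dots> = ennreal k * (\<integral>\<^sup>+x\<in>S. ennreal (?e x) \<partial>lborel)"
  proof (rule nn_integral_cmult)
    have "(\<lambda>x. ennreal (indicator S x *\<^sub>R ?e x)) \<in> borel_measurable borel"
      using mh by measurable
    also have "(\<lambda>x. ennreal (indicator S x *\<^sub>R ?e x)) = (\<lambda>x. ennreal (?e x) * indicator S x)"
      by (auto split: split_indicator)
    finally show "(\<lambda>x. ennreal (?e x) * indicator S x) \<in> borel_measurable lborel"
      by simp
  qed
  finally show ?thesis
    unfolding cv k_def .
qed

text \<open>A finite Borel partition subordinate to the charts. It plays the part of a partition of
  unity: measures are compared and glued piece by piece.\<close>

definition chart_partition ::
    "('a::topological_space, 'n::finite) chart set \<Rightarrow> nat \<Rightarrow> (nat \<Rightarrow> ('a, 'n) chart) \<Rightarrow> (nat \<Rightarrow> 'a set) \<Rightarrow> bool"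
  where "chart_partition \<A> N C D \<longleftrightarrow>
     (\<forall>k<N. C k \<in> \<A> \<and> D k \<subseteq> chart_dom (C k)) \<and> (\<forall>k. D k \<in> sets borel) \<and>
     disjoint_family D \<and> (\<Union>k<N. D k) = UNIV"

lemma chart_partitionD:
  assumes "chart_partition \<A> N C D"
  shows "k < N \<Longrightarrow> C k \<in> \<A>" "D k \<in> sets borel" "k < N \<Longrightarrow> D k \<subseteq> chart_dom (C k)"
    "disjoint_family D" "(\<Union>k<N. D k) = UNIV"
  using assms by (simp_all add: chart_partition_def)

lemma ex_chart_partition:
  fixes \<A> :: "('a::t2_space, 'n::finite) chart set"
  assumes "closed_manifold \<A>"
  shows "\<exists>N C D. chart_partition \<A> N C D"
proof -
  have atlas: "smooth_atlas \<A>" and comp: "compact (UNIV :: 'a set)"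
    using assms by (auto simp: closed_manifold_def)
  have opn: "open (chart_dom c)" if "c \<in> \<A>" for c
    using atlas that by (auto simp: smooth_atlas_def is_chart_def)
  have "(UNIV :: 'a set) \<subseteq> (\<Union>c\<in>\<A>. chart_dom c)"
    using atlas by (auto simp: smooth_atlas_def)
  from compactE_image[OF comp opn this] obtain F where F: "F \<subseteq> \<A>" "finite F" "UNIV \<subseteq> (\<Union>c\<in>F. chart_dom c)"
    by metis
  obtain C where C: "bij_betw C {0..<card F} F"
    using ex_bij_betw_nat_finite[OF F(2)] by blast
  \<comment> \<open>Padded with empty sets, since \<open>disjointed\<close> acts on
    sequences.\<close>
  define A where "A k = (if k < card F then chart_dom (C k) else {})" for k
  have CA: "C k \<in> \<A>" if "k < card F" for k
    using C F that by (auto simp: bij_betw_def)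
  have "A k \<in> sets borel" for k
    using opn[OF CA] by (auto simp: A_def)
  then have 1: "disjointed A k \<in> sets borel" for k
    by (intro sets.range_disjointed_sets[THEN range_subsetD]) auto
  have 2: "disjointed A k \<subseteq> chart_dom (C k)" if "k < card F" for k
    using that disjointed_subset[of A k] by (auto simp: A_def)
  have "(\<Union>k<card F. disjointed A k) = (\<Union>k<card F. A k)"
    using finite_UN_disjointed_eq[of A "card F"] by (simp add: atLeast0LessThan)
  also have "\<dots> = (\<Union>c\<in>C ` {0..<card F}. chart_dom c)"
    by (auto simp: A_def)
  also have "\<dots> = UNIV"
    using C F(3) by (auto simp: bij_betw_def)
  finally have "chart_partition \<A> (card F) C (disjointed A)"
    using CA 1 2 by (simp add: chart_partition_def disjoint_family_disjointed)
  then show ?thesis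
    by blast
qed

section \<open>Existence and uniqueness of the Riemannian measure\<close>

definition is_riem_measure ::
    "('a::topological_space, 'n::finite) chart set \<Rightarrow> ('a, 'n) tensor2 \<Rightarrow> 'a measure \<Rightarrow> bool" where
  "is_riem_measure \<A> g \<mu> \<longleftrightarrow> sets \<mu> = sets borel \<and>
     (\<forall>c\<in>\<A>. \<forall>B\<in>sets borel. B \<subseteq> chart_dom c \<longrightarrow> emeasure \<mu> B = chart_volume g c B)"

lemma riem_measure_eq: "riem_measure \<A> g = (THE \<mu>. is_riem_measure \<A> g \<mu>)"
  by (simp add: riem_measure_def is_riem_measure_def chart_volume_def metric_density_def)

lemma emeasure_partition:
  assumes "sets \<mu> = sets borel" "B \<in> sets borel" "\<And>k. D k \<in> sets borel"
    "disjoint_family D" "(\<Union>k<(N::nat). D k) = UNIV"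
  shows "emeasure \<mu> B = (\<Sum>k<N. emeasure \<mu> (B \<inter> D k))"
proof -
  have "(\<Sum>k<N. emeasure \<mu> (B \<inter> D k)) = emeasure \<mu> (\<Union>k<N. B \<inter> D k)"
    using assms(1-3) disjoint_family_on_bisimulation[OF disjoint_family_on_mono[OF _ assms(4), of "{..<N}"],
        of "\<lambda>k. B \<inter> D k"]
    by (intro sum_emeasure) auto
  also have "(\<Union>k<N. B \<inter> D k) = B"
    using assms(5) by auto
  finally show ?thesis
    by simp
qed

text \<open>A Borel set splits into finitely many pieces that lie in one chart each, and there the
  value is prescribed.\<close>

lemma is_riem_measure_unique:
  fixes \<A> :: "('a::t2_space, 'n::finite) chart set"
  assumes M: "closed_manifold \<A>" and \<mu>: "is_riem_measure \<A> g \<mu>" and \<nu>: "is_riem_measure \<A> g \<nu>"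
  shows "\<mu> = \<nu>"
proof (rule measure_eqI)
  show "sets \<mu> = sets \<nu>"
    using \<mu> \<nu> by (simp add: is_riem_measure_def)
  fix B
  assume "B \<in> sets \<mu>"
  then have B: "B \<in> sets borel"
    using \<mu> by (simp add: is_riem_measure_def)
  obtain N C D where "chart_partition \<A> N C D"
    using ex_chart_partition[OF M] by blast
  note P = chart_partitionD[OF this]
  have "emeasure \<mu> (B \<inter> D k) = emeasure \<nu> (B \<inter> D k)" if "k < N" for k
  proof -
    have "B \<inter> D k \<in> sets borel" "B \<inter> D k \<subseteq> chart_dom (C k)"
      using B P that by auto
    then show ?thesis
      using \<mu> \<nu> P(1)[OF that] by (auto simp: is_riem_measure_def)
  qed
  moreover have "sets \<mu> = sets borel" "sets \<nu> = sets borel"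
    using \<mu> \<nu> by (auto simp: is_riem_measure_def)
  ultimately show "emeasure \<mu> B = emeasure \<nu> B"
    using emeasure_partition[OF _ B P(2,4,5)] by simp
qed

lemma chart_volume_partition:
  assumes g: "continuous_metric \<A> g" "c \<in> \<A>" "is_chart c" and B: "B \<in> sets borel" "B \<subseteq> chart_dom c"
    and D: "\<And>k. D k \<in> sets borel" "disjoint_family D" "(\<Union>k<(N::nat). D k) = UNIV"
  shows "chart_volume g c B = (\<Sum>k<N. chart_volume g c (B \<inter> D k))"
proof -
  have *: "B \<inter> D k \<in> sets borel" "B \<inter> D k \<subseteq> chart_dom c" for k
    using B D by auto
  have "(\<Sum>k<N. emeasure (chart_measure g c) (chart_map c ` (B \<inter> D k))) =
      emeasure (chart_measure g c) (\<Union>k<N. chart_map c ` (B \<inter> D k))"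
  proof (rule sum_emeasure)
    show "disjoint_family_on (\<lambda>k. chart_map c ` (B \<inter> D k)) {..<N}"
      using D(2) B(2) inj_onD[OF chart_inj[OF g(3)]] by (fastforce simp: disjoint_family_on_def)
  qed (use chart_image_borel[OF g(3) *] in auto)
  also have "(\<Union>k<N. chart_map c ` (B \<inter> D k)) = chart_map c ` B"
    using D(3) by blast
  finally show ?thesis
    using chart_volume_eq_measure[OF g *] chart_volume_eq_measure[OF g B] by simp
qed


text \<open>Each piece of a partition is measured in its own chart and the results are added. The
  sum has the prescribed value in every other chart as well, because chart volumes agree on
  overlaps: this is \<open>chart_volume_transform\<close> for the identity.\<close>

lemma ex_is_riem_measure:
  fixes \<A> :: "('a::t2_space, 'n::finite) chart set"
  assumes M: "closed_manifold \<A>" and g: "continuous_metric \<A> g"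
  shows "\<exists>\<mu>. is_riem_measure \<A> g \<mu>"
proof -
  have atlas: "smooth_atlas \<A>"
    using M by (simp add: closed_manifold_def)
  note chart = smooth_atlas_chart[OF atlas]
  obtain N C D where "chart_partition \<A> N C D"
    using ex_chart_partition[OF M] by blast
  note P = chart_partitionD[OF this]
  define m where "m B = (\<Sum>k<N. chart_volume g (C k) (B \<inter> D k))" for B
  define \<mu> where "\<mu> = measure_of UNIV (sets borel) m"
  have piece: "B \<inter> D k \<in> sets borel" "k < N \<Longrightarrow> B \<inter> D k \<subseteq> chart_dom (C k)" if "B \<in> sets borel" for B k
    using that P by auto
  have m_eq: "m B = (\<Sum>k<N. emeasure (chart_measure g (C k)) (chart_map (C k) ` (B \<inter> D k)))" if "B \<in> sets borel" for B
    unfolding m_def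
    by (intro sum.cong refl chart_volume_eq_measure[OF g] chart P(1) piece[OF that]) auto
  have "countably_additive (sets borel) m"
  proof (rule countably_additiveI)
    fix A :: "nat \<Rightarrow> 'a set"
    assume A: "range A \<subseteq> sets borel" "disjoint_family A" "(\<Union>i. A i) \<in> sets borel"
    have Ai: "A i \<in> sets borel" for i
      using A by auto
    have "(\<Sum>i. emeasure (chart_measure g (C k)) (chart_map (C k) ` (A i \<inter> D k)))
        = emeasure (chart_measure g (C k)) (chart_map (C k) ` ((\<Union>i. A i) \<inter> D k))" if k: "k < N" for k
    proof -
      note ck = chart[OF P(1)[OF k]]
      have "disjoint_family (\<lambda>i. chart_map (C k) ` (A i \<inter> D k))"
        unfolding disjoint_family_on_def
      proof (intro ballI impI)
        fix i j :: nat
        assume "i \<noteq> j"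
        then have "(A i \<inter> D k) \<inter> (A j \<inter> D k) = {}"
          using A(2) by (auto simp: disjoint_family_on_def)
        moreover have "chart_map (C k) ` (A i \<inter> D k) \<inter> chart_map (C k) ` (A j \<inter> D k)
            = chart_map (C k) ` ((A i \<inter> D k) \<inter> (A j \<inter> D k))"
          using P(3)[OF k] by (intro inj_on_image_Int[OF chart_inj[OF ck], symmetric]) auto
        ultimately show "chart_map (C k) ` (A i \<inter> D k) \<inter> chart_map (C k) ` (A j \<inter> D k) = {}"
          by simp
      qed
      moreover have "range (\<lambda>i. chart_map (C k) ` (A i \<inter> D k)) \<subseteq> sets (chart_measure g (C k))"
        using chart_image_borel[OF ck piece(1)[OF Ai] piece(2)[OF Ai k]] by auto
      moreover have "(\<Union>i. chart_map (C k) ` (A i \<inter> D k)) = chart_map (C k) ` ((\<Union>i. A i) \<inter> D k)"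
        by blast
      ultimately show ?thesis
        by (simp add: suminf_emeasure)
    qed
    then show "(\<Sum>i. m (A i)) = m (\<Union>i. A i)"
      unfolding m_eq[OF Ai] m_eq[OF A(3)] by (subst suminf_sum) auto
  qed
  moreover have "positive (sets borel) m"
    by (simp add: positive_def m_def chart_volume_def)
  ultimately have em: "emeasure \<mu> B = m B" if "B \<in> sets borel" for B
    using that unfolding \<mu>_def
    by (intro emeasure_measure_of_sigma) (auto simp: sets.sigma_algebra_axioms[of borel, simplified])
  have "is_riem_measure \<A> g \<mu>"
    unfolding is_riem_measure_def
  proof (intro conjI ballI impI)
    show "sets \<mu> = sets borel"
      by (simp add: \<mu>_def sigma_algebra.sets_measure_of_eq[OF sets.sigma_algebra_axioms[of borel, simplified]])
    fix c B
    assume c: "c \<in> \<A>" and B: "B \<in> sets borel" "B \<subseteq> chart_dom c"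
    have "chart_volume g c (B \<inter> D k) = chart_volume g (C k) (B \<inter> D k)" if k: "k < N" for k
    proof -
      note Ck = P(1)[OF k]
      have sub: "B \<inter> D k \<subseteq> chart_dom c" "B \<inter> D k \<subseteq> chart_dom (C k)"
        using B P(3)[OF k] by auto
      have "chart_volume g c (B \<inter> D k) = ennreal (sqrt (1 ^ CARD('n))) * chart_volume g (C k) (id ` (B \<inter> D k))"
      proof (rule chart_volume_transform[OF g g c chart[OF c] Ck chart[OF Ck]])
        fix p
        assume p: "p \<in> B \<inter> D k"
        have "smooth_on (chart_map c ` (chart_dom c \<inter> chart_dom (C k))) (chart_map (C k) \<circ> chart_inv c)"
          using atlas c Ck unfolding smooth_atlas_def by blast
        then have "(chart_map (C k) \<circ> chart_inv c) differentiable_on chart_map c ` (chart_dom c \<inter> chart_dom (C k))"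
          unfolding smooth_on_def by (metis Ck_on.simps(2))
        moreover have "open (chart_map c ` (chart_dom c \<inter> chart_dom (C k)))"
          using chart_open[OF chart[OF c]] chart_open[OF chart[OF Ck]]
          by (intro chart_image_open[OF chart[OF c]]) auto
        ultimately show "(chart_map (C k) \<circ> id \<circ> chart_inv c) differentiable at (chart_map c p)"
          using p sub by (simp add: differentiable_on_open_at subset_iff)
        show "g c (chart_map c p) = 1 *\<^sub>R (transpose (jacobian id c (C k) p) **
            g (C k) (chart_map (C k) (id p)) ** jacobian id c (C k) p)"
          using riemannian_metric_transform[OF continuous_metricD(1)[OF g] c Ck, of p] p sub by auto
      qed (use sub piece[OF B(1)] k in auto)
      then show ?thesis
        by simp
    qed
    then show "emeasure \<mu> B = chart_volume g c B"
      unfolding em[OF B(1)] m_def chart_volume_partition[OF g c chart[OF c] B P(2,4,5)] by simp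
  qed
  then show ?thesis
    by blast
qed

lemma is_riem_measure_riem_measure:
  fixes \<A> :: "('a::t2_space, 'n::finite) chart set"
  assumes M: "closed_manifold \<A>" and g: "continuous_metric \<A> g"
  shows "is_riem_measure \<A> g (riem_measure \<A> g)"
proof -
  obtain \<mu> where \<mu>: "is_riem_measure \<A> g \<mu>"
    using ex_is_riem_measure[OF assms] by blast
  show ?thesis
    unfolding riem_measure_eq by (rule theI[where P = "is_riem_measure \<A> g", OF \<mu>]) (rule is_riem_measure_unique[OF M _ \<mu>])
qed

lemma riem_measureI:
  fixes \<A> :: "('a::t2_space, 'n::finite) chart set"
  assumes M: "closed_manifold \<A>" and "is_riem_measure \<A> g \<mu>"
  shows "riem_measure \<A> g = \<mu>"
  unfolding riem_measure_eq using assms is_riem_measure_unique[OF M] by (intro the_equality) auto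

text \<open>Every point has a neighbourhood of finite measure, namely the preimage of a ball whose
  closure lies in a chart image, where the continuous density is bounded. Compactness leaves
  finitely many such neighbourhoods.\<close>

lemma finite_riem_measure:
  fixes \<A> :: "('a::t2_space, 'n::finite) chart set"
  assumes M: "closed_manifold \<A>" and g: "continuous_metric \<A> g"
  shows "finite_measure (riem_measure \<A> g)"
proof (rule finite_measureI)
  let ?\<mu> = "riem_measure \<A> g"
  have atlas: "smooth_atlas \<A>" and comp: "compact (UNIV :: 'a set)"
    using M by (auto simp: closed_manifold_def)
  note R = is_riem_measure_riem_measure[OF M g, unfolded is_riem_measure_def]
  have "\<exists>W. open W \<and> p \<in> W \<and> emeasure ?\<mu> W < \<infinity>" for p
  proof -
    obtain c where c: "c \<in> \<A>" "p \<in> chart_dom c"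
      using smooth_atlas_cover[OF atlas] by blast
    note ic = smooth_atlas_chart[OF atlas c(1)]
    obtain e where e: "e > 0" "cball (chart_map c p) e \<subseteq> chart_img c"
      using chart_open(2)[OF ic] c(2) by (metis open_contains_cball imageI)
    define W where "W = chart_dom c \<inter> chart_map c -` ball (chart_map c p) e"
    have W: "open W"
      unfolding W_def using homeomorphism_cont1[OF chart_homeo[OF ic]] chart_open(1)[OF ic]
      by (metis Int_commute continuous_on_open_vimage open_ball)
    have "compact (metric_density g c ` cball (chart_map c p) e)"
      using continuous_on_subset[OF continuous_on_metric_density[OF g c(1)] e(2)]
      by (intro compact_continuous_image) auto
    then have "bounded (metric_density g c ` cball (chart_map c p) e)"
      by (rule compact_imp_bounded)
    then obtain b where b: "\<And>x. x \<in> cball (chart_map c p) e \<Longrightarrow> \<bar>metric_density g c x\<bar> \<le> b"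
      unfolding bounded_iff real_norm_def by blast
    have "emeasure ?\<mu> W = chart_volume g c W"
      using R c W by (auto simp: W_def)
    also have "\<dots> \<le> (\<integral>\<^sup>+x. ennreal b * indicator (cball (chart_map c p) e) x \<partial>lborel)"
      unfolding chart_volume_def
    proof (rule nn_integral_mono)
      fix x
      show "ennreal (metric_density g c x) * indicator (chart_map c ` W) x
          \<le> ennreal b * indicator (cball (chart_map c p) e) x"
        using b[of x] by (auto simp: W_def split: split_indicator intro!: ennreal_leI)
    qed
    also have "\<dots> = ennreal b * emeasure lborel (cball (chart_map c p) e)"
      by (simp add: nn_integral_cmult_indicator)
    also have "\<dots> < \<infinity>"
      using emeasure_bounded_finite[OF bounded_cball, of "chart_map c p" e]
      by (simp add: ennreal_mult_less_top)
    finally show ?thesis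
      using W c e by (intro exI[of _ W]) (auto simp: W_def)
  qed
  then obtain W where W: "\<And>p. open (W p)" "\<And>p. p \<in> W p" "\<And>p. emeasure ?\<mu> (W p) < \<infinity>"
    by metis
  obtain F where F: "finite F" "UNIV \<subseteq> (\<Union>p\<in>F. W p)"
    using compactE_image[OF comp, of UNIV W] W by (metis UNIV_I UN_I subsetI)
  have "sets ?\<mu> = sets borel"
    using R by blast
  then have "emeasure ?\<mu> (\<Union>p\<in>F. W p) \<le> (\<Sum>p\<in>F. emeasure ?\<mu> (W p))"
    using F W by (intro emeasure_subadditive_finite) auto
  also have "\<dots> < \<infinity>"
    using F W by (simp add: ennreal_sum_less_top)
  moreover have "(\<Union>p\<in>F. W p) = UNIV"
    using F by auto
  moreover have "space ?\<mu> = UNIV"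
    using \<open>sets ?\<mu> = sets borel\<close> by (metis sets_eq_imp_space_eq space_borel)
  ultimately show "emeasure ?\<mu> (space ?\<mu>) \<noteq> \<infinity>"
    by auto
qed

text \<open>A chart image around some point is open and nonempty, hence not a null set, and the
  density is positive on it.\<close>

lemma vol_pos:
  fixes \<A> :: "('a::t2_space, 'n::finite) chart set"
  assumes M: "closed_manifold \<A>" and g: "continuous_metric \<A> g"
  shows "vol \<A> g > 0"
proof -
  let ?\<mu> = "riem_measure \<A> g"
  interpret finite_measure ?\<mu>
    by (rule finite_riem_measure[OF M g])
  have atlas: "smooth_atlas \<A>"
    using M by (auto simp: closed_manifold_def)
  note R = is_riem_measure_riem_measure[OF M g, unfolded is_riem_measure_def]
  \<comment> \<open>\<open>undefined\<close> merely names some point of the manifold.\<close>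
  obtain c where c: "c \<in> \<A>" "(undefined :: 'a) \<in> chart_dom c"
    using smooth_atlas_cover[OF atlas] by blast
  note ic = smooth_atlas_chart[OF atlas c(1)]
  have opn: "open (chart_img c)" "chart_img c \<noteq> {}"
    using chart_open(2)[OF ic] c by auto
  have "chart_volume g c (chart_dom c) \<noteq> 0"
  proof
    assume 0: "chart_volume g c (chart_dom c) = 0"
    have "(\<lambda>x. ennreal (indicator (chart_img c) x *\<^sub>R metric_density g c x)) \<in> borel_measurable borel"
      using measurable_metric_density[OF g c(1) ic, of "chart_img c"] opn by measurable
    also have "(\<lambda>x. ennreal (indicator (chart_img c) x *\<^sub>R metric_density g c x)) =
        (\<lambda>x. ennreal (metric_density g c x) * indicator (chart_img c) x)"
      by (auto split: split_indicator)
    finally have "AE x in lborel. ennreal (metric_density g c x) * indicator (chart_img c) x = 0"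
      using 0 unfolding chart_volume_def by (subst (asm) nn_integral_0_iff_AE) auto
    moreover have "ennreal (metric_density g c x) * indicator (chart_img c) x \<noteq> 0" if "x \<in> chart_img c" for x
      using metric_density_pos[OF g c(1) that] that by simp
    ultimately have "AE x in lborel. x \<notin> chart_img c"
      by (elim eventually_mono) auto
    then have "chart_img c \<in> null_sets lborel"
      using opn by (subst (asm) AE_iff_null_sets[symmetric]) auto
    then have "negligible (chart_img c)"
      by (simp add: negligible_iff_null_sets null_sets_completionI)
    then show False
      using opn open_not_negligible by blast
  qed
  moreover have "chart_dom c \<in> sets borel"
    using chart_open(1)[OF ic] by simp
  ultimately have "emeasure ?\<mu> (chart_dom c) \<noteq> 0"
    using R c(1) by auto
  moreover have "emeasure ?\<mu> (chart_dom c) \<le> emeasure ?\<mu> UNIV"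
    using R by (intro emeasure_mono) (auto simp: sets_eq_imp_space_eq)
  ultimately have "emeasure ?\<mu> UNIV \<noteq> 0"
    by auto
  then show ?thesis
    unfolding vol_def by (simp add: emeasure_eq_measure zero_less_measure_iff)
qed

text \<open>The pushforward of the measure of \<open>g\<close> under \<open>\<phi>\<inverse>\<close>, rescaled, has the
  chart densities of \<open>r \<phi>\<^sup>*g\<close>.\<close>

lemma vol_scaled_pullback:
  fixes \<A> :: "('a::t2_space, 'n::finite) chart set"
  assumes M: "closed_manifold \<A>" and g: "continuous_metric \<A> g" and h: "continuous_metric \<A> h"
    and \<phi>: "bij \<phi>" "continuous_on UNIV \<phi>" "continuous_on UNIV (inv \<phi>)"
    and diff: "\<And>c d p. c \<in> \<A> \<Longrightarrow> d \<in> \<A> \<Longrightarrow> p \<in> chart_dom c \<Longrightarrow> \<phi> p \<in> chart_dom d \<Longrightarrow>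
      (chart_map d \<circ> \<phi> \<circ> chart_inv c) differentiable at (chart_map c p)"
    and r: "r > 0"
    and eq: "\<And>c d p. c \<in> \<A> \<Longrightarrow> d \<in> \<A> \<Longrightarrow> p \<in> chart_dom c \<Longrightarrow> \<phi> p \<in> chart_dom d \<Longrightarrow>
      h c (chart_map c p) =
        r *\<^sub>R (transpose (jacobian \<phi> c d p) ** g d (chart_map d (\<phi> p)) ** jacobian \<phi> c d p)"
  shows "vol \<A> h = sqrt (r ^ CARD('n)) * vol \<A> g"
proof -
  let ?\<mu> = "riem_measure \<A> g"
  define k where "k = ennreal (sqrt (r ^ CARD('n)))"
  define \<nu> where "\<nu> = scale_measure k (distr ?\<mu> borel (inv \<phi>))"
  have atlas: "smooth_atlas \<A>"
    using M by (auto simp: closed_manifold_def)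
  note chart = smooth_atlas_chart[OF atlas]
  note R = is_riem_measure_riem_measure[OF M g, unfolded is_riem_measure_def]
  then have sets: "sets ?\<mu> = sets borel"
    by blast
  then have space: "space ?\<mu> = UNIV"
    by (metis sets_eq_imp_space_eq space_borel)
  have m\<phi>: "\<phi> \<in> borel_measurable borel" "inv \<phi> \<in> borel_measurable borel"
    using \<phi> by (auto intro: borel_measurable_continuous_onI)
  have vim: "inv \<phi> -` B = \<phi> ` B" for B
    using bij_vimage_eq_inv_image[OF bij_imp_bij_inv[OF \<phi>(1)]] \<phi>(1) by (simp add: inv_inv_eq)
  have im: "\<phi> ` B \<in> sets borel" if "B \<in> sets borel" for B
    using measurable_sets_borel[OF m\<phi>(2) that] by (simp add: vim)
  have "inv \<phi> \<in> measurable ?\<mu> borel"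
    using m\<phi>(2) sets by (simp cong: measurable_cong_sets)
  then have \<nu>: "emeasure \<nu> B = k * emeasure ?\<mu> (\<phi> ` B)" if "B \<in> sets borel" for B
    using that by (simp add: \<nu>_def emeasure_distr space vim)
  obtain N C D where "chart_partition \<A> N C D"
    using ex_chart_partition[OF M] by blast
  note P = chart_partitionD[OF this]
  have "is_riem_measure \<A> h \<nu>"
    unfolding is_riem_measure_def
  proof (intro conjI ballI impI)
    show "sets \<nu> = sets borel"
      by (simp add: \<nu>_def)
    fix c B
    assume c: "c \<in> \<A>" and B: "B \<in> sets borel" "B \<subseteq> chart_dom c"
    \<comment> \<open>The partition is pulled back by \<open>\<phi>\<close>, so that
      \<open>\<phi>\<close> maps each piece of \<open>B\<close> into a single chart.\<close>
    define E where "E j = \<phi> -` D j" for j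
    have "(\<Union>j<N. E j) = \<phi> -` (\<Union>j<N. D j)"
      by (auto simp: E_def)
    moreover have "disjoint_family E"
      using P(4) unfolding disjoint_family_on_def E_def by blast
    ultimately have E: "\<And>j. E j \<in> sets borel" "disjoint_family E" "(\<Union>j<N. E j) = UNIV"
      using measurable_sets_borel[OF m\<phi>(1) P(2)] P(5) by (simp_all add: E_def)
    have "chart_volume h c (B \<inter> E j) = k * emeasure ?\<mu> (\<phi> ` B \<inter> D j)" if j: "j < N" for j
    proof -
      note Cj = P(1)[OF j]
      have sub: "B \<inter> E j \<subseteq> chart_dom c" "\<phi> ` (B \<inter> E j) \<subseteq> chart_dom (C j)"
        using B P(3)[OF j] by (auto simp: E_def)
      have b: "B \<inter> E j \<in> sets borel" "\<phi> ` (B \<inter> E j) \<in> sets borel"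
        using B E im by auto
      have "chart_volume h c (B \<inter> E j) = k * chart_volume g (C j) (\<phi> ` (B \<inter> E j))"
        unfolding k_def
      proof (rule chart_volume_transform[OF h g c chart[OF c] Cj chart[OF Cj] b(1) sub(1) b(2) sub(2) _ _ r])
        show "inj_on \<phi> (B \<inter> E j)"
          using \<phi>(1) by (meson bij_is_inj inj_on_subset subset_UNIV)
        fix p
        assume p: "p \<in> B \<inter> E j"
        then have p': "p \<in> chart_dom c" "\<phi> p \<in> chart_dom (C j)"
          using sub by auto
        show "(chart_map (C j) \<circ> \<phi> \<circ> chart_inv c) differentiable at (chart_map c p)"
          by (rule diff[OF c Cj p'])
        show "h c (chart_map c p) = r *\<^sub>R (transpose (jacobian \<phi> c (C j) p) **
            g (C j) (chart_map (C j) (\<phi> p)) ** jacobian \<phi> c (C j) p)"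
          by (rule eq[OF c Cj p'])
      qed
      also have "chart_volume g (C j) (\<phi> ` (B \<inter> E j)) = emeasure ?\<mu> (\<phi> ` (B \<inter> E j))"
        using R Cj b sub by auto
      also have "\<phi> ` (B \<inter> E j) = \<phi> ` B \<inter> D j"
        by (auto simp: E_def)
      finally show ?thesis .
    qed
    then have "chart_volume h c B = (\<Sum>j<N. k * emeasure ?\<mu> (\<phi> ` B \<inter> D j))"
      unfolding chart_volume_partition[OF h c chart[OF c] B E] by simp
    also have "\<dots> = k * emeasure ?\<mu> (\<phi> ` B)"
      unfolding emeasure_partition[OF sets im[OF B(1)] P(2,4,5)] by (simp add: sum_distrib_left)
    finally show "emeasure \<nu> B = chart_volume h c B"
      using \<nu>[OF B(1)] by simp
  qed
  then have "riem_measure \<A> h = \<nu>"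
    by (rule riem_measureI[OF M])
  moreover have "\<phi> ` UNIV = UNIV"
    using \<phi>(1) by (rule bij_is_surj)
  ultimately show ?thesis
    using \<nu>[of UNIV] r by (simp add: vol_def measure_def k_def enn2real_mult)
qed

section \<open>Metrics close to an Einstein metric\<close>

lemma smooth_on_partial_deriv: "smooth_on S f \<Longrightarrow> smooth_on S (partial_deriv i f)"
  unfolding smooth_on_def by (metis Ck_on.simps(2))

lemma smooth_on_differentiable_on: "smooth_on S f \<Longrightarrow> f differentiable_on S"
  unfolding smooth_on_def by (metis Ck_on.simps(2))

lemma smooth_on_continuous_on: "smooth_on S f \<Longrightarrow> continuous_on S f"
  unfolding smooth_on_def by (metis Ck_on.simps(1))

lemma smooth_on_twice_differentiable: "smooth_on S f \<Longrightarrow> twice_differentiable_on f S"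
  by (simp add: twice_differentiable_on_def smooth_on_differentiable_on smooth_on_partial_deriv)

lemma holder_on_twice_differentiable: "holder_on 2 \<alpha> S f \<Longrightarrow> twice_differentiable_on f S"
  by (simp add: twice_differentiable_on_def numeral_2_eq_2)

lemma twice_differentiable_on_matrixI:
  fixes f :: "real^'n::finite \<Rightarrow> real^'k::finite^'m::finite"
  assumes S: "open S" and f: "\<And>a b. twice_differentiable_on (\<lambda>y. f y $ a $ b) S"
  shows "twice_differentiable_on f S"
proof -
  have d: "f differentiable at x" if "x \<in> S" for x
    using twice_differentiable_on_at(1)[OF f S that] by (rule differentiable_matrixI)
  have "partial_deriv i f differentiable at x" if x: "x \<in> S" for i x
  proof (rule differentiable_matrixI)
    fix a b
    have eq: "partial_deriv i f y $ a $ b = partial_deriv i (\<lambda>y. f y $ a $ b) y" if "y \<in> S" for y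
      using d[OF that] by (simp add: partial_deriv_matrix_entry)
    show "(\<lambda>y. partial_deriv i f y $ a $ b) differentiable at x"
      by (rule iffD2[OF differentiable_cong_open[OF S x]]) (erule eq, rule twice_differentiable_on_at[OF f S x])
  qed
  then show ?thesis
    using d by (simp add: twice_differentiable_on_def differentiable_on_openI)
qed

lemma twice_differentiable_on_jac:
  assumes "open S" "smooth_on S \<psi>"
  shows "twice_differentiable_on (jac \<psi>) S"
  using assms
  by (intro twice_differentiable_on_matrixI)
    (simp_all add: jac_entry twice_differentiable_on_vec_nth smooth_on_twice_differentiable smooth_on_partial_deriv)

lemma jac_compose:
  fixes f :: "real^'m::finite \<Rightarrow> real^'k::finite" and \<psi> :: "real^'n::finite \<Rightarrow> real^'m"
  assumes "f differentiable at (\<psi> x)" "\<psi> differentiable at x"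
  shows "jac (f \<circ> \<psi>) x = jac f (\<psi> x) ** jac \<psi> x"
proof -
  note D = differentiable_has_frechet[OF assms(1)] differentiable_has_frechet[OF assms(2)]
  show ?thesis
    unfolding jac_def frechet_derivative_at[OF diff_chain_at[OF D(2,1)], symmetric]
    by (rule matrix_compose) (use D has_derivative_linear in blast)+
qed

lemma jac_cong:
  assumes "open S" "x \<in> S" "\<And>y. y \<in> S \<Longrightarrow> f y = g y"
  shows "jac f x = jac g x"
  using partial_deriv_cong[OF assms] by (simp add: vec_eq_iff jac_entry)

lemma transition_smooth:
  assumes "smooth_atlas \<A>" "c \<in> \<A>" "d \<in> \<A>"
  shows "smooth_on (chart_map c ` (chart_dom c \<inter> chart_dom d)) (chart_map d \<circ> chart_inv c)"
  using assms unfolding smooth_atlas_def by blast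

lemma overlap_image_open:
  assumes "smooth_atlas \<A>" "c \<in> \<A>" "open V"
  shows "open (chart_map c ` (chart_dom c \<inter> V))"
  using smooth_atlas_chart[OF assms(1,2)] assms(3)
  by (intro chart_image_open) (auto simp: is_chart_def)

lemma holder_metric_continuous:
  assumes "holder_metric 2 \<alpha> \<A> h"
  shows "continuous_metric \<A> h"
  using assms holder_on_twice_differentiable[THEN twice_differentiable_on_def[THEN iffD1], THEN conjunct1]
  unfolding holder_metric_def continuous_metric_def by (blast intro: differentiable_imp_continuous_on)

lemma smooth_metric_continuous:
  assumes "smooth_metric \<A> h"
  shows "continuous_metric \<A> h"
  using assms smooth_on_continuous_on unfolding smooth_metric_def continuous_metric_def by blast

lemma metric_det_nonzero:
  "riemannian_metric \<A> h \<Longrightarrow> c \<in> \<A> \<Longrightarrow> x \<in> chart_img c \<Longrightarrow> det (h c x) \<noteq> 0"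
  using pos_def_det_pos[OF riemannian_metric_pos_def] by fastforce

lemma ricci_chart_transform:
  fixes \<A> :: "('a::topological_space, 'n::finite) chart set"
  assumes atlas: "smooth_atlas \<A>" and h: "riemannian_metric \<A> h"
    and reg: "\<And>c. c \<in> \<A> \<Longrightarrow> twice_differentiable_on (h c) (chart_img c)"
    and c: "c \<in> \<A>" and d: "d \<in> \<A>" and p: "p \<in> chart_dom c" "p \<in> chart_dom d"
  shows "ricci h c (chart_map c p) =
    transpose (jacobian id c d p) ** ricci h d (chart_map d p) ** jacobian id c d p"
proof -
  define S where "S = chart_map c ` (chart_dom c \<inter> chart_dom d)"
  define \<psi> where "\<psi> = chart_map d \<circ> chart_inv c"
  note ic = smooth_atlas_chart[OF atlas c] and id = smooth_atlas_chart[OF atlas d]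
  have S: "open S"
    unfolding S_def by (rule overlap_image_open[OF atlas c chart_open(1)[OF id]])
  have sub: "S \<subseteq> chart_img c"
    by (auto simp: S_def)
  have \<psi>: "\<psi> (chart_map c q) = chart_map d q" if "q \<in> chart_dom c" for q
    using chart_inv_map[OF ic that] by (simp add: \<psi>_def)
  have sm: "smooth_on S \<psi>"
    unfolding S_def \<psi>_def by (rule transition_smooth[OF atlas c d])
  have tr: "metric_transition \<psi> S (chart_img d) (h c) (h d)"
  proof
    show "open S" "open (chart_img d)"
      using S chart_open(2)[OF id] by auto
    show "\<psi> x \<in> chart_img d" if "x \<in> S" for x
      using that \<psi> by (auto simp: S_def)
    show "twice_differentiable_on \<psi> S" "twice_differentiable_on (jac \<psi>) S"
      using sm S by (simp_all add: smooth_on_twice_differentiable twice_differentiable_on_jac)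
    show "twice_differentiable_on (h d) (chart_img d)"
      by (rule reg[OF d])
    show "twice_differentiable_on (h c) S"
      using reg[OF c] sub differentiable_on_subset unfolding twice_differentiable_on_def by blast
    show "det (h c x) \<noteq> 0" if "x \<in> S" for x
      using metric_det_nonzero[OF h c] sub that by blast
    show "det (h d x) \<noteq> 0" if "x \<in> chart_img d" for x
      by (rule metric_det_nonzero[OF h d that])
    show "transpose (h d x) = h d x" if "x \<in> chart_img d" for x
      using riemannian_metric_pos_def[OF h d that] by (simp add: pos_def_def)
    show "h c x = transpose (jac \<psi> x) ** h d (\<psi> x) ** jac \<psi> x" if "x \<in> S" for x
    proof -
      obtain q where q: "q \<in> chart_dom c" "q \<in> chart_dom d" "x = chart_map c q"
        using \<open>x \<in> S\<close> by (auto simp: S_def)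
      show ?thesis
        using riemannian_metric_transform[OF h c d q(1,2)] \<psi>[OF q(1)]
        by (simp add: jacobian_eq_jac q(3) \<psi>_def)
    qed
  qed
  have "chart_map c p \<in> S"
    using p by (auto simp: S_def)
  from ricci_transform[OF tr this] show ?thesis
    using \<psi>[OF p(1)] by (simp add: jacobian_eq_jac \<psi>_def o_def)
qed

text \<open>All that is known about the chart selected by \<open>SOME\<close> is that it belongs to
  the atlas and contains \<open>p\<close>; estimates must therefore hold in an unspecified
  chart.\<close>

lemma tensor_norm_sq_eq:
  assumes "smooth_atlas \<A>"
  obtains c where "c \<in> \<A>" "p \<in> chart_dom c"
    "tensor_norm_sq \<A> g h p = metric_norm_sq (g c (chart_map c p)) (h c (chart_map c p))"
proof -
  define c where "c = (SOME c. c \<in> \<A> \<and> p \<in> chart_dom c)"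
  have "\<exists>c. c \<in> \<A> \<and> p \<in> chart_dom c"
    using smooth_atlas_cover[OF assms, of p] by blast
  from someI_ex[OF this] have "c \<in> \<A> \<and> p \<in> chart_dom c"
    unfolding c_def .
  moreover have "tensor_norm_sq \<A> g h p = metric_norm_sq (g c (chart_map c p)) (h c (chart_map c p))"
    by (simp add: tensor_norm_sq_def metric_norm_sq_def c_def Let_def)
  ultimately show ?thesis
    using that by blast
qed

lemma quadratic_congruence:
  fixes J A :: "real^'n::finite^'n"
  shows "v \<bullet> ((transpose J ** A ** J) *v v) = (J *v v) \<bullet> (A *v (J *v v))"
  by (simp flip: matrix_vector_mul_assoc) (metis dot_lmul_matrix inner_commute)

text \<open>The lower bound is only needed in one chart around each point, since the Ricci tensor
  and the metric transform alike.\<close>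

lemma tensor_norm_sq_ricci_le:
  fixes \<A> :: "('a::topological_space, 'n::finite) chart set"
  assumes atlas: "smooth_atlas \<A>" and h: "riemannian_metric \<A> h"
    and reg: "\<And>c. c \<in> \<A> \<Longrightarrow> twice_differentiable_on (h c) (chart_img c)"
    and upper: "tensor_le \<A> (ricci h) (\<lambda>c x. k *\<^sub>R h c x)" and k: "k \<ge> 0"
    and lower: "\<And>p. \<exists>d\<in>\<A>. p \<in> chart_dom d \<and>
      (\<forall>v. - (k * (v \<bullet> (h d (chart_map d p) *v v))) \<le> v \<bullet> (ricci h d (chart_map d p) *v v))"
  shows "tensor_norm_sq \<A> h (ricci h) p \<le> real CARD('n) * k\<^sup>2"
proof -
  obtain c where c: "c \<in> \<A>" "p \<in> chart_dom c"
    and eq: "tensor_norm_sq \<A> h (ricci h) p = metric_norm_sq (h c (chart_map c p)) (ricci h c (chart_map c p))"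
    by (rule tensor_norm_sq_eq[OF atlas])
  obtain d where d: "d \<in> \<A>" "p \<in> chart_dom d" and ld:
      "\<And>v. - (k * (v \<bullet> (h d (chart_map d p) *v v))) \<le> v \<bullet> (ricci h d (chart_map d p) *v v)"
    using lower by blast
  let ?x = "chart_map c p"
  have x: "?x \<in> chart_img c"
    using c by simp
  note ic = smooth_atlas_chart[OF atlas c(1)]
  have pd: "pos_def (h c y)" if "y \<in> chart_img c" for y
    by (rule riemannian_metric_pos_def[OF h c(1) that])
  show ?thesis
    unfolding eq
  proof (rule metric_norm_sq_le[OF pd[OF x] _ k])
    show "transpose (ricci h c ?x) = ricci h c ?x"
    proof (rule ricci_symmetric[where g = h and c = c, OF reg[OF c(1)] chart_open(2)[OF ic] x])
      show "det (h c y) \<noteq> 0" if "y \<in> chart_img c" for y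
        by (rule metric_det_nonzero[OF h c(1) that])
      show "transpose (h c y) = h c y" if "y \<in> chart_img c" for y
        using pd[OF that] by (simp add: pos_def_def)
    qed
    fix v
    show "v \<bullet> (ricci h c ?x *v v) \<le> k * (v \<bullet> (h c ?x *v v))"
      using upper c x unfolding tensor_le_def by (auto simp: scaleR_matrix_vector_assoc[symmetric])
    show "- (k * (v \<bullet> (h c ?x *v v))) \<le> v \<bullet> (ricci h c ?x *v v)"
    proof -
      \<comment> \<open>Both quadratic forms at \<open>v\<close> equal their values in the chart
        \<open>d\<close> at the transported vector.\<close>
      let ?w = "jacobian id c d p *v v"
      have "v \<bullet> (ricci h c ?x *v v) = ?w \<bullet> (ricci h d (chart_map d p) *v ?w)"
        by (subst ricci_chart_transform[OF atlas h reg c(1) d(1) c(2) d(2)]) (auto intro: quadratic_congruence)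
      moreover have "v \<bullet> (h c ?x *v v) = ?w \<bullet> (h d (chart_map d p) *v ?w)"
        by (subst riemannian_metric_transform[OF h c(1) d(1) c(2) d(2)]) (rule quadratic_congruence)
      ultimately show ?thesis
        using ld[of ?w] by simp
    qed
  qed
qed

section \<open>Stability of the lower Ricci bound\<close>

lemma norm_le_holder_norm:
  assumes "x \<in> K"
  shows "ennreal (norm (f x)) \<le> holder_norm k \<alpha> K f"
proof -
  have "ennreal (norm (f x)) \<le> (SUP x\<in>K. ennreal (norm (f x)))"
    using assms by (intro SUP_upper)
  then show ?thesis
    by (cases k) (auto intro: order_trans)
qed

lemma holder_norm_partial_deriv_le: "holder_norm k \<alpha> K (partial_deriv i f) \<le> holder_norm (Suc k) \<alpha> K f"
proof -
  have "holder_norm k \<alpha> K (partial_deriv i f) \<le> (\<Sum>i\<in>UNIV. holder_norm k \<alpha> K (partial_deriv i f))"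
    by (rule member_le_sum) auto
  then show ?thesis
    by (auto intro: order_trans)
qed

lemma norm_vec_le_sum: "norm x \<le> (\<Sum>i\<in>UNIV. norm (x $ i))"
  unfolding norm_vec_def by (rule L2_set_le_sum) simp

lemma open_jet_domain:
  "open ({(M, D, E). det M \<noteq> 0} :: ((real^'n^'n) \<times> (real^'n^'n^'n) \<times> (real^'n^'n^'n^'n)) set)"
proof -
  have "({(M, D, E). det M \<noteq> 0} :: ((real^'n^'n) \<times> (real^'n^'n^'n) \<times> (real^'n^'n^'n^'n)) set) = {M. det M \<noteq> 0} \<times> UNIV"
    by auto
  then show ?thesis
    using open_det_nonzero[where 'n = 'n] by (simp add: open_Times)
qed

lemma bounded_bilinear_matrix_vector_mult:
  "bounded_bilinear ((*v) :: real^'n::finite^'m::finite \<Rightarrow> real^'n \<Rightarrow> real^'m)"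
  unfolding bilinear_conv_bounded_bilinear[symmetric] bilinear_def
  by (auto intro!: linearI simp: matrix_vector_mult_def vec_eq_iff algebra_simps sum.distrib sum_distrib_left)

text \<open>For \<open>G\<close> itself the form Ric + k G is 2 k G, hence positive. The 2-jets of
  \<open>G\<close> over \<open>K\<close>, paired with unit vectors, form a compact subset of the
  open set where this form is positive, so a uniform neighbourhood of them stays inside. Homogeneity
  extends the bound from unit vectors to all vectors.\<close>

lemma ricci_lower_bound_near:
  fixes G :: "real^'n::finite \<Rightarrow> real^'n^'n"
  assumes V: "open V" "compact K" "K \<subseteq> V" and G: "smooth_on V G"
    and pos: "\<And>x. x \<in> K \<Longrightarrow> pos_def (G x)" and k: "k > 0"
    and einstein: "\<And>x. x \<in> K \<Longrightarrow> jet_ricci (G x) (jet1 G x) (jet2 G x) = k *\<^sub>R G x"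
  shows "\<exists>\<epsilon>>0. \<forall>H. twice_differentiable_on H V \<longrightarrow> holder_norm 2 \<alpha> K (\<lambda>x. H x - G x) < \<epsilon> \<longrightarrow>
    (\<forall>x\<in>K. \<forall>v. - (k * (v \<bullet> (H x *v v))) \<le> v \<bullet> (jet_ricci (H x) (jet1 H x) (jet2 H x) *v v))"
proof -
  let ?\<Omega> = "{(M, D, E). det M \<noteq> 0} :: ((real^'n^'n) \<times> (real^'n^'n^'n) \<times> (real^'n^'n^'n^'n)) set"
  define J where "J F x = (F x, jet1 F x, jet2 F x)" for F :: "real^'n \<Rightarrow> real^'n^'n" and x
  define Q :: "((real^'n^'n) \<times> (real^'n^'n^'n) \<times> (real^'n^'n^'n^'n)) \<times> (real^'n) \<Rightarrow> real"
    where "Q = (\<lambda>((M, D, E), v). v \<bullet> (jet_ricci M D E *v v) + k * (v \<bullet> (M *v v)))"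
  have Q: "Q ((M, D, E), v) = v \<bullet> (jet_ricci M D E *v v) + k * (v \<bullet> (M *v v))" for M D E and v :: "real^'n"
    by (simp add: Q_def)
  define W where "W = (?\<Omega> \<times> UNIV) \<inter> Q -` {0<..}"
  have "continuous_on (?\<Omega> \<times> UNIV) Q"
    unfolding Q_def case_prod_unfold
    by (intro continuous_intros continuous_on_jet_ricci
        bounded_bilinear.continuous_on[OF bounded_bilinear_matrix_vector_mult]) auto
  then have "open W"
    unfolding W_def by (intro continuous_open_preimage open_Times open_jet_domain) auto
  have "continuous_on V (jet1 G)" "continuous_on V (jet2 G)"
    unfolding jet1_def[abs_def] jet2_def[abs_def]
    by (intro continuous_on_vec_lambda smooth_on_continuous_on smooth_on_partial_deriv G)+
  then have "continuous_on K (J G)"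
    unfolding J_def[abs_def] using V(3) smooth_on_continuous_on[OF G]
    by (intro continuous_on_Pair) (auto intro: continuous_on_subset)
  then have "compact (J G ` K \<times> sphere (0 :: real^'n) 1)"
    by (intro compact_Times compact_continuous_image V compact_sphere)
  moreover have "J G ` K \<times> sphere (0 :: real^'n) 1 \<subseteq> W"
  proof
    fix z
    assume "z \<in> J G ` K \<times> sphere (0 :: real^'n) 1"
    then obtain x v where z: "z = (J G x, v)" and x: "x \<in> K" and v: "norm v = 1"
      by auto
    have "v \<noteq> 0"
      using v by auto
    then have "v \<bullet> (G x *v v) > 0"
      using pos[OF x] by (simp add: pos_def_def)
    then have "Q z > 0"
      using k by (simp add: z J_def Q einstein[OF x] scaleR_matrix_vector_assoc[symmetric] add_pos_pos)
    moreover have "det (G x) \<noteq> 0"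
      using pos_def_det_pos[OF pos[OF x]] by simp
    ultimately show "z \<in> W"
      by (simp add: W_def z J_def)
  qed
  ultimately obtain \<delta> where \<delta>: "\<delta> > 0" "(\<Union>z\<in>J G ` K \<times> sphere (0 :: real^'n) 1. ball z \<delta>) \<subseteq> W"
    using compact_subset_open_imp_ball_epsilon_subset[OF _ \<open>open W\<close>] by metis
  define n where "n = real CARD('n)"
  \<comment> \<open>A 2-jet has \<open>1 + n + n * n\<close> matrix entries: the value, the first
    and the second derivatives. If each moves by less than \<open>\<eta>\<close>, the jet moves by
    less than \<open>\<delta>\<close>.\<close>
  define \<eta> where "\<eta> = \<delta> / (1 + n + n * n)"
  have \<eta>: "\<eta> > 0"
    using \<delta> by (simp add: \<eta>_def n_def add_pos_nonneg)
  have "- (k * (v \<bullet> (H x *v v))) \<le> v \<bullet> (jet_ricci (H x) (jet1 H x) (jet2 H x) *v v)"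
    if H: "twice_differentiable_on H V" and close: "holder_norm 2 \<alpha> K (\<lambda>x. H x - G x) < ennreal \<eta>"
      and x: "x \<in> K" for H x v
  proof (cases "v = 0")
    case False
    let ?f = "\<lambda>x. H x - G x"
    have xV: "x \<in> V"
      using x V by auto
    note dH = twice_differentiable_on_at[OF H V(1)]
    note dG = twice_differentiable_on_at[OF smooth_on_twice_differentiable[OF G] V(1)]
    have f1: "partial_deriv i ?f y = partial_deriv i H y - partial_deriv i G y" if "y \<in> V" for i y
      using that by (intro partial_deriv_diff dH dG)
    have f2: "partial_deriv j (partial_deriv i ?f) x = partial_deriv j (partial_deriv i H) x - partial_deriv j (partial_deriv i G) x" for i j
    proof -
      have "partial_deriv j (partial_deriv i ?f) x = partial_deriv j (\<lambda>y. partial_deriv i H y - partial_deriv i G y) x"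
        by (rule partial_deriv_cong[OF V(1) xV f1])
      then show ?thesis
        using xV by (simp add: partial_deriv_diff dH dG)
    qed
    have lt: "r < \<eta>" if "ennreal r \<le> holder_norm 2 \<alpha> K ?f" for r
      using le_less_trans[OF that close] by (meson ennreal_leI not_le)
    have hn1: "holder_norm (Suc 0) \<alpha> K (partial_deriv i ?f) \<le> holder_norm 2 \<alpha> K ?f" for i
      unfolding numeral_2_eq_2 by (rule holder_norm_partial_deriv_le)
    have hn2: "holder_norm 0 \<alpha> K (partial_deriv j (partial_deriv i ?f)) \<le> holder_norm 2 \<alpha> K ?f" for i j
      by (rule order_trans[OF holder_norm_partial_deriv_le hn1])
    have 0: "norm (H x - G x) < \<eta>"
      by (intro lt norm_le_holder_norm[where f = ?f] x)
    have 1: "norm (partial_deriv i H x - partial_deriv i G x) < \<eta>" for i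
      unfolding f1[OF xV, symmetric] by (intro lt order_trans[OF norm_le_holder_norm[OF x] hn1])
    have 2: "norm (partial_deriv j (partial_deriv i H) x - partial_deriv j (partial_deriv i G) x) < \<eta>" for i j
      unfolding f2[symmetric] by (intro lt order_trans[OF norm_le_holder_norm[OF x] hn2])
    have n1: "norm (jet1 H x - jet1 G x) \<le> n * \<eta>"
    proof -
      have "norm (jet1 H x - jet1 G x) \<le> (\<Sum>i\<in>(UNIV :: 'n set). \<eta>)"
        by (rule order_trans[OF norm_vec_le_sum sum_mono]) (simp add: jet1_def 1 less_imp_le)
      then show ?thesis
        by (simp add: n_def)
    qed
    have n2: "norm (jet2 H x - jet2 G x) \<le> n * (n * \<eta>)"
    proof -
      have row: "norm ((jet2 H x - jet2 G x) $ j) \<le> (\<Sum>i\<in>(UNIV :: 'n set). \<eta>)" for j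
        by (rule order_trans[OF norm_vec_le_sum sum_mono]) (simp add: jet2_def 2 less_imp_le)
      have "norm (jet2 H x - jet2 G x) \<le> (\<Sum>j\<in>(UNIV :: 'n set). \<Sum>i\<in>(UNIV :: 'n set). \<eta>)"
        by (rule order_trans[OF norm_vec_le_sum sum_mono]) (rule row)
      then show ?thesis
        by (simp add: n_def)
    qed
    have "dist (J H x) (J G x) \<le> norm (H x - G x) + (norm (jet1 H x - jet1 G x) + norm (jet2 H x - jet2 G x))"
      unfolding J_def dist_norm by (simp add: norm_Pair_le order_trans[OF norm_Pair_le add_left_mono[OF norm_Pair_le]])
    also have "\<dots> < \<eta> + (n * \<eta> + n * (n * \<eta>))"
      using 0 n1 n2 by linarith
    also have "\<dots> = \<eta> * (1 + n + n * n)"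
      by (simp add: algebra_simps)
    also have "\<dots> = \<delta>"
    proof -
      have "1 + n + n * n > 0"
        by (simp add: n_def add_pos_nonneg)
      then show ?thesis
        by (simp add: \<eta>_def)
    qed
    finally have near: "dist (J H x) (J G x) < \<delta>" .
    define u where "u = v /\<^sub>R norm v"
    have u: "norm u = 1" "v = norm v *\<^sub>R u"
      using False by (simp_all add: u_def)
    have "(J H x, u) \<in> ball (J G x, u) \<delta>"
      using near by (simp add: dist_Pair_Pair dist_commute)
    moreover have "(J G x, u) \<in> J G ` K \<times> sphere 0 1"
      using x u by simp
    ultimately have "(J H x, u) \<in> W"
      using \<delta>(2) by blast
    then have "u \<bullet> (jet_ricci (H x) (jet1 H x) (jet2 H x) *v u) + k * (u \<bullet> (H x *v u)) > 0"
      by (simp add: W_def J_def Q)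
    then have "(norm v)\<^sup>2 * (u \<bullet> (jet_ricci (H x) (jet1 H x) (jet2 H x) *v u) + k * (u \<bullet> (H x *v u))) \<ge> 0"
      by simp
    moreover have "v \<bullet> (A *v v) = (norm v)\<^sup>2 * (u \<bullet> (A *v u))" for A :: "real^'n^'n"
      by (subst (1 2) u(2)) (simp add: matrix_vector_mult_scaleR power2_eq_square)
    ultimately show ?thesis
      by (simp add: algebra_simps)
  qed simp
  then show ?thesis
    using \<eta> by (intro exI[of _ "ennreal \<eta>"]) auto
qed

text \<open>\<open>holder_nhd\<close> controls a metric only on finitely many compact subsets of
  chart images. Closed coordinate balls chosen by compactness cover the manifold, so this control
  reaches every point.\<close>

lemma finite_compact_chart_cover:
  fixes \<A> :: "('a::t2_space, 'n::finite) chart set"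
  assumes "closed_manifold \<A>"
  shows "\<exists>F. finite F \<and> (\<forall>(c, K)\<in>F. c \<in> \<A> \<and> compact K \<and> K \<subseteq> chart_img c) \<and>
    (\<forall>p. \<exists>(c, K)\<in>F. p \<in> chart_dom c \<and> chart_map c p \<in> K)"
proof -
  have atlas: "smooth_atlas \<A>" and comp: "compact (UNIV :: 'a set)"
    using assms by (auto simp: closed_manifold_def)
  have "\<exists>c K W. c \<in> \<A> \<and> compact K \<and> K \<subseteq> chart_img c \<and> open W \<and> p \<in> W \<and> W \<subseteq> chart_dom c \<and> chart_map c ` W \<subseteq> K" for p
  proof -
    obtain c where c: "c \<in> \<A>" "p \<in> chart_dom c"
      using smooth_atlas_cover[OF atlas] by blast
    note ic = smooth_atlas_chart[OF atlas c(1)]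
    obtain e where e: "e > 0" "cball (chart_map c p) e \<subseteq> chart_img c"
      using chart_open(2)[OF ic] c(2) by (metis open_contains_cball imageI)
    define W where "W = chart_dom c \<inter> chart_map c -` ball (chart_map c p) e"
    have W: "open W"
      unfolding W_def using homeomorphism_cont1[OF chart_homeo[OF ic]] chart_open(1)[OF ic]
      by (metis Int_commute continuous_on_open_vimage open_ball)
    have W': "p \<in> W" "W \<subseteq> chart_dom c" "chart_map c ` W \<subseteq> cball (chart_map c p) e"
      using c e by (auto simp: W_def)
    show ?thesis
      by (rule exI[of _ c], rule exI[of _ "cball (chart_map c p) e"], rule exI[of _ W])
        (intro conjI c(1) compact_cball e(2) W W')
  qed
  then obtain c K W where CKW: "\<And>p. c p \<in> \<A>" "\<And>p. compact (K p)" "\<And>p. K p \<subseteq> chart_img (c p)"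
    "\<And>p. open (W p)" "\<And>p. p \<in> W p" "\<And>p. W p \<subseteq> chart_dom (c p)" "\<And>p. chart_map (c p) ` W p \<subseteq> K p"
    by metis
  obtain P where P: "finite P" "UNIV \<subseteq> (\<Union>p\<in>P. W p)"
    using compactE_image[OF comp, of UNIV W] CKW by (metis UNIV_I UN_I subsetI)
  show ?thesis
  proof (intro exI[of _ "(\<lambda>p. (c p, K p)) ` P"] conjI allI)
    fix p
    obtain q where q: "q \<in> P" "p \<in> W q"
      using P(2) by blast
    then show "\<exists>(c, K)\<in>(\<lambda>p. (c p, K p)) ` P. p \<in> chart_dom c \<and> chart_map c p \<in> K"
      using CKW(6,7)[of q] by (intro bexI[of _ "(c q, K q)"]) auto
  qed (use P CKW in auto)
qed

definition holder_close ::
    "real \<Rightarrow> (('a, 'n::finite) chart \<times> (real^'n) set) set \<Rightarrow> ennreal \<Rightarrow> ('a, 'n) tensor2 \<Rightarrow> ('a, 'n) tensor2 \<Rightarrow> bool"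
  where "holder_close \<alpha> F \<epsilon> g h \<longleftrightarrow> (\<forall>(c, K)\<in>F. holder_norm 2 \<alpha> K (\<lambda>x. h c x - g c x) < \<epsilon>)"

lemma holder_nhd_iff:
  "holder_nhd 2 \<alpha> \<A> g U \<longleftrightarrow> U \<subseteq> Collect (holder_metric 2 \<alpha> \<A>) \<and>
     (\<exists>F \<epsilon>. finite F \<and> \<epsilon> > 0 \<and> (\<forall>(c, K)\<in>F. c \<in> \<A> \<and> compact K \<and> K \<subseteq> chart_img c) \<and>
       (\<forall>h. holder_metric 2 \<alpha> \<A> h \<longrightarrow> holder_close \<alpha> F \<epsilon> g h \<longrightarrow> h \<in> U))"
  by (simp only: holder_nhd_def holder_close_def)

text \<open>\<open>ricci_lower_bound_near\<close> is applied on each set of a finite compact cover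
  and the smallest radius is kept. A point receives the bound in one chart only, which is the form
  that \<open>tensor_norm_sq_ricci_le\<close> accepts.\<close>

lemma ricci_lower_bound_nhd:
  fixes \<A> :: "('a::t2_space, 'n::finite) chart set"
  assumes M: "closed_manifold \<A>" and g: "smooth_metric \<A> g" and k: "k > 0"
    and einstein: "tensor_eq \<A> (ricci g) (\<lambda>c x. k *\<^sub>R g c x)"
  shows "\<exists>F \<epsilon>. finite F \<and> \<epsilon> > 0 \<and> (\<forall>(c, K)\<in>F. c \<in> \<A> \<and> compact K \<and> K \<subseteq> chart_img c) \<and>
    (\<forall>h. holder_metric 2 \<alpha> \<A> h \<longrightarrow> holder_close \<alpha> F \<epsilon> g h \<longrightarrow>
      (\<forall>p. \<exists>d\<in>\<A>. p \<in> chart_dom d \<and>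
        (\<forall>v. - (k * (v \<bullet> (h d (chart_map d p) *v v))) \<le> v \<bullet> (ricci h d (chart_map d p) *v v))))"
proof -
  have atlas: "smooth_atlas \<A>"
    using M by (simp add: closed_manifold_def)
  have rg: "riemannian_metric \<A> g" and sg: "\<And>c. c \<in> \<A> \<Longrightarrow> smooth_on (chart_img c) (g c)"
    using g unfolding smooth_metric_def by blast+
  obtain F where F: "finite F" "\<And>c K. (c, K) \<in> F \<Longrightarrow> c \<in> \<A> \<and> compact K \<and> K \<subseteq> chart_img c"
    "\<And>p. \<exists>(c, K)\<in>F. p \<in> chart_dom c \<and> chart_map c p \<in> K"
  proof -
    obtain F where F: "finite F" "\<forall>(c, K)\<in>F. c \<in> \<A> \<and> compact K \<and> K \<subseteq> chart_img c"
      "\<forall>p. \<exists>(c, K)\<in>F. p \<in> chart_dom c \<and> chart_map c p \<in> K"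
      using finite_compact_chart_cover[OF M] by blast
    show ?thesis
    proof (rule that[OF F(1)])
      show "c \<in> \<A> \<and> compact K \<and> K \<subseteq> chart_img c" if "(c, K) \<in> F" for c K
        using F(2) that by blast
      show "\<exists>(c, K)\<in>F. p \<in> chart_dom c \<and> chart_map c p \<in> K" for p
        using F(3) by blast
    qed
  qed
  have ric: "ricci h c x = jet_ricci (h c x) (jet1 (h c) x) (jet2 (h c) x)"
    if "riemannian_metric \<A> h" "c \<in> \<A>" "twice_differentiable_on (h c) (chart_img c)" "x \<in> chart_img c" for h c x
    using that(3) chart_open(2)[OF smooth_atlas_chart[OF atlas that(2)]] that(4) metric_det_nonzero[OF that(1,2)]
    by (rule ricci_eq_jet)
  define P where "P ck \<epsilon> \<longleftrightarrow> (case ck of (c, K) \<Rightarrow> \<forall>H. twice_differentiable_on H (chart_img c) \<longrightarrow>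
      holder_norm 2 \<alpha> K (\<lambda>x. H x - g c x) < \<epsilon> \<longrightarrow>
      (\<forall>x\<in>K. \<forall>v. - (k * (v \<bullet> (H x *v v))) \<le> v \<bullet> (jet_ricci (H x) (jet1 H x) (jet2 H x) *v v)))"
    for ck :: "('a, 'n) chart \<times> (real^'n) set" and \<epsilon> :: ennreal
  have "\<exists>\<epsilon>>0. P ck \<epsilon>" if ck: "ck \<in> F" for ck
  proof -
    obtain c K where [simp]: "ck = (c, K)"
      by (cases ck)
    have c: "c \<in> \<A>" "compact K" "K \<subseteq> chart_img c"
      using F(2) ck by auto
    show ?thesis
      unfolding P_def \<open>ck = (c, K)\<close> prod.case
    proof (rule ricci_lower_bound_near[OF chart_open(2)[OF smooth_atlas_chart[OF atlas c(1)]] c(2,3) sg[OF c(1)] _ k])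
      show "pos_def (g c x)" if "x \<in> K" for x
        using riemannian_metric_pos_def[OF rg c(1)] that c by blast
      show "jet_ricci (g c x) (jet1 (g c) x) (jet2 (g c) x) = k *\<^sub>R g c x" if "x \<in> K" for x
        using ric[OF rg c(1) smooth_on_twice_differentiable[OF sg[OF c(1)]], of x] einstein that c
        unfolding tensor_eq_def by (metis subsetD)
    qed
  qed
  then obtain e where e: "\<And>ck. ck \<in> F \<Longrightarrow> e ck > 0" "\<And>ck. ck \<in> F \<Longrightarrow> P ck (e ck)"
    by metis
  \<comment> \<open>The extra \<open>1\<close> makes the set nonempty for any \<open>F\<close>, so
    that \<open>Min\<close> is meaningful.\<close>
  define \<epsilon> where "\<epsilon> = Min (insert 1 (e ` F))"
  have \<epsilon>: "\<epsilon> > 0" "\<And>ck. ck \<in> F \<Longrightarrow> \<epsilon> \<le> e ck"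
    using F(1) e(1) by (auto simp: \<epsilon>_def Min_gr_iff)
  have "\<exists>d\<in>\<A>. p \<in> chart_dom d \<and>
      (\<forall>v. - (k * (v \<bullet> (h d (chart_map d p) *v v))) \<le> v \<bullet> (ricci h d (chart_map d p) *v v))"
    if h: "holder_metric 2 \<alpha> \<A> h" and close: "holder_close \<alpha> F \<epsilon> g h" for h p
  proof -
    obtain c K where ck: "(c, K) \<in> F" and p: "p \<in> chart_dom c" "chart_map c p \<in> K"
      using F(3)[of p] by blast
    have c: "c \<in> \<A>" "K \<subseteq> chart_img c"
      using F(2)[OF ck] by auto
    have rh: "riemannian_metric \<A> h" "twice_differentiable_on (h c) (chart_img c)"
      using h c holder_on_twice_differentiable unfolding holder_metric_def by blast+
    have "holder_norm 2 \<alpha> K (\<lambda>x. h c x - g c x) < e (c, K)"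
      using close ck \<epsilon>(2)[OF ck] unfolding holder_close_def by (auto intro: less_le_trans)
    then have "\<forall>v. - (k * (v \<bullet> (h c (chart_map c p) *v v))) \<le>
        v \<bullet> (ricci h c (chart_map c p) *v v)"
      using e(2)[OF ck] rh p c unfolding P_def by (simp add: ric[OF rh(1) c(1) rh(2)])
    then show ?thesis
      using c p by blast
  qed
  moreover have "\<forall>(c, K)\<in>F. c \<in> \<A> \<and> compact K \<and> K \<subseteq> chart_img c"
    using F(2) by blast
  ultimately show ?thesis
    using F(1) \<epsilon>(1) by blast
qed


section \<open>Pullbacks by diffeomorphisms and their volume\<close>

lemma holder_diffeo_chart:
  fixes \<A> :: "('a::topological_space, 'n::finite) chart set"
  assumes atlas: "smooth_atlas \<A>" and \<phi>: "holder_diffeo 3 \<alpha> \<A> \<phi>"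
    and c: "c \<in> \<A>" and d: "d \<in> \<A>" and p: "p \<in> chart_dom c" "\<phi> p \<in> chart_dom d"
  shows "(chart_map d \<circ> \<phi> \<circ> chart_inv c) differentiable at (chart_map c p)"
proof -
  let ?S = "chart_map c ` (chart_dom c \<inter> \<phi> -` chart_dom d)"
  have m: "continuous_on UNIV \<phi>" "holder_on 3 \<alpha> ?S (chart_map d \<circ> \<phi> \<circ> chart_inv c)"
    using \<phi> c d unfolding holder_diffeo_def holder_map_def by blast+
  have "open (\<phi> -` chart_dom d)"
    using m(1) chart_open(1)[OF smooth_atlas_chart[OF atlas d]] by (simp add: continuous_on_open_vimage)
  then have "open ?S"
    by (rule overlap_image_open[OF atlas c])
  moreover have "(chart_map d \<circ> \<phi> \<circ> chart_inv c) differentiable_on ?S"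
    using m(2) by (simp add: numeral_3_eq_3)
  ultimately show ?thesis
    using p by (intro differentiable_on_open_at[of _ ?S]) auto
qed

lemma jacobian_change_chart:
  fixes \<A> :: "('a::topological_space, 'n::finite) chart set"
  assumes atlas: "smooth_atlas \<A>" and \<phi>: "holder_diffeo 3 \<alpha> \<A> \<phi>"
    and c: "c \<in> \<A>" and d: "d \<in> \<A>" "d' \<in> \<A>"
    and p: "p \<in> chart_dom c" "\<phi> p \<in> chart_dom d" "\<phi> p \<in> chart_dom d'"
  shows "jacobian \<phi> c d' p = jacobian id d d' (\<phi> p) ** jacobian \<phi> c d p"
proof -
  note ic = smooth_atlas_chart[OF atlas c] and id = smooth_atlas_chart[OF atlas d(1)]
    and id' = smooth_atlas_chart[OF atlas d(2)]
  let ?f = "chart_map d' \<circ> chart_inv d" and ?\<psi> = "chart_map d \<circ> \<phi> \<circ> chart_inv c"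
  let ?V = "\<phi> -` (chart_dom d \<inter> chart_dom d')"
  let ?S = "chart_map c ` (chart_dom c \<inter> ?V)"
  have "continuous_on UNIV \<phi>"
    using \<phi> unfolding holder_diffeo_def holder_map_def by blast
  then have "open ?V"
    using chart_open(1)[OF id] chart_open(1)[OF id'] by (simp add: continuous_on_open_vimage open_Int)
  then have S: "open ?S"
    by (rule overlap_image_open[OF atlas c])
  have xS: "chart_map c p \<in> ?S"
    using p by auto
  have \<psi>p: "?\<psi> (chart_map c p) = chart_map d (\<phi> p)"
    using chart_inv_map[OF ic p(1)] by simp
  have "jac (chart_map d' \<circ> \<phi> \<circ> chart_inv c) (chart_map c p) = jac (?f \<circ> ?\<psi>) (chart_map c p)"
  proof (rule jac_cong[OF S xS])
    fix y
    assume "y \<in> ?S"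
    then obtain q where q: "q \<in> chart_dom c" "\<phi> q \<in> chart_dom d" "y = chart_map c q"
      by auto
    show "(chart_map d' \<circ> \<phi> \<circ> chart_inv c) y = (?f \<circ> ?\<psi>) y"
      using chart_inv_map[OF ic q(1)] chart_inv_map[OF id q(2)] by (simp add: q(3))
  qed
  also have "\<dots> = jac ?f (?\<psi> (chart_map c p)) ** jac ?\<psi> (chart_map c p)"
  proof (rule jac_compose)
    show "?\<psi> differentiable at (chart_map c p)"
      by (rule holder_diffeo_chart[OF atlas \<phi> c d(1) p(1,2)])
    have "?f differentiable_on chart_map d ` (chart_dom d \<inter> chart_dom d')"
      by (rule smooth_on_differentiable_on[OF transition_smooth[OF atlas d]])
    then show "?f differentiable at (?\<psi> (chart_map c p))"
      unfolding \<psi>p using p overlap_image_open[OF atlas d(1) chart_open(1)[OF id']]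
      by (intro differentiable_on_open_at[of _ "chart_map d ` (chart_dom d \<inter> chart_dom d')"]) auto
  qed
  finally show ?thesis
    unfolding \<psi>p by (simp add: jacobian_eq_jac)
qed

text \<open>The chart chosen by \<open>SOME\<close> may be exchanged for any chart around the image
  point: the chain rule for the Jacobian cancels the transformation law of \<open>g\<close>.\<close>

lemma pullback_eq:
  fixes \<A> :: "('a::topological_space, 'n::finite) chart set"
  assumes atlas: "smooth_atlas \<A>" and g: "riemannian_metric \<A> g" and \<phi>: "holder_diffeo 3 \<alpha> \<A> \<phi>"
    and c: "c \<in> \<A>" and d: "d \<in> \<A>" and p: "p \<in> chart_dom c" "\<phi> p \<in> chart_dom d"
  shows "pullback \<A> \<phi> g c (chart_map c p) =
    transpose (jacobian \<phi> c d p) ** g d (chart_map d (\<phi> p)) ** jacobian \<phi> c d p"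
proof -
  define e where "e = (SOME d. d \<in> \<A> \<and> \<phi> p \<in> chart_dom d)"
  have "\<exists>d. d \<in> \<A> \<and> \<phi> p \<in> chart_dom d"
    using d p by blast
  from someI_ex[OF this] have e: "e \<in> \<A>" "\<phi> p \<in> chart_dom e"
    unfolding e_def by blast+
  have "pullback \<A> \<phi> g c (chart_map c p) =
      transpose (jacobian \<phi> c e p) ** g e (chart_map e (\<phi> p)) ** jacobian \<phi> c e p"
    using chart_inv_map[OF smooth_atlas_chart[OF atlas c] p(1)]
    by (simp add: pullback_def Let_def e_def)
  also have "\<dots> = transpose (jacobian \<phi> c d p) ** g d (chart_map d (\<phi> p)) ** jacobian \<phi> c d p"
    unfolding jacobian_change_chart[OF atlas \<phi> c e(1) d p(1) e(2) p(2)]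
    by (subst riemannian_metric_transform[OF g e(1) d e(2) p(2)])
      (simp add: matrix_transpose_mul matrix_mul_assoc)
  finally show ?thesis .
qed

lemma vol_exp_pullback:
  fixes \<A> :: "('a::t2_space, 'n::finite) chart set"
  assumes M: "closed_manifold \<A>" and g: "continuous_metric \<A> g" and h: "continuous_metric \<A> h"
    and \<phi>: "holder_diffeo 3 \<alpha> \<A> \<phi>" and r: "r > 0"
    and eq: "tensor_eq \<A> h (\<lambda>c x. r *\<^sub>R pullback \<A> \<phi> g c x)"
  shows "vol \<A> h = sqrt (r ^ CARD('n)) * vol \<A> g"
proof (rule vol_scaled_pullback[OF M g h _ _ _ _ r])
  have atlas: "smooth_atlas \<A>"
    using M by (simp add: closed_manifold_def)
  show "bij \<phi>" "continuous_on UNIV \<phi>" "continuous_on UNIV (inv \<phi>)"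
    using \<phi> unfolding holder_diffeo_def holder_map_def by blast+
  fix c d p
  assume cdp: "c \<in> \<A>" "d \<in> \<A>" "p \<in> chart_dom c" "\<phi> p \<in> chart_dom d"
  show "(chart_map d \<circ> \<phi> \<circ> chart_inv c) differentiable at (chart_map c p)"
    by (rule holder_diffeo_chart[OF atlas \<phi> cdp])
  show "h c (chart_map c p) =
      r *\<^sub>R (transpose (jacobian \<phi> c d p) ** g d (chart_map d (\<phi> p)) ** jacobian \<phi> c d p)"
    using eq cdp unfolding tensor_eq_def
    by (simp add: pullback_eq[OF atlas continuous_metricD(1)[OF g] \<phi> cdp, symmetric])
qed

section \<open>The functional as a power of the volume\<close>

lemma powr_volume: "(v::real) > 0 \<Longrightarrow> v powr (a - 1) * (k * v) = k * v powr a"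
  by (simp add: powr_diff)

text \<open>In an orthonormal frame the Ricci tensor is \<open>k\<close> times the identity, so the
  integrand is constant. Its integral is that constant times the volume, which raises the exponent
  4/n - 1 of the prefactor to 4/n.\<close>

lemma ricci_functional_einstein:
  fixes \<A> :: "('a::t2_space, 'n::finite) chart set"
  assumes M: "closed_manifold \<A>" and g: "continuous_metric \<A> g"
    and einstein: "tensor_eq \<A> (ricci g) (\<lambda>c x. k *\<^sub>R g c x)"
  shows "ricci_functional \<A> g = real CARD('n) * k\<^sup>2 * vol \<A> g powr (4 / real CARD('n))"
proof -
  have atlas: "smooth_atlas \<A>"
    using M by (simp add: closed_manifold_def)
  have "tensor_norm_sq \<A> g (ricci g) p = real CARD('n) * k\<^sup>2" for p
  proof -
    obtain c where c: "c \<in> \<A>" "p \<in> chart_dom c"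
      and eq: "tensor_norm_sq \<A> g (ricci g) p = metric_norm_sq (g c (chart_map c p)) (ricci g c (chart_map c p))"
      by (rule tensor_norm_sq_eq[OF atlas])
    have "ricci g c (chart_map c p) = k *\<^sub>R g c (chart_map c p)"
      using einstein c unfolding tensor_eq_def by blast
    then show ?thesis
      unfolding eq using metric_norm_sq_scaled[OF continuous_metric_pos_def[OF g c(1)], of "chart_map c p"] c(2)
      by simp
  qed
  then have "(\<integral>p. tensor_norm_sq \<A> g (ricci g) p \<partial>riem_measure \<A> g) = real CARD('n) * k\<^sup>2 * vol \<A> g"
    using is_riem_measure_riem_measure[OF M g]
    by (simp add: vol_def is_riem_measure_def sets_eq_imp_space_eq)
  then show ?thesis
    unfolding ricci_functional_def by (simp add: powr_volume vol_pos[OF M g])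
qed

lemma ricci_functional_le:
  fixes \<A> :: "('a::t2_space, 'n::finite) chart set"
  assumes M: "closed_manifold \<A>" and h: "continuous_metric \<A> h"
    and le: "\<And>p. tensor_norm_sq \<A> h (ricci h) p \<le> C" and C: "C \<ge> 0"
  shows "ricci_functional \<A> h \<le> C * vol \<A> h powr (4 / real CARD('n))"
proof -
  let ?\<mu> = "riem_measure \<A> h"
  interpret finite_measure ?\<mu>
    by (rule finite_riem_measure[OF M h])
  have space: "space ?\<mu> = UNIV"
    using is_riem_measure_riem_measure[OF M h] by (simp add: is_riem_measure_def sets_eq_imp_space_eq)
  note pos = vol_pos[OF M h]
  have "(\<integral>p. tensor_norm_sq \<A> h (ricci h) p \<partial>?\<mu>) \<le> C * vol \<A> h"
  proof (cases "integrable ?\<mu> (tensor_norm_sq \<A> h (ricci h))")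
    case True
    then have "(\<integral>p. tensor_norm_sq \<A> h (ricci h) p \<partial>?\<mu>) \<le> (\<integral>p. C \<partial>?\<mu>)"
      by (rule integral_mono) (use le in auto)
    then show ?thesis
      by (simp add: vol_def space mult.commute)
  next
    \<comment> \<open>The integral of a non-integrable function is 0 by convention, which is below
      the nonnegative bound. This disposes of the measurability of the squared norm.\<close>
    case False
    then show ?thesis
      using C pos by (simp add: not_integrable_integral_eq)
  qed
  then have "ricci_functional \<A> h \<le> vol \<A> h powr (4 / real CARD('n) - 1) * (C * vol \<A> h)"
    unfolding ricci_functional_def by (rule mult_left_mono) simp
  then show ?thesis
    by (simp add: powr_volume pos)
qed

theorem theorem1p13:
  fixes \<A> :: "('a::t2_space, 'n::finite) chart set"
    and g :: "('a, 'n) tensor2"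
    and \<alpha> :: real
  assumes "closed_manifold \<A>"
    and "CARD('n) \<ge> 3"
    and "0 < \<alpha>" and "\<alpha> < 1"
    and "smooth_metric \<A> g"
    and "tensor_eq \<A> (ricci g) (\<lambda>c x. (real CARD('n) - 1) *\<^sub>R g c x)"
    and "strict_local_minimizer \<alpha> \<A> g"
  shows "\<exists>U. holder_nhd 2 \<alpha> \<A> g U \<and>
           (\<forall>h\<in>U. tensor_le \<A> (ricci h) (\<lambda>c x. (real CARD('n) - 1) *\<^sub>R h c x) \<longrightarrow>
              vol \<A> h \<ge> vol \<A> g \<and>
              (vol \<A> h = vol \<A> g \<longleftrightarrow>
                 (\<exists>\<phi>. holder_diffeo 3 \<alpha> \<A> \<phi> \<and> tensor_eq \<A> h (pullback \<A> \<phi> g))))"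
proof -
  note M = assms(1)
  define n where "n = real CARD('n)"
  define k where "k = n - 1"
  have n: "n \<ge> 3"
    using assms(2) by (simp add: n_def)
  have k: "k > 0"
    using n by (simp add: k_def)
  have atlas: "smooth_atlas \<A>"
    using M by (simp add: closed_manifold_def)
  have g: "continuous_metric \<A> g"
    by (rule smooth_metric_continuous[OF assms(5)])
  have einstein: "tensor_eq \<A> (ricci g) (\<lambda>c x. k *\<^sub>R g c x)"
    using assms(6) by (simp add: k_def n_def)
  obtain U0 where U0: "holder_nhd 2 \<alpha> \<A> g U0"
    "\<And>h. h \<in> U0 \<Longrightarrow> ricci_functional \<A> h \<ge> ricci_functional \<A> g"
    "\<And>h. h \<in> U0 \<Longrightarrow> ricci_functional \<A> h = ricci_functional \<A> g \<Longrightarrow>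
       \<exists>\<phi> s. holder_diffeo 3 \<alpha> \<A> \<phi> \<and> tensor_eq \<A> h (\<lambda>c x. exp s *\<^sub>R pullback \<A> \<phi> g c x)"
    using assms(7) unfolding strict_local_minimizer_def by blast
  have U0_metric: "holder_metric 2 \<alpha> \<A> h" if "h \<in> U0" for h
    using conjunct1[OF U0(1)[unfolded holder_nhd_iff]] that by auto
  obtain F0 \<epsilon>0 where F0: "finite F0 \<and> \<epsilon>0 > 0 \<and>
      (\<forall>(c, K)\<in>F0. c \<in> \<A> \<and> compact K \<and> K \<subseteq> chart_img c) \<and>
      (\<forall>h. holder_metric 2 \<alpha> \<A> h \<longrightarrow> holder_close \<alpha> F0 \<epsilon>0 g h \<longrightarrow> h \<in> U0)"
    using conjunct2[OF U0(1)[unfolded holder_nhd_iff]] by (elim exE) (rule that)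
  obtain F1 \<epsilon>1 where F1: "finite F1 \<and> \<epsilon>1 > 0 \<and>
      (\<forall>(c, K)\<in>F1. c \<in> \<A> \<and> compact K \<and> K \<subseteq> chart_img c) \<and>
      (\<forall>h. holder_metric 2 \<alpha> \<A> h \<longrightarrow> holder_close \<alpha> F1 \<epsilon>1 g h \<longrightarrow>
        (\<forall>p. \<exists>d\<in>\<A>. p \<in> chart_dom d \<and>
          (\<forall>v. - (k * (v \<bullet> (h d (chart_map d p) *v v))) \<le> v \<bullet> (ricci h d (chart_map d p) *v v))))"
    using ricci_lower_bound_nhd[OF M assms(5) k einstein, of \<alpha>] by (elim exE) (rule that)
  \<comment> \<open>Membership in \<open>U0\<close> provides minimality of \<open>g\<close>,
    closeness on \<open>F1\<close> the lower Ricci bound.\<close>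
  define U where "U = {h \<in> U0. holder_close \<alpha> F1 \<epsilon>1 g h}"
  have "holder_nhd 2 \<alpha> \<A> g U"
    unfolding holder_nhd_iff
  \<comment> \<open>Joining the two families of compact sets and taking the smaller radius imposes
    both closeness conditions.\<close>
  proof (intro conjI exI[of _ "F0 \<union> F1"] exI[of _ "min \<epsilon>0 \<epsilon>1"] allI impI)
    show "U \<subseteq> Collect (holder_metric 2 \<alpha> \<A>)"
      using U0_metric by (auto simp: U_def)
    show "finite (F0 \<union> F1)" "min \<epsilon>0 \<epsilon>1 > 0"
      using F0 F1 by auto
    show "\<forall>(c, K)\<in>F0 \<union> F1. c \<in> \<A> \<and> compact K \<and> K \<subseteq> chart_img c"
      using F0 F1 by blast
    fix h
    assume h: "holder_metric 2 \<alpha> \<A> h" and "holder_close \<alpha> (F0 \<union> F1) (min \<epsilon>0 \<epsilon>1) g h"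
    then have "holder_close \<alpha> F0 \<epsilon>0 g h" "holder_close \<alpha> F1 \<epsilon>1 g h"
      unfolding holder_close_def by auto
    then show "h \<in> U"
      using F0 h by (simp add: U_def)
  qed
  moreover have "vol \<A> h \<ge> vol \<A> g \<and>
      (vol \<A> h = vol \<A> g \<longleftrightarrow> (\<exists>\<phi>. holder_diffeo 3 \<alpha> \<A> \<phi> \<and> tensor_eq \<A> h (pullback \<A> \<phi> g)))"
    if hU: "h \<in> U" and "tensor_le \<A> (ricci h) (\<lambda>c x. (real CARD('n) - 1) *\<^sub>R h c x)" for h
  proof -
    have upper: "tensor_le \<A> (ricci h) (\<lambda>c x. k *\<^sub>R h c x)"
      using that(2) by (simp add: k_def n_def)
    have hU0: "h \<in> U0" and close: "holder_close \<alpha> F1 \<epsilon>1 g h"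
      using hU by (auto simp: U_def)
    note hm = U0_metric[OF hU0]
    have h: "continuous_metric \<A> h"
      by (rule holder_metric_continuous[OF hm])
    have reg: "twice_differentiable_on (h c) (chart_img c)" if "c \<in> \<A>" for c
      using hm that holder_on_twice_differentiable unfolding holder_metric_def by blast
    let ?a = "4 / real CARD('n)"
    have a: "?a > 0"
      by simp
    define C where "C = real CARD('n) * k\<^sup>2"
    have C: "C > 0"
      using k by (simp add: C_def)
    have Fh: "ricci_functional \<A> h \<le> C * vol \<A> h powr ?a"
    proof (rule ricci_functional_le[OF M h])
      show "tensor_norm_sq \<A> h (ricci h) p \<le> C" for p
        unfolding C_def
        by (rule tensor_norm_sq_ricci_le[OF atlas continuous_metricD(1)[OF h] reg upper])
          (use k F1 hm close in \<open>auto simp: less_imp_le\<close>)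
    qed (use C in simp)
    have Fg: "ricci_functional \<A> g = C * vol \<A> g powr ?a"
      unfolding C_def by (rule ricci_functional_einstein[OF M g einstein])
    note pos = vol_pos[OF M g] vol_pos[OF M h]
    have "C * vol \<A> g powr ?a \<le> C * vol \<A> h powr ?a"
      using U0(2)[OF hU0] Fh Fg by simp
    then have "vol \<A> g powr ?a \<le> vol \<A> h powr ?a"
      using C by simp
    \<comment> \<open>The exponent 4/n is positive, so the power is strictly increasing in the
      volume.\<close>
    then have ge: "vol \<A> h \<ge> vol \<A> g"
      using powr_less_mono2[OF a, of "vol \<A> h" "vol \<A> g"] pos by (meson less_imp_le not_le)
    have vol_eq: "vol \<A> h = sqrt (r ^ CARD('n)) * vol \<A> g"
      if "holder_diffeo 3 \<alpha> \<A> \<phi>" "r > 0" "tensor_eq \<A> h (\<lambda>c x. r *\<^sub>R pullback \<A> \<phi> g c x)" for \<phi> r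
      by (rule vol_exp_pullback[OF M g h that])
    have "\<exists>\<phi>. holder_diffeo 3 \<alpha> \<A> \<phi> \<and> tensor_eq \<A> h (pullback \<A> \<phi> g)" if eq: "vol \<A> h = vol \<A> g"
    proof -
      \<comment> \<open>With equal volumes the chain closes up: the upper bound \<open>Fh\<close>
        for \<open>h\<close> coincides with the value \<open>Fg\<close> at \<open>g\<close>, which
        is at most the value at \<open>h\<close> by minimality.\<close>
      have "ricci_functional \<A> h = ricci_functional \<A> g"
        using U0(2)[OF hU0] Fh Fg eq by simp
      from U0(3)[OF hU0 this] obtain \<phi> s where \<phi>: "holder_diffeo 3 \<alpha> \<A> \<phi>"
        "tensor_eq \<A> h (\<lambda>c x. exp s *\<^sub>R pullback \<A> \<phi> g c x)"
        by blast
      \<comment> \<open>The scaling factor of the volume formula is 1, since the volumes agree and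
        are positive; its n-th power structure then forces \<open>exp s = 1\<close>.\<close>
      from vol_eq[OF \<phi>(1) _ \<phi>(2)] have "sqrt (exp s ^ CARD('n)) = 1"
        using eq pos by simp
      then have "exp s ^ CARD('n) = 1"
        by simp
      then have "exp s = 1"
        by (simp add: exp_of_nat_mult[symmetric])
      then show ?thesis
        using \<phi> by auto
    qed
    \<comment> \<open>The converse is the volume formula with scaling factor 1.\<close>
    moreover have "vol \<A> h = vol \<A> g" if "holder_diffeo 3 \<alpha> \<A> \<phi>" "tensor_eq \<A> h (pullback \<A> \<phi> g)" for \<phi>
      using vol_eq[OF that(1), of 1] that(2) by simp
    ultimately show ?thesis
      using ge by blast
  qed
  ultimately show ?thesis
    by blast
qed

end
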